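(* Let $H$ be a finite-dimensional Hopf algebra over a field $\Bbbk$, $B$ a left coideal subalgebra with inclusion $\iota$, $C:=H/B^+H$, and $(\zeta,\gamma^* )$ a partially admissible mapping system for $\iota$. Let $C^*\#B$ be the left partial dual of $H$ determined by $(\zeta,\gamma^* )$, and let $B^{\mathrm{op\,cop}}\#C^{*\,\mathrm{op\,cop}}$ be the left partial dual of $H^{*\,\mathrm{op\,cop}}$ determined by the partially admissible mapping system $(\gamma^*,\zeta)$ for $\pi^*:C^{*\,\mathrm{op\,cop}}\rightarrowtail H^{*\,\mathrm{op\,cop}}$. Then $$\vartheta:(C^*\#B)^{\mathrm{op\,cop}}\cong B^{\mathrm{op\,cop}}\#C^{*\,\mathrm{op\,cop}},\qquad f\#b\mapsto b\#f$$ is an isomorphism of quasi-bialgebras. Furthermore, if the element $\boldsymbol\upsilon=\sum_i(\varepsilon\#b_i)(\overline\gamma^*[\overline\zeta^*(b_i^* )]\#1)\in C^*\#B$ is invertible, then: (1) The antipode $(\boldsymbol S_1,\varepsilon\#1,\boldsymbol\upsilon)$ of the quasi-Hopf algebra $(C^*\#B)^{\mathrm{op\,cop}}$ is carried by $\vartheta$ to an antipode $(\vartheta\circ\boldsymbol S_1\circ\vartheta^{-1},\ 1\#\varepsilon,\ \vartheta(\boldsymbol\upsilon))$ of $B^{\mathrm{op\,cop}}\#C^{*\,\mathrm{op\,cop}}$; (2) The antipode $(\boldsymbol S_2,\boldsymbol\upsilon,\varepsilon\#1)$ of $(C^*\#B)^{\mathrm{op\,cop}}$ is carried by $\vartheta$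 to an antipode $(\vartheta\circ\boldsymbol S_2\circ\vartheta^{-1},\ \vartheta(\boldsymbol\upsilon),\ 1\#\varepsilon)$ of $B^{\mathrm{op\,cop}}\#C^{*\,\mathrm{op\,cop}}$.
   Context: All spaces are over $\Bbbk$; $\otimes=\otimes_\Bbbk$; $(-)^*$ denotes linear dual/transpose; $\langle-,-\rangle$ evaluation; Sweedler notation is used. Partially admissible mapping system. Let $H$ be a finite-dimensional Hopf algebra, $\iota:B\rightarrowtail H$ an injective map of left $H$-comodule algebras, $\pi:H\twoheadrightarrow C$ a surjective map of right $H$-module coalgebras (action $\blacktriangleleft$ on $C$), with $\iota(B)=\{h\in H:\sum h_{(1)}\otimes\pi(h_{(2)})=h\otimes\pi(1)\}$ (for a left coideal subalgebra $B$, take $C=H/B^+H$, $B^+=B\cap\ker\varepsilon$). A partially admissible mapping system $(\zeta,\gamma^* )$ for $\iota$ consists of linear maps $\zeta:H\to B$, $\gamma:C\to H$ (with transposes $\zeta^*:B^*\to H^*$, $\gamma^*:H^*\to C^*$) such that: $\zeta,\gamma$ have convolution inverses $\overline\zeta,\overline\gamma$; $\zeta(\iota(b)h)=b\,\zeta(h)$ and $\sum\gamma(x)_{(1)}\otimes\pi(\gamma(x)_{(2)})=\sum\gamma(x_{(1)})\otimes x_{(2)}$; $\zeta(1)=1$, $\varepsilon\circ\iota\circ\zeta=\varepsilon$, $\gamma(\pi(1))=1$, $\varepsilon\circ\gamma=\varepsilon_C$; and $\sum\iota(\zeta(h_{(1)}))\gamma(\pi(h_{(2)}))=h$. Left partial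 dual. Write $\sum b_{(1)}\otimes b_{(2)}\in H\otimes B$ for the coaction on $b\in B$, and $\sum f_{(1)}\otimes f_{(2)}\in C^*\otimes H^*$ for $f\in C^*$, determined by $\langle f,x\blacktriangleleft h\rangle=\sum\langle f_{(1)},x\rangle\langle f_{(2)},h\rangle$. Let $\{b_i\},\{b_i^*\}$ be dual bases of $B,B^*$ and $\{f_j\},\{f_j^*\}$ dual bases of $C^*,C$. The left partial dual of $H$ determined by $(\zeta,\gamma^* )$ is the quasi-Hopf algebra $C^*\#B=C^*\otimes B$ with unit $\varepsilon\#1$, product $(f\#b)(g\#c)=\sum fg_{(1)}\#\langle g_{(2)},b_{(1)}\rangle b_{(2)}c$, comultiplication $\mathbf\Delta(f\#b)=\sum_{i,j}(f_{(1)}\#b_i\zeta[\gamma(f_j^* )b_{(1)}])\otimes(\gamma^*[f_{(2)}\zeta^*(b_i^* )]f_j\#b_{(2)})$, counit $f\#b\mapsto\langle f,\pi(1)\rangle\langle\varepsilon,\iota(b)\rangle$, and associator $\boldsymbol\phi$ with inverse $\sum_{i,j}(\varepsilon\#b_i)\otimes(\gamma^*[\zeta^*(b_i^* )_{(1)}]\#b_j)\otimes(\gamma^*[\zeta^*(b_i^* )_{(2)}\zeta^*(b_j^* )]\#1)$. Put $\boldsymbol T(f\#b)=\sum_i(\varepsilon\#b_i)(\overline\gamma^*[\pi^*(f)(\iota(b)\rightharpoonup\overline\zeta^*(b_i^* ))]\#1)$, where $h\rightharpoonup h^*=\sum h^*_{(1)}\langle h^*_{(2)},h\rangle$; so $\boldsymbol\upsilon=\boldsymbol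 T(\varepsilon\#1)$. When $\boldsymbol\upsilon$ is invertible, $\boldsymbol S_1=\boldsymbol T(-)\boldsymbol\upsilon^{-1}$ (with $\boldsymbol\alpha_1=\boldsymbol\upsilon$, $\boldsymbol\beta_1=\varepsilon\#1$) and $\boldsymbol S_2=\boldsymbol\upsilon^{-1}\boldsymbol T(-)$ (with $\boldsymbol\alpha_2=\varepsilon\#1$, $\boldsymbol\beta_2=\boldsymbol\upsilon$) are antipodes of $C^*\#B$. A triple $(S,\alpha,\beta)$ denotes an antipode $S$ with distinguished elements: $\sum S(a_{(1)})\alpha a_{(2)}=\varepsilon(a)\alpha$, $\sum a_{(1)}\beta S(a_{(2)})=\varepsilon(a)\beta$, $\sum\phi^1\beta S(\phi^2)\alpha\phi^3=1=\sum S(\overline\phi{}^1)\alpha\overline\phi{}^2\beta S(\overline\phi{}^3)$, where $\phi=\sum\phi^1\otimes\phi^2\otimes\phi^3$ and $\phi^{-1}=\sum\overline\phi{}^1\otimes\overline\phi{}^2\otimes\overline\phi{}^3$ (associators satisfy $(\mathrm{id}\otimes\Delta)\Delta(a)=\phi(\Delta\otimes\mathrm{id})\Delta(a)\phi^{-1}$). For a quasi-Hopf algebra $K$ with associator $\phi$, $K^{\mathrm{op\,cop}}$ has opposite multiplication, coopposite comultiplication, associator obtained from $\phi$ by flipping the first and third tensorands, and antipode $(S,\beta,\alpha)$ whenever $(S,\alpha,\beta)$ is an antipode of $K$. $H^{*\,\mathrm{op\,cop}}$ is the Hopf algebra $H^*$ with opposite product and coopposite coproduct; $C^{*\,\mathrm{op\,cop}}$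 is the opposite algebra of $C^*$ with left $H^{*\,\mathrm{op\,cop}}$-coaction $f\mapsto\sum f_{(2)}\otimes f_{(1)}$; the corresponding quotient is $\iota^*:H^{*\,\mathrm{op\,cop}}\to B^{*\,\mathrm{op\,cop}}$ ($B^*$ with coopposite coproduct and with right $H^{*\,\mathrm{op\,cop}}$-action coming from the left $H^*$-action $\langle h^*\blacktriangleright b^*,b\rangle=\sum\langle h^*,b_{(1)}\rangle\langle b^*,b_{(2)}\rangle$). The system $(\gamma^*,\zeta)$ consists of the maps $\gamma^*:H^*\to C^*$ and $\zeta^*:B^*\to H^*$ playing the roles of $\zeta$ and $\gamma$ respectively; it is a partially admissible mapping system for $\pi^*$. In its left partial dual, $b\#f$ denotes $b\otimes f\in B\otimes C^*$. *)

theory Defs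
  imports "HOL-Analysis.Cartesian_Space"
begin

text \<open>
  A finite-dimensional vector space over a field \<open>'k\<close> is presented by a basis indexed by a finite
  type \<open>'n\<close>, i.e. as \<open>'k ^ 'n\<close>.  The tensor product of \<open>'k ^ 'm\<close> and \<open>'k ^ 'n\<close> is \<open>'k ^ ('m \<times> 'n)\<close>.
  The dual space of \<open>'k ^ 'n\<close> is again \<open>'k ^ 'n\<close>, expressed in the dual basis, so that evaluation
  is \<^const>\<open>scalar_product\<close>, both a basis vector and the corresponding dual basis vector are
  \<open>bas i\<close>, and the double dual is identified with the space itself.
  The spaces \<open>'k ^ 'n\<close> are never zero; all spaces below contain a unit or carry a
  nonzero counit, so nothing is lost.
\<close>

abbreviation klinear :: "('k::field ^ 'm \<Rightarrow> 'k ^ 'n) \<Rightarrow> bool" where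
  "klinear f \<equiv> Vector_Spaces.linear (*s) (*s) f"

abbreviation kfunctional :: "('k::field ^ 'm \<Rightarrow> 'k) \<Rightarrow> bool" where
  "kfunctional f \<equiv> Vector_Spaces.linear (*s) (*) f"

definition kbilinear :: "('k::field ^ 'l \<Rightarrow> 'k ^ 'm \<Rightarrow> 'k ^ 'n) \<Rightarrow> bool" where
  "kbilinear F \<longleftrightarrow> (\<forall>x. klinear (F x)) \<and> (\<forall>y. klinear (\<lambda>x. F x y))"

abbreviation bas :: "'n \<Rightarrow> 'k::field ^ 'n" where
  "bas i \<equiv> axis i 1"

definition tensor :: "'k::field ^ 'm \<Rightarrow> 'k ^ 'n \<Rightarrow> 'k ^ ('m \<times> 'n)" (infixr \<open>\<otimes>\<close> 75) where
  "x \<otimes> y = (\<chi> p. x $ fst p * y $ snd p)"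

text \<open>
  Sweedler notation: for bilinear \<open>F\<close>, \<open>sweedler t F\<close> is the value at \<open>t\<close> of the linear map
  induced by \<open>F\<close> on the tensor product, i.e. the sum of \<open>F t\<^sub>1 t\<^sub>2\<close> if \<open>t\<close> is the sum of \<open>t\<^sub>1 \<otimes> t\<^sub>2\<close>.
\<close>

definition sweedler ::
    "'k::field ^ ('m::finite \<times> 'n::finite) \<Rightarrow> ('k ^ 'm \<Rightarrow> 'k ^ 'n \<Rightarrow> 'k ^ 'l) \<Rightarrow> 'k ^ 'l" where
  "sweedler t F = (\<Sum>i\<in>UNIV. \<Sum>j\<in>UNIV. t $ (i, j) *s F (bas i) (bas j))"

definition sweedler3 ::
    "'k::field ^ ('m::finite \<times> 'n::finite \<times> 'p::finite) \<Rightarrow> ('k ^ 'm \<Rightarrow> 'k ^ 'n \<Rightarrow> 'k ^ 'p \<Rightarrow> 'k ^ 'l) \<Rightarrow> 'k ^ 'l" where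
  "sweedler3 t F = sweedler t (\<lambda>a u. sweedler u (\<lambda>b c. F a b c))"

definition flip :: "'k::field ^ ('m::finite \<times> 'n::finite) \<Rightarrow> 'k ^ ('n \<times> 'm)" where
  "flip t = (\<chi> p. t $ (snd p, fst p))"

definition flip13 :: "'k::field ^ ('m::finite \<times> 'n::finite \<times> 'p::finite) \<Rightarrow> 'k ^ ('p \<times> 'n \<times> 'm)" where
  "flip13 t = (\<chi> p. t $ (snd (snd p), fst (snd p), fst p))"

lemma sweedler_tensor:
  assumes "kbilinear F"
  shows "sweedler (x \<otimes> y) F = F x y"
proof -
  have 1: "klinear (F u)" "klinear (\<lambda>u. F u v)" for u v
    using assms by (auto simp: kbilinear_def)
  have "F x y = F (\<Sum>i\<in>UNIV. x $ i *s bas i) (\<Sum>j\<in>UNIV. y $ j *s bas j)"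
    by (simp add: basis_expansion)
  also have "\<dots> = (\<Sum>i\<in>UNIV. x $ i *s F (bas i) (\<Sum>j\<in>UNIV. y $ j *s bas j))"
    by (simp only: vec.linear_sum[OF 1(2)] vec.linear_scale[OF 1(2)])
  also have "\<dots> = (\<Sum>i\<in>UNIV. x $ i *s (\<Sum>j\<in>UNIV. y $ j *s F (bas i) (bas j)))"
    by (simp only: vec.linear_sum[OF 1(1)] vec.linear_scale[OF 1(1)])
  finally show ?thesis
    by (simp add: sweedler_def tensor_def vec.scale_sum_right)
qed

lemma flip_tensor: "flip (x \<otimes> y) = y \<otimes> x"
  by (simp add: flip_def tensor_def mult.commute)

lemma flip13_tensor: "flip13 (x \<otimes> y \<otimes> z) = z \<otimes> y \<otimes> x"
  by (simp add: flip13_def tensor_def vec_eq_iff mult_ac)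

definition dual_map :: "('k::field ^ 'm \<Rightarrow> 'k ^ 'n) \<Rightarrow> 'k ^ 'n \<Rightarrow> 'k ^ 'm" where
  "dual_map f g = transpose (matrix f) *v g"

lemma scalar_product_dual_map:
  assumes "klinear f"
  shows "scalar_product (dual_map f g) x = scalar_product g (f x)"
proof -
  have "f x = matrix f *v x"
    by (simp add: matrix_works[OF assms])
  then show ?thesis
    by (simp add: scalar_product_def dual_map_def matrix_vector_mult_def transpose_def
        sum_distrib_left sum_distrib_right mult_ac) (rule sum.swap)
qed

definition algebra_str :: "('k::field ^ 'n \<Rightarrow> 'k ^ 'n \<Rightarrow> 'k ^ 'n) \<Rightarrow> 'k ^ 'n \<Rightarrow> bool" where
  "algebra_str m u \<longleftrightarrow> kbilinear m \<and>
     (\<forall>x y z. m (m x y) z = m x (m y z)) \<and> (\<forall>x. m u x = x \<and> m x u = x)"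

definition coalgebra_str ::
    "('k::field ^ 'n \<Rightarrow> 'k ^ ('n \<times> 'n)) \<Rightarrow> ('k ^ 'n \<Rightarrow> 'k) \<Rightarrow> bool" where
  "coalgebra_str \<Delta> \<epsilon> \<longleftrightarrow> klinear \<Delta> \<and> kfunctional \<epsilon> \<and>
     (\<forall>x. sweedler (\<Delta> x) (\<lambda>x1 x2. sweedler (\<Delta> x1) (\<lambda>x11 x12. x11 \<otimes> x12 \<otimes> x2)) =
          sweedler (\<Delta> x) (\<lambda>x1 x2. x1 \<otimes> \<Delta> x2)) \<and>
     (\<forall>x. sweedler (\<Delta> x) (\<lambda>x1 x2. \<epsilon> x1 *s x2) = x \<and>
          sweedler (\<Delta> x) (\<lambda>x1 x2. \<epsilon> x2 *s x1) = x)"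

definition tensor_mul ::
    "('k::field ^ 'm \<Rightarrow> 'k ^ 'm \<Rightarrow> 'k ^ 'm) \<Rightarrow> ('k ^ 'n \<Rightarrow> 'k ^ 'n \<Rightarrow> 'k ^ 'n) \<Rightarrow>
     'k ^ ('m \<times> 'n) \<Rightarrow> 'k ^ ('m \<times> 'n) \<Rightarrow> 'k ^ ('m \<times> 'n)" where
  "tensor_mul m n s t = sweedler s (\<lambda>a b. sweedler t (\<lambda>c d. m a c \<otimes> n b d))"

record ('k, 'n::finite) bialg =
  mul :: "('k, 'n) vec \<Rightarrow> ('k, 'n) vec \<Rightarrow> ('k, 'n) vec"
  one :: "('k, 'n) vec"
  comul :: "('k, 'n) vec \<Rightarrow> ('k, 'n \<times> 'n) vec"
  counit :: "('k, 'n) vec \<Rightarrow> 'k"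

definition bialgebra :: "('k::field, 'n::finite) bialg \<Rightarrow> bool" where
  "bialgebra H \<longleftrightarrow> algebra_str (mul H) (one H) \<and> coalgebra_str (comul H) (counit H) \<and>
     (\<forall>x y. comul H (mul H x y) = tensor_mul (mul H) (mul H) (comul H x) (comul H y)) \<and>
     comul H (one H) = one H \<otimes> one H \<and>
     (\<forall>x y. counit H (mul H x y) = counit H x * counit H y) \<and> counit H (one H) = 1"

text \<open>
  \<open>conv_inverse \<Delta> \<epsilon> m u f g\<close>: the linear maps \<open>f\<close>, \<open>g\<close> from the coalgebra \<open>(\<Delta>, \<epsilon>)\<close> to the algebra
  \<open>(m, u)\<close> are inverse to each other under convolution.
\<close>

definition conv_inverse ::
    "('k::field ^ 'n \<Rightarrow> 'k ^ ('n \<times> 'n)) \<Rightarrow> ('k ^ 'n \<Rightarrow> 'k) \<Rightarrow>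
     ('k ^ 'm \<Rightarrow> 'k ^ 'm \<Rightarrow> 'k ^ 'm) \<Rightarrow> 'k ^ 'm \<Rightarrow>
     ('k ^ 'n \<Rightarrow> 'k ^ 'm) \<Rightarrow> ('k ^ 'n \<Rightarrow> 'k ^ 'm) \<Rightarrow> bool" where
  "conv_inverse \<Delta> \<epsilon> m u f g \<longleftrightarrow> klinear f \<and> klinear g \<and>
     (\<forall>x. sweedler (\<Delta> x) (\<lambda>x1 x2. m (f x1) (g x2)) = \<epsilon> x *s u \<and>
          sweedler (\<Delta> x) (\<lambda>x1 x2. m (g x1) (f x2)) = \<epsilon> x *s u)"

definition hopf_algebra :: "('k::field, 'n::finite) bialg \<Rightarrow> bool" where
  "hopf_algebra H \<longleftrightarrow> bialgebra H \<and>
     (\<exists>S. conv_inverse (comul H) (counit H) (mul H) (one H) id S)"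

definition dual_mul ::
    "('k::field ^ 'n \<Rightarrow> 'k ^ ('n \<times> 'n)) \<Rightarrow> 'k ^ 'n \<Rightarrow> 'k ^ 'n \<Rightarrow> 'k ^ 'n" where
  "dual_mul \<Delta> f g = (\<chi> i. scalar_product (f \<otimes> g) (\<Delta> (bas i)))"

definition dual_one :: "('k::field ^ 'n \<Rightarrow> 'k) \<Rightarrow> 'k ^ 'n" where
  "dual_one \<epsilon> = (\<chi> i. \<epsilon> (bas i))"

definition dual_comul ::
    "('k::field ^ 'n \<Rightarrow> 'k ^ 'n \<Rightarrow> 'k ^ 'n) \<Rightarrow> 'k ^ 'n \<Rightarrow> 'k ^ ('n \<times> 'n)" where
  "dual_comul m f = (\<chi> p. scalar_product f (m (bas (fst p)) (bas (snd p))))"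

definition dual_bialg :: "('k::field, 'n::finite) bialg \<Rightarrow> ('k, 'n) bialg" where
  "dual_bialg H = \<lparr>mul = dual_mul (comul H), one = dual_one (counit H),
     comul = dual_comul (mul H), counit = (\<lambda>f. scalar_product f (one H))\<rparr>"

definition op_cop :: "('k::field, 'n::finite, 'z) bialg_scheme \<Rightarrow> ('k, 'n, 'z) bialg_scheme" where
  "op_cop H = H\<lparr>mul := (\<lambda>x y. mul H y x), comul := (\<lambda>x. flip (comul H x))\<rparr>"

record ('k, 'h::finite, 'b::finite) comod_alg =
  amul :: "('k, 'b) vec \<Rightarrow> ('k, 'b) vec \<Rightarrow> ('k, 'b) vec"
  aone :: "('k, 'b) vec"
  coact :: "('k, 'b) vec \<Rightarrow> ('k, 'h \<times> 'b) vec"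

record ('k, 'h::finite, 'c::finite) mod_coalg =
  ccomul :: "('k, 'c) vec \<Rightarrow> ('k, 'c \<times> 'c) vec"
  ccounit :: "('k, 'c) vec \<Rightarrow> 'k"
  act :: "('k, 'c) vec \<Rightarrow> ('k, 'h) vec \<Rightarrow> ('k, 'c) vec"

definition comodule_algebra ::
    "('k::field, 'h::finite) bialg \<Rightarrow> ('k, 'h, 'b::finite) comod_alg \<Rightarrow> bool" where
  "comodule_algebra H B \<longleftrightarrow> algebra_str (amul B) (aone B) \<and> klinear (coact B) \<and>
     (\<forall>b. sweedler (coact B b) (\<lambda>b1 b2. sweedler (comul H b1) (\<lambda>b11 b12. b11 \<otimes> b12 \<otimes> b2)) =
          sweedler (coact B b) (\<lambda>b1 b2. b1 \<otimes> coact B b2)) \<and>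
     (\<forall>b. sweedler (coact B b) (\<lambda>b1 b2. counit H b1 *s b2) = b) \<and>
     (\<forall>b c. coact B (amul B b c) = tensor_mul (mul H) (amul B) (coact B b) (coact B c)) \<and>
     coact B (aone B) = one H \<otimes> aone B"

definition module_coalgebra ::
    "('k::field, 'h::finite) bialg \<Rightarrow> ('k, 'h, 'c::finite) mod_coalg \<Rightarrow> bool" where
  "module_coalgebra H C \<longleftrightarrow> coalgebra_str (ccomul C) (ccounit C) \<and> kbilinear (act C) \<and>
     (\<forall>x h k. act C (act C x h) k = act C x (mul H h k)) \<and> (\<forall>x. act C x (one H) = x) \<and>
     (\<forall>x h. ccomul C (act C x h) =
        sweedler (ccomul C x) (\<lambda>x1 x2. sweedler (comul H h) (\<lambda>h1 h2. act C x1 h1 \<otimes> act C x2 h2))) \<and>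
     (\<forall>x h. ccounit C (act C x h) = ccounit C x * counit H h)"

text \<open>
  A left coideal subalgebra is presented by a basis, that is, as an injective map \<open>\<iota>\<close> of left
  \<open>H\<close>-comodule algebras from \<open>B\<close> to \<open>H\<close>: the subalgebra itself is \<open>range \<iota>\<close>, and \<open>\<iota>\<close> determines
  the structure of \<open>B\<close>.  Dually, a quotient is a surjective map of right \<open>H\<close>-module coalgebras.
\<close>

definition comodule_subalgebra ::
    "('k::field, 'h::finite) bialg \<Rightarrow> ('k, 'h, 'b::finite) comod_alg \<Rightarrow> ('k ^ 'b \<Rightarrow> 'k ^ 'h) \<Rightarrow> bool" where
  "comodule_subalgebra H B \<iota> \<longleftrightarrow> comodule_algebra H B \<and> klinear \<iota> \<and> inj \<iota> \<and>
     (\<forall>b c. \<iota> (amul B b c) = mul H (\<iota> b) (\<iota> c)) \<and> \<iota> (aone B) = one H \<and>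
     (\<forall>b. comul H (\<iota> b) = sweedler (coact B b) (\<lambda>b1 b2. b1 \<otimes> \<iota> b2))"

definition module_quotient_coalgebra ::
    "('k::field, 'h::finite) bialg \<Rightarrow> ('k, 'h, 'c::finite) mod_coalg \<Rightarrow> ('k ^ 'h \<Rightarrow> 'k ^ 'c) \<Rightarrow> bool" where
  "module_quotient_coalgebra H C \<pi> \<longleftrightarrow> module_coalgebra H C \<and> klinear \<pi> \<and> surj \<pi> \<and>
     (\<forall>h k. \<pi> (mul H h k) = act C (\<pi> h) k) \<and>
     (\<forall>h. ccomul C (\<pi> h) = sweedler (comul H h) (\<lambda>h1 h2. \<pi> h1 \<otimes> \<pi> h2)) \<and>
     (\<forall>h. ccounit C (\<pi> h) = counit H h)"

definition augmentation_right_ideal ::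
    "('k::field, 'h::finite) bialg \<Rightarrow> ('k ^ 'b \<Rightarrow> 'k ^ 'h) \<Rightarrow> ('k ^ 'h) set" where
  "augmentation_right_ideal H \<iota> = vec.span {mul H (\<iota> b) h | b h. counit H (\<iota> b) = 0}"

definition partially_admissible ::
    "('k::field, 'h::finite) bialg \<Rightarrow> ('k, 'h, 'b::finite) comod_alg \<Rightarrow> ('k, 'h, 'c::finite) mod_coalg \<Rightarrow>
     ('k ^ 'b \<Rightarrow> 'k ^ 'h) \<Rightarrow> ('k ^ 'h \<Rightarrow> 'k ^ 'c) \<Rightarrow> ('k ^ 'h \<Rightarrow> 'k ^ 'b) \<Rightarrow> ('k ^ 'c \<Rightarrow> 'k ^ 'h) \<Rightarrow> bool" where
  "partially_admissible H B C \<iota> \<pi> \<zeta> \<gamma> \<longleftrightarrow>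
     hopf_algebra H \<and> comodule_subalgebra H B \<iota> \<and> module_quotient_coalgebra H C \<pi> \<and>
     range \<iota> = {h. sweedler (comul H h) (\<lambda>h1 h2. h1 \<otimes> \<pi> h2) = h \<otimes> \<pi> (one H)} \<and>
     klinear \<zeta> \<and> klinear \<gamma> \<and>
     (\<exists>\<zeta>'. conv_inverse (comul H) (counit H) (amul B) (aone B) \<zeta> \<zeta>') \<and>
     (\<exists>\<gamma>'. conv_inverse (ccomul C) (ccounit C) (mul H) (one H) \<gamma> \<gamma>') \<and>
     (\<forall>b h. \<zeta> (mul H (\<iota> b) h) = amul B b (\<zeta> h)) \<and>
     (\<forall>x. sweedler (comul H (\<gamma> x)) (\<lambda>h1 h2. h1 \<otimes> \<pi> h2) =
          sweedler (ccomul C x) (\<lambda>x1 x2. \<gamma> x1 \<otimes> x2)) \<and>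
     \<zeta> (one H) = aone B \<and> (\<forall>h. counit H (\<iota> (\<zeta> h)) = counit H h) \<and>
     \<gamma> (\<pi> (one H)) = one H \<and> (\<forall>x. counit H (\<gamma> x) = ccounit C x) \<and>
     (\<forall>h. sweedler (comul H h) (\<lambda>h1 h2. mul H (\<iota> (\<zeta> h1)) (\<gamma> (\<pi> h2))) = h)"

record ('k, 'n::finite) qbialg = "('k, 'n) bialg" +
  assoc :: "('k, 'n \<times> 'n \<times> 'n) vec"
  assoc_inv :: "('k, 'n \<times> 'n \<times> 'n) vec"

definition mul3 :: "('k::field ^ 'n \<Rightarrow> 'k ^ 'n \<Rightarrow> 'k ^ 'n) \<Rightarrow>
     'k ^ ('n \<times> 'n \<times> 'n) \<Rightarrow> 'k ^ ('n \<times> 'n \<times> 'n) \<Rightarrow> 'k ^ ('n \<times> 'n \<times> 'n)" where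
  "mul3 m = tensor_mul m (tensor_mul m m)"

definition mul4 :: "('k::field ^ 'n \<Rightarrow> 'k ^ 'n \<Rightarrow> 'k ^ 'n) \<Rightarrow>
     'k ^ ('n \<times> 'n \<times> 'n \<times> 'n) \<Rightarrow> 'k ^ ('n \<times> 'n \<times> 'n \<times> 'n) \<Rightarrow> 'k ^ ('n \<times> 'n \<times> 'n \<times> 'n)" where
  "mul4 m = tensor_mul m (mul3 m)"

definition inverse_in ::
    "('a \<Rightarrow> 'a \<Rightarrow> 'a) \<Rightarrow> 'a \<Rightarrow> 'a \<Rightarrow> 'a \<Rightarrow> bool" where
  "inverse_in m u x y \<longleftrightarrow> m x y = u \<and> m y x = u"

definition quasi_bialgebra :: "('k::field, 'n::finite) qbialg \<Rightarrow> bool" where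
  "quasi_bialgebra K \<longleftrightarrow>
     algebra_str (mul K) (one K) \<and> klinear (comul K) \<and> kfunctional (counit K) \<and>
     (\<forall>x y. comul K (mul K x y) = tensor_mul (mul K) (mul K) (comul K x) (comul K y)) \<and>
     comul K (one K) = one K \<otimes> one K \<and>
     (\<forall>x y. counit K (mul K x y) = counit K x * counit K y) \<and> counit K (one K) = 1 \<and>
     (\<forall>x. sweedler (comul K x) (\<lambda>x1 x2. counit K x1 *s x2) = x \<and>
          sweedler (comul K x) (\<lambda>x1 x2. counit K x2 *s x1) = x) \<and>
     inverse_in (mul3 (mul K)) (one K \<otimes> one K \<otimes> one K) (assoc K) (assoc_inv K) \<and>
     (\<forall>x. sweedler (comul K x) (\<lambda>x1 x2. x1 \<otimes> comul K x2) =
          mul3 (mul K)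
            (mul3 (mul K) (assoc K)
              (sweedler (comul K x) (\<lambda>x1 x2. sweedler (comul K x1) (\<lambda>x11 x12. x11 \<otimes> x12 \<otimes> x2))))
            (assoc_inv K)) \<and>
     mul4 (mul K)
       (sweedler3 (assoc K) (\<lambda>a b c. a \<otimes> b \<otimes> comul K c))
       (sweedler3 (assoc K) (\<lambda>a b c. sweedler (comul K a) (\<lambda>a1 a2. a1 \<otimes> a2 \<otimes> b \<otimes> c))) =
     mul4 (mul K)
       (mul4 (mul K)
         (one K \<otimes> assoc K)
         (sweedler3 (assoc K) (\<lambda>a b c. sweedler (comul K b) (\<lambda>b1 b2. a \<otimes> b1 \<otimes> b2 \<otimes> c))))
       (sweedler3 (assoc K) (\<lambda>a b c. a \<otimes> b \<otimes> c \<otimes> one K)) \<and>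
     sweedler3 (assoc K) (\<lambda>a b c. counit K b *s (a \<otimes> c)) = one K \<otimes> one K"

definition quasi_op_cop :: "('k::field, 'n::finite) qbialg \<Rightarrow> ('k, 'n) qbialg" where
  "quasi_op_cop K = (op_cop K)\<lparr>assoc := flip13 (assoc K), assoc_inv := flip13 (assoc_inv K)\<rparr>"

definition quasi_bialgebra_iso ::
    "('k::field, 'm::finite) qbialg \<Rightarrow> ('k, 'n::finite) qbialg \<Rightarrow> ('k ^ 'm \<Rightarrow> 'k ^ 'n) \<Rightarrow> bool" where
  "quasi_bialgebra_iso K L \<theta> \<longleftrightarrow> quasi_bialgebra K \<and> quasi_bialgebra L \<and> klinear \<theta> \<and> bij \<theta> \<and>
     (\<forall>x y. \<theta> (mul K x y) = mul L (\<theta> x) (\<theta> y)) \<and> \<theta> (one K) = one L \<and>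
     (\<forall>x. comul L (\<theta> x) = sweedler (comul K x) (\<lambda>x1 x2. \<theta> x1 \<otimes> \<theta> x2)) \<and>
     (\<forall>x. counit L (\<theta> x) = counit K x) \<and>
     assoc L = sweedler3 (assoc K) (\<lambda>a b c. \<theta> a \<otimes> \<theta> b \<otimes> \<theta> c)"

text \<open>
  The antipode triple \<open>(S, \<alpha>, \<beta>)\<close>.  As usual \<open>S\<close> is a unital algebra anti-endomorphism; bijectivity
  is not part of the notion.
\<close>

definition quasi_antipode ::
    "('k::field, 'n::finite) qbialg \<Rightarrow> ('k ^ 'n \<Rightarrow> 'k ^ 'n) \<Rightarrow> 'k ^ 'n \<Rightarrow> 'k ^ 'n \<Rightarrow> bool" where
  "quasi_antipode K S \<alpha> \<beta> \<longleftrightarrow> klinear S \<and>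
     (\<forall>x y. S (mul K x y) = mul K (S y) (S x)) \<and> S (one K) = one K \<and>
     (\<forall>x. sweedler (comul K x) (\<lambda>x1 x2. mul K (mul K (S x1) \<alpha>) x2) = counit K x *s \<alpha>) \<and>
     (\<forall>x. sweedler (comul K x) (\<lambda>x1 x2. mul K (mul K x1 \<beta>) (S x2)) = counit K x *s \<beta>) \<and>
     sweedler3 (assoc K)
       (\<lambda>a b c. mul K (mul K (mul K (mul K a \<beta>) (S b)) \<alpha>) c) = one K \<and>
     sweedler3 (assoc_inv K)
       (\<lambda>a b c. mul K (mul K (mul K (mul K (S a) \<alpha>) b) \<beta>) (S c)) = one K"

text \<open>
  The coaction \<open>f \<mapsto> f\<^sub>1 \<otimes> f\<^sub>2\<close> from \<open>C\<^sup>*\<close> to \<open>C\<^sup>* \<otimes> H\<^sup>*\<close> dual to the action of \<open>H\<close> on \<open>C\<close>.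
\<close>

definition dual_coact ::
    "('k::field, 'h::finite, 'c::finite) mod_coalg \<Rightarrow> 'k ^ 'c \<Rightarrow> 'k ^ ('c \<times> 'h)" where
  "dual_coact C f = (\<chi> p. scalar_product f (act C (bas (fst p)) (bas (snd p))))"

abbreviation cdual_mul where "cdual_mul C \<equiv> dual_mul (ccomul C)"

abbreviation cdual_one where "cdual_one C \<equiv> dual_one (ccounit C)"

definition lpd_mul ::
    "('k::field, 'h::finite, 'b::finite) comod_alg \<Rightarrow> ('k, 'h, 'c::finite) mod_coalg \<Rightarrow>
     'k ^ ('c \<times> 'b) \<Rightarrow> 'k ^ ('c \<times> 'b) \<Rightarrow> 'k ^ ('c \<times> 'b)" where
  "lpd_mul B C x y =
     sweedler x (\<lambda>f b. sweedler y (\<lambda>g c.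
       sweedler (dual_coact C g) (\<lambda>g1 g2. sweedler (coact B b) (\<lambda>b1 b2.
         scalar_product g2 b1 *s (cdual_mul C f g1 \<otimes> amul B b2 c)))))"

definition lpd_comul ::
    "('k::field, 'h::finite) bialg \<Rightarrow> ('k, 'h, 'b::finite) comod_alg \<Rightarrow> ('k, 'h, 'c::finite) mod_coalg \<Rightarrow>
     ('k ^ 'h \<Rightarrow> 'k ^ 'b) \<Rightarrow> ('k ^ 'c \<Rightarrow> 'k ^ 'h) \<Rightarrow>
     'k ^ ('c \<times> 'b) \<Rightarrow> 'k ^ (('c \<times> 'b) \<times> ('c \<times> 'b))" where
  "lpd_comul H B C \<zeta> \<gamma> x =
     sweedler x (\<lambda>f b. sweedler (dual_coact C f) (\<lambda>f1 f2. sweedler (coact B b) (\<lambda>b1 b2.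
       \<Sum>i\<in>UNIV. \<Sum>j\<in>UNIV.
         (f1 \<otimes> amul B (bas i) (\<zeta> (mul H (\<gamma> (bas j)) b1))) \<otimes>
         (cdual_mul C
            (dual_map \<gamma> (mul (dual_bialg H) f2 (dual_map \<zeta> (bas i)))) (bas j) \<otimes> b2))))"

definition lpd_counit ::
    "('k::field, 'h::finite) bialg \<Rightarrow> ('k ^ 'b \<Rightarrow> 'k ^ 'h) \<Rightarrow> ('k ^ 'h \<Rightarrow> 'k ^ 'c) \<Rightarrow>
     'k ^ ('c \<times> 'b) \<Rightarrow> 'k" where
  "lpd_counit H \<iota> \<pi> x =
     scalar_product x (\<pi> (one H) \<otimes> dual_one (\<lambda>b. counit H (\<iota> b)))"

definition lpd_assoc_inv ::
    "('k::field, 'h::finite) bialg \<Rightarrow> ('k, 'h, 'b::finite) comod_alg \<Rightarrow> ('k, 'h, 'c::finite) mod_coalg \<Rightarrow>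
     ('k ^ 'h \<Rightarrow> 'k ^ 'b) \<Rightarrow> ('k ^ 'c \<Rightarrow> 'k ^ 'h) \<Rightarrow>
     'k ^ (('c \<times> 'b) \<times> ('c \<times> 'b) \<times> ('c \<times> 'b))" where
  "lpd_assoc_inv H B C \<zeta> \<gamma> =
     (\<Sum>i\<in>UNIV. \<Sum>j\<in>UNIV.
       sweedler (comul (dual_bialg H) (dual_map \<zeta> (bas i))) (\<lambda>z1 z2.
         (cdual_one C \<otimes> bas i) \<otimes>
         (dual_map \<gamma> z1 \<otimes> bas j) \<otimes>
         (dual_map \<gamma> (mul (dual_bialg H) z2 (dual_map \<zeta> (bas j))) \<otimes> aone B)))"

text \<open>
  The associator is the (unique, if existing) inverse of \<^const>\<open>lpd_assoc_inv\<close> in the threefold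
  tensor power of the algebra; that it exists is part of \<^const>\<open>quasi_bialgebra\<close>.
\<close>

definition left_partial_dual ::
    "('k::field, 'h::finite) bialg \<Rightarrow> ('k, 'h, 'b::finite) comod_alg \<Rightarrow> ('k, 'h, 'c::finite) mod_coalg \<Rightarrow>
     ('k ^ 'b \<Rightarrow> 'k ^ 'h) \<Rightarrow> ('k ^ 'h \<Rightarrow> 'k ^ 'c) \<Rightarrow> ('k ^ 'h \<Rightarrow> 'k ^ 'b) \<Rightarrow> ('k ^ 'c \<Rightarrow> 'k ^ 'h) \<Rightarrow>
     ('k, 'c \<times> 'b) qbialg" where
  "left_partial_dual H B C \<iota> \<pi> \<zeta> \<gamma> =
     (let u = cdual_one C \<otimes> aone B; \<phi>' = lpd_assoc_inv H B C \<zeta> \<gamma> in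
      \<lparr>mul = lpd_mul B C, one = u, comul = lpd_comul H B C \<zeta> \<gamma>, counit = lpd_counit H \<iota> \<pi>,
       assoc = (THE \<phi>. inverse_in (mul3 (lpd_mul B C)) (u \<otimes> u \<otimes> u) \<phi> \<phi>'),
       assoc_inv = \<phi>'\<rparr>)"

definition hit :: "('k::field, 'h::finite) bialg \<Rightarrow> 'k ^ 'h \<Rightarrow> 'k ^ 'h \<Rightarrow> 'k ^ 'h" where
  "hit H h f = sweedler (comul (dual_bialg H) f) (\<lambda>f1 f2. scalar_product f2 h *s f1)"

text \<open>
  In the next two definitions \<open>\<zeta>'\<close> and \<open>\<gamma>'\<close> stand for the convolution inverses of \<open>\<zeta>\<close> and \<open>\<gamma>\<close>.
\<close>

definition lpd_T ::
    "('k::field, 'h::finite) bialg \<Rightarrow> ('k, 'h, 'b::finite) comod_alg \<Rightarrow> ('k, 'h, 'c::finite) mod_coalg \<Rightarrow>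
     ('k ^ 'b \<Rightarrow> 'k ^ 'h) \<Rightarrow> ('k ^ 'h \<Rightarrow> 'k ^ 'c) \<Rightarrow> ('k ^ 'h \<Rightarrow> 'k ^ 'b) \<Rightarrow> ('k ^ 'c \<Rightarrow> 'k ^ 'h) \<Rightarrow>
     'k ^ ('c \<times> 'b) \<Rightarrow> 'k ^ ('c \<times> 'b)" where
  "lpd_T H B C \<iota> \<pi> \<zeta>' \<gamma>' x =
     sweedler x (\<lambda>f b. \<Sum>i\<in>UNIV.
       lpd_mul B C (cdual_one C \<otimes> bas i)
         (dual_map \<gamma>'
            (mul (dual_bialg H) (dual_map \<pi> f) (hit H (\<iota> b) (dual_map \<zeta>' (bas i)))) \<otimes> aone B))"

definition lpd_upsilon ::
    "('k::field, 'h::finite, 'b::finite) comod_alg \<Rightarrow> ('k, 'h, 'c::finite) mod_coalg \<Rightarrow>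
     ('k ^ 'h \<Rightarrow> 'k ^ 'b) \<Rightarrow> ('k ^ 'c \<Rightarrow> 'k ^ 'h) \<Rightarrow> 'k ^ ('c \<times> 'b)" where
  "lpd_upsilon B C \<zeta>' \<gamma>' =
     (\<Sum>i\<in>UNIV. lpd_mul B C (cdual_one C \<otimes> bas i)
        (dual_map \<gamma>' (dual_map \<zeta>' (bas i)) \<otimes> aone B))"

text \<open>
  The left \<open>(H\<^sup>*)\<^sup>o\<^sup>p \<^sup>c\<^sup>o\<^sup>p\<close>-comodule algebra \<open>(C\<^sup>*)\<^sup>o\<^sup>p\<close>, with coaction \<open>f \<mapsto> f\<^sub>2 \<otimes> f\<^sub>1\<close>.
\<close>

definition dual_comod_alg ::
    "('k::field, 'h::finite, 'c::finite) mod_coalg \<Rightarrow> ('k, 'h, 'c) comod_alg" where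
  "dual_comod_alg C = \<lparr>amul = (\<lambda>f g. cdual_mul C g f), aone = cdual_one C,
     coact = (\<lambda>f. flip (dual_coact C f))\<rparr>"

text \<open>
  The right \<open>(H\<^sup>*)\<^sup>o\<^sup>p \<^sup>c\<^sup>o\<^sup>p\<close>-module coalgebra \<open>(B\<^sup>*)\<^sup>c\<^sup>o\<^sup>p\<close>; the action of \<open>f \<in> H\<^sup>*\<close> on \<open>\<beta> \<in> B\<^sup>*\<close>
  sends \<open>b\<close> to the sum of \<open>f(b\<^sub>1) \<beta>(b\<^sub>2)\<close>.
\<close>

definition dual_mod_coalg ::
    "('k::field, 'h::finite, 'b::finite) comod_alg \<Rightarrow> ('k, 'h, 'b) mod_coalg" where
  "dual_mod_coalg B = \<lparr>ccomul = (\<lambda>\<beta>. flip (dual_comul (amul B) \<beta>)),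
     ccounit = (\<lambda>\<beta>. scalar_product \<beta> (aone B)),
     act = (\<lambda>\<beta> f. \<chi> i. scalar_product (f \<otimes> \<beta>) (coact B (bas i)))\<rparr>"

end

theory Submission
  imports Defs
begin

text \<open>
  An element \<open>F = f # b\<close> of \<open>C\<^sup>* # B\<close> is regarded as the linear map \<open>h \<mapsto> \<langle>f, \<pi>(h)\<rangle> \<iota>(b)\<close> from \<open>H\<close> to \<open>H\<close>.
  The product then reads \<open>(F G)(h) = F(h\<^sub>1)\<^sub>2 G(h\<^sub>2 F(h\<^sub>1)\<^sub>1)\<close>, and an element of a tensor power is determined
  by its values, so all axioms of a quasi-bialgebra become identities in \<open>H\<close> about \<open>z = \<iota>\<zeta>\<close>, \<open>e = \<gamma>\<pi>\<close> and
  their convolution inverses, with \<open>z(h\<^sub>1) e(h\<^sub>2) = h\<close> as the main relation.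

  The map \<open>T\<close> is a preantipode, i.e. \<open>T(a\<^sub>1 b) a\<^sub>2 = \<epsilon>(a) T(b) = a\<^sub>1 T(b a\<^sub>2)\<close>, and both associator conditions
  hold for it.  If \<open>\<upsilon> = T(1)\<close> is invertible, a dimension count for the free Hopf module \<open>K \<otimes> K\<close>
  shows that \<open>T(x y) = T(y) \<upsilon>\<inverse> T(x)\<close>, which makes \<open>T(-) \<upsilon>\<inverse>\<close> and \<open>\<upsilon>\<inverse> T(-)\<close> antipodes.

  For the dual system, the identification of double duals turns the structure maps of the left partial dual of
  \<open>H\<^sup>*\<close> with opposite product and coproduct into those of \<open>C\<^sup>* # B\<close> read backwards.  The inverse of the
  associator being unique, the flip is an isomorphism.
\<close>

section \<open>Linear maps and Sweedler notation\<close>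

text \<open>Since \<open>B\<close> sits inside \<open>H\<close> and \<open>C\<close> is a quotient
  of \<open>H\<close>, values on \<open>H\<close> remove all dual bases, actions and coactions from
  the structure maps. The price is double bookkeeping. A leg that belongs to \<open>C\<close> is
  represented by a lift to \<open>H\<close>, so colinearity of \<open>\<gamma>\<close> may be used
  only for expressions that factor through \<open>\<pi>\<close> in that leg; a leg that belongs to
  \<open>B\<close> is formally an arbitrary vector of \<open>H\<close>, so B-linearity of
  \<open>\<zeta>\<close> may be used only where membership in \<open>range \<iota>\<close> is
  tracked. Most side conditions below come from these two restrictions.

  The definitions give only the inverse of the associator. The axioms are therefore proved in
  inverted form wherever possible, and an explicit associator is used only for its invertibility,
  for the normalisations and for one identity of \<open>T\<close>.

  An antipode must reverse products. Nothing in the formula for \<open>T\<close> shows this, which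
  is why the antipodes are reached through a general theorem on preantipodes rather than by direct
  computation.\<close>

lemma klinear_iff:
  fixes f :: "'k::field ^ 'm \<Rightarrow> 'k ^ 'n"
  shows "klinear f \<longleftrightarrow> (\<forall>x y. f (x + y) = f x + f y) \<and> (\<forall>c x. f (c *s x) = c *s f x)"
  by (auto simp: Vector_Spaces.linear_iff intro: vec.vector_space_axioms)

lemma kfunctional_iff:
  fixes e :: "'k::field ^ 'm \<Rightarrow> 'k"
  shows "kfunctional e \<longleftrightarrow> (\<forall>x y. e (x + y) = e x + e y) \<and> (\<forall>c x. e (c *s x) = c * e x)"
  by (auto simp: Vector_Spaces.linear_iff
      intro: vec.vector_space_axioms vector_space_over_itself.vector_space_axioms)

text \<open>Closure rules \<open>klinear f ==> klinear (\<lambda>x. ...)\<close>, so that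
  \<open>intro lin\<close> proves linearity of any nested Sweedler sum in any one slot. This is the
  side condition for evaluating \<open>sweedler\<close> on a pure tensor, hence for nearly every
  rewriting below.\<close>

named_theorems lin

lemma lin_id [lin]: "klinear (\<lambda>x. x)"
  by (simp add: klinear_iff)

lemma lin_compose: "klinear g \<Longrightarrow> klinear f \<Longrightarrow> klinear (\<lambda>x. g (f x))"
  by (simp add: klinear_iff)

lemma lin_scale [lin]: "klinear f \<Longrightarrow> klinear (\<lambda>x. c *s f x)"
  by (simp add: klinear_iff vec.scale_right_distrib mult.commute)

lemma lin_sum [lin]: "(\<And>i. klinear (f i)) \<Longrightarrow> klinear (\<lambda>x. \<Sum>i\<in>A. f i x)"
  by (auto simp: klinear_iff sum.distrib vec.scale_sum_right)

lemma lin_add [lin]: "klinear f \<Longrightarrow> klinear g \<Longrightarrow> klinear (\<lambda>x. f x + g x)"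
  by (simp add: klinear_iff vec.scale_right_distrib)

text \<open>Sweedler sums are vector valued, so functionals enter them as coefficients of a vector
  \<open>v\<close>. For the same reason many scalar identities are stated after scaling an arbitrary
  \<open>v\<close>.\<close>

lemma lin_functional: "kfunctional e \<Longrightarrow> klinear f \<Longrightarrow> klinear (\<lambda>x. e (f x) *s v)"
  by (auto simp: klinear_iff kfunctional_iff vec.scale_left_distrib)

lemma lin_scalar_product1 [lin]: "klinear f \<Longrightarrow> klinear (\<lambda>x. scalar_product (f x) w *s v)"
  by (auto simp: klinear_iff scalar_product_def vec.scale_left_distrib sum.distrib
      distrib_right sum_distrib_left mult.assoc)

lemma lin_scalar_product2 [lin]: "klinear f \<Longrightarrow> klinear (\<lambda>x. scalar_product w (f x) *s v)"
  by (auto simp: klinear_iff scalar_product_def vec.scale_left_distrib sum.distrib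
      distrib_left sum_distrib_left mult_ac)

lemma lin_tensor1 [lin]: "klinear f \<Longrightarrow> klinear (\<lambda>x. f x \<otimes> v)"
  by (auto simp: klinear_iff tensor_def vec_eq_iff algebra_simps)

lemma lin_tensor2 [lin]: "klinear f \<Longrightarrow> klinear (\<lambda>x. v \<otimes> f x)"
  by (auto simp: klinear_iff tensor_def vec_eq_iff algebra_simps)

lemma lin_sweedler1 [lin]: "klinear f \<Longrightarrow> klinear (\<lambda>x. sweedler (f x) F)"
  by (auto simp: klinear_iff sweedler_def vec.scale_left_distrib sum.distrib vec.scale_sum_right)

lemma lin_sweedler2 [lin]: "(\<And>a b. klinear (\<lambda>x. F x a b)) \<Longrightarrow> klinear (\<lambda>x. sweedler t (F x))"
  by (auto simp: klinear_iff sweedler_def vec.scale_right_distrib sum.distrib vec.scale_sum_right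
      mult.commute)

lemma sweedler_pairs: "sweedler t F = (\<Sum>p\<in>UNIV. t $ p *s F (bas (fst p)) (bas (snd p)))"
  by (simp add: sweedler_def sum.cartesian_product UNIV_Times_UNIV case_prod_beta)

lemma linear_sweedler:
  assumes "klinear f" shows "f (sweedler t F) = sweedler t (\<lambda>a b. f (F a b))"
  by (simp add: sweedler_def vec.linear_sum[OF assms] vec.linear_scale[OF assms])

lemma tensor_scale: "(c *s x) \<otimes> y = c *s (x \<otimes> y)" "x \<otimes> (c *s y) = c *s (x \<otimes> y)"
  by (simp_all add: tensor_def vec_eq_iff)

lemma sweedler_sweedler:
  "sweedler (sweedler t F) G = sweedler t (\<lambda>a b. sweedler (F a b) G)"
  by (rule linear_sweedler) (intro lin)

lemma sweedler_tensor1: "sweedler t F \<otimes> v = sweedler t (\<lambda>a b. F a b \<otimes> v)"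
  by (rule linear_sweedler) (intro lin)

lemma sweedler_tensor2: "v \<otimes> sweedler t F = sweedler t (\<lambda>a b. v \<otimes> F a b)"
  by (rule linear_sweedler) (intro lin)

lemma sweedler_scale: "sweedler (c *s t) F = c *s sweedler t F"
  by (rule vec.linear_scale) (intro lin)

lemma scale_sweedler: "c *s sweedler t F = sweedler t (\<lambda>a b. c *s F a b)"
  by (rule linear_sweedler) (intro lin)

lemma sweedler_pure:
  assumes "\<And>b. klinear (\<lambda>a. F a b)" "\<And>a. klinear (\<lambda>b. F a b)"
  shows "sweedler (x \<otimes> y) F = F x y"
  using assms by (intro sweedler_tensor) (auto simp: kbilinear_def)

lemma sweedler_commute:
  "sweedler s (\<lambda>a b. sweedler t (\<lambda>c d. F a b c d)) = sweedler t (\<lambda>c d. sweedler s (\<lambda>a b. F a b c d))"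
  by (simp add: sweedler_pairs vec.scale_sum_right mult.commute) (rule sum.swap)

lemma bas_tensor: "bas i \<otimes> bas j = bas (i, j)"
  by (auto simp: tensor_def axis_def vec_eq_iff)

lemma sweedler_eta: "sweedler t (\<lambda>a b. a \<otimes> b) = t"
  by (simp add: sweedler_pairs bas_tensor basis_expansion)

lemma tensor_ext:
  assumes "klinear f" "klinear g" "\<And>x y. f (x \<otimes> y) = g (x \<otimes> y)"
  shows "f t = g t"
proof -
  have "f (sweedler t (\<lambda>a b. a \<otimes> b)) = g (sweedler t (\<lambda>a b. a \<otimes> b))"
    by (simp add: linear_sweedler[OF assms(1)] linear_sweedler[OF assms(2)] assms(3))
  then show ?thesis by (simp add: sweedler_eta)
qed

lemmas sw_pull = sweedler_sweedler sweedler_tensor1 sweedler_tensor2 scale_sweedler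

section \<open>Bialgebras and partially admissible mapping systems\<close>

locale bialg =
  fixes H :: "('k::field, 'h::finite) bialg"
  assumes bialgebra_H: "bialgebra H"
begin

abbreviation times_H (infixl "\<cdot>" 78) where "x \<cdot> y \<equiv> mul H x y"
abbreviation sw where "sw h F \<equiv> sweedler (comul H h) F"
abbreviation eps where "eps \<equiv> counit H"

lemma bilinear_mul: "kbilinear (mul H)"
  and mul_assoc: "(x \<cdot> y) \<cdot> z = x \<cdot> (y \<cdot> z)"
  and mul_one [simp]: "one H \<cdot> x = x" "x \<cdot> one H = x"
  using bialgebra_H by (auto simp: bialgebra_def algebra_str_def)

lemma linear_comul: "klinear (comul H)"
  and functional_eps: "kfunctional eps"
  and comul_one: "comul H (one H) = one H \<otimes> one H"
  and eps_mul [simp]: "eps (x \<cdot> y) = eps x * eps y"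
  and eps_one [simp]: "eps (one H) = 1"
  using bialgebra_H by (auto simp: bialgebra_def coalgebra_str_def)

lemma lin_mul1 [lin]: "klinear f \<Longrightarrow> klinear (\<lambda>x. f x \<cdot> v)"
  by (rule lin_compose[of "\<lambda>x. x \<cdot> v" f]) (use bilinear_mul in \<open>auto simp: kbilinear_def\<close>)

lemma lin_mul2 [lin]: "klinear f \<Longrightarrow> klinear (\<lambda>x. v \<cdot> f x)"
  by (rule lin_compose[of "\<lambda>x. v \<cdot> x" f]) (use bilinear_mul in \<open>auto simp: kbilinear_def\<close>)

lemma lin_comul [lin]: "klinear f \<Longrightarrow> klinear (\<lambda>x. comul H (f x))"
  by (rule lin_compose[OF linear_comul])

lemma lin_eps [lin]: "klinear f \<Longrightarrow> klinear (\<lambda>x. eps (f x) *s v)"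
  by (rule lin_functional[OF functional_eps])

lemma sw_coassoc:
  assumes "\<And>b c. klinear (\<lambda>a. F a b c)" "\<And>a c. klinear (\<lambda>b. F a b c)" "\<And>a b. klinear (\<lambda>c. F a b c)"
  shows "sw h (\<lambda>a b. sw a (\<lambda>c d. F c d b)) = sw h (\<lambda>a b. sw b (\<lambda>c d. F a c d))"
proof -
  have "sw h (\<lambda>x1 x2. sw x1 (\<lambda>x11 x12. x11 \<otimes> x12 \<otimes> x2)) = sw h (\<lambda>x1 x2. x1 \<otimes> comul H x2)"
    using bialgebra_H by (auto simp: bialgebra_def coalgebra_str_def)
  then have "sweedler (sw h (\<lambda>x1 x2. sw x1 (\<lambda>x11 x12. x11 \<otimes> x12 \<otimes> x2))) (\<lambda>a u. sweedler u (\<lambda>b c. F a b c)) =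
     sweedler (sw h (\<lambda>x1 x2. x1 \<otimes> comul H x2)) (\<lambda>a u. sweedler u (\<lambda>b c. F a b c))"
    by simp
  then show ?thesis
    by (simp add: sweedler_sweedler sweedler_pure lin assms)
qed

lemma sw_counit:
  assumes "klinear f"
  shows "sw h (\<lambda>a b. eps a *s f b) = f h" "sw h (\<lambda>a b. eps b *s f a) = f h"
proof -
  have "sw h (\<lambda>a b. eps a *s b) = h" "sw h (\<lambda>a b. eps b *s a) = h"
    using bialgebra_H by (auto simp: bialgebra_def coalgebra_str_def)
  then have "f (sw h (\<lambda>a b. eps a *s b)) = f h" "f (sw h (\<lambda>a b. eps b *s a)) = f h"
    by simp_all
  then show "sw h (\<lambda>a b. eps a *s f b) = f h" "sw h (\<lambda>a b. eps b *s f a) = f h"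
    by (simp_all add: linear_sweedler[OF assms] vec.linear_scale[OF assms])
qed

lemma sw_one:
  assumes "\<And>b. klinear (\<lambda>a. F a b)" "\<And>a. klinear (\<lambda>b. F a b)"
  shows "sw (one H) F = F (one H) (one H)"
  by (simp add: comul_one sweedler_pure assms)

lemma sw_mul:
  assumes "\<And>b. klinear (\<lambda>a. F a b)" "\<And>a. klinear (\<lambda>b. F a b)"
  shows "sw (x \<cdot> y) F = sw x (\<lambda>x1 x2. sw y (\<lambda>y1 y2. F (x1 \<cdot> y1) (x2 \<cdot> y2)))"
proof -
  have "comul H (x \<cdot> y) = tensor_mul (mul H) (mul H) (comul H x) (comul H y)"
    using bialgebra_H by (auto simp: bialgebra_def)
  then show ?thesis
    by (simp add: tensor_mul_def sweedler_sweedler sweedler_pure assms)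
qed

lemma mul_pull: "sweedler t F \<cdot> v = sweedler t (\<lambda>a b. F a b \<cdot> v)"
  "v \<cdot> sweedler t F = sweedler t (\<lambda>a b. v \<cdot> F a b)"
  "comul H (sweedler t F) = sweedler t (\<lambda>a b. comul H (F a b))"
  by (rule linear_sweedler; intro lin)+

lemma mul_scale: "(c *s u) \<cdot> v = c *s (u \<cdot> v)" "v \<cdot> (c *s u) = c *s (v \<cdot> u)"
  "comul H (c *s u) = c *s comul H u"
  by (rule vec.linear_scale; intro lin)+

lemma eps_scale: "eps (c *s u) = c * eps u"
  using functional_eps by (simp add: kfunctional_iff)

end

locale partial_dual =
  fixes H :: "('k::field, 'h::finite) bialg"
    and B :: "('k, 'h, 'b::finite) comod_alg"
    and C :: "('k, 'h, 'c::finite) mod_coalg"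
    and \<iota> :: "'k ^ 'b \<Rightarrow> 'k ^ 'h" and \<pi> :: "'k ^ 'h \<Rightarrow> 'k ^ 'c"
    and \<zeta> \<zeta>' :: "'k ^ 'h \<Rightarrow> 'k ^ 'b" and \<gamma> \<gamma>' :: "'k ^ 'c \<Rightarrow> 'k ^ 'h"
  assumes pams: "partially_admissible H B C \<iota> \<pi> \<zeta> \<gamma>"
    and conv_zeta: "conv_inverse (comul H) (counit H) (amul B) (aone B) \<zeta> \<zeta>'"
    and conv_gamma: "conv_inverse (ccomul C) (ccounit C) (mul H) (one H) \<gamma> \<gamma>'"

sublocale partial_dual \<subseteq> bialg H
  using pams by unfold_locales (simp add: partially_admissible_def hopf_algebra_def)

context partial_dual
begin

definition z where "z h = \<iota> (\<zeta> h)"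
definition e where "e h = \<gamma> (\<pi> h)"
definition zb where "zb h = \<iota> (\<zeta>' h)"
definition eb where "eb h = \<gamma>' (\<pi> h)"

lemma comod_B: "comodule_subalgebra H B \<iota>" and mod_C: "module_quotient_coalgebra H C \<pi>"
  and linear_zeta: "klinear \<zeta>" and linear_gamma: "klinear \<gamma>"
  using pams unfolding partially_admissible_def by blast+

lemma linear_iota: "klinear \<iota>" and linear_pi: "klinear \<pi>"
  and linear_zeta': "klinear \<zeta>'" and linear_gamma': "klinear \<gamma>'"
  and linear_coact: "klinear (coact B)" and linear_ccomul: "klinear (ccomul C)"
  and inj_iota: "inj \<iota>" and surj_pi: "surj \<pi>"
  and bilinear_amul: "kbilinear (amul B)" and bilinear_act: "kbilinear (act C)"
  and functional_ccounit: "kfunctional (ccounit C)"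
  using comod_B mod_C conv_zeta conv_gamma
  unfolding comodule_subalgebra_def comodule_algebra_def algebra_str_def conv_inverse_def
    module_quotient_coalgebra_def module_coalgebra_def coalgebra_str_def by blast+

lemmas lin_maps [lin] =
  lin_compose[OF linear_iota] lin_compose[OF linear_pi] lin_compose[OF linear_zeta]
  lin_compose[OF linear_zeta'] lin_compose[OF linear_gamma] lin_compose[OF linear_gamma']
  lin_compose[OF linear_coact] lin_compose[OF linear_ccomul]

lemma lin_amul [lin]: "klinear f \<Longrightarrow> klinear (\<lambda>x. amul B (f x) b)"
  "klinear f \<Longrightarrow> klinear (\<lambda>x. amul B b (f x))"
  by (rule lin_compose[of "\<lambda>x. amul B x b" f] lin_compose[of "amul B b" f];
      use bilinear_amul in \<open>simp add: kbilinear_def\<close>)+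

lemma lin_act [lin]: "klinear f \<Longrightarrow> klinear (\<lambda>x. act C (f x) g)"
  "klinear g' \<Longrightarrow> klinear (\<lambda>x. act C c (g' x))"
  by (rule lin_compose[of "\<lambda>x. act C x g" f] lin_compose[of "act C c" g'];
      use bilinear_act in \<open>simp add: kbilinear_def\<close>)+

lemma lin_ccounit [lin]: "klinear f \<Longrightarrow> klinear (\<lambda>x. ccounit C (f x) *s v)"
  by (rule lin_functional[OF functional_ccounit])

lemma lin_ze [lin]:
  "klinear f \<Longrightarrow> klinear (\<lambda>x. z (f x))" "klinear f \<Longrightarrow> klinear (\<lambda>x. zb (f x))"
  "klinear f \<Longrightarrow> klinear (\<lambda>x. e (f x))" "klinear f \<Longrightarrow> klinear (\<lambda>x. eb (f x))"
  unfolding z_def zb_def e_def eb_def by (intro lin; assumption)+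

lemma ze_pull:
  "z (sweedler t F) = sweedler t (\<lambda>a b. z (F a b))" "zb (sweedler t F) = sweedler t (\<lambda>a b. zb (F a b))"
  "e (sweedler t F) = sweedler t (\<lambda>a b. e (F a b))" "eb (sweedler t F) = sweedler t (\<lambda>a b. eb (F a b))"
  "\<iota> (sweedler t F') = sweedler t (\<lambda>a b. \<iota> (F' a b))" "\<pi> (sweedler t F) = sweedler t (\<lambda>a b. \<pi> (F a b))"
  "\<zeta> (sweedler t F) = sweedler t (\<lambda>a b. \<zeta> (F a b))" "\<zeta>' (sweedler t F) = sweedler t (\<lambda>a b. \<zeta>' (F a b))"
  "\<gamma> (sweedler t G) = sweedler t (\<lambda>a b. \<gamma> (G a b))" "\<gamma>' (sweedler t G) = sweedler t (\<lambda>a b. \<gamma>' (G a b))"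
  by (rule linear_sweedler; intro lin)+

lemma ze_scale:
  "z (c *s h) = c *s z h" "zb (c *s h) = c *s zb h" "e (c *s h) = c *s e h" "eb (c *s h) = c *s eb h"
  "\<iota> (c *s b) = c *s \<iota> b" "\<pi> (c *s h) = c *s \<pi> h"
  by (rule vec.linear_scale; intro lin)+

lemmas pull = sw_pull mul_pull ze_pull
lemmas scale = mul_scale ze_scale tensor_scale sweedler_scale

lemma iota_mul: "\<iota> (amul B b c) = \<iota> b \<cdot> \<iota> c" and iota_one: "\<iota> (aone B) = one H"
  and comul_iota: "comul H (\<iota> b) = sweedler (coact B b) (\<lambda>b1 b2. b1 \<otimes> \<iota> b2)"
  using comod_B by (auto simp: comodule_subalgebra_def)

lemma sw_iota:
  assumes "\<And>b. klinear (\<lambda>a. F a b)" "\<And>a. klinear (\<lambda>b. F a b)"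
  shows "sw (\<iota> b) F = sweedler (coact B b) (\<lambda>b1 b2. F b1 (\<iota> b2))"
  by (simp add: comul_iota sweedler_sweedler sweedler_pure assms)

abbreviation Bs where "Bs \<equiv> range \<iota>"

text \<open>\<open>B\<close> is a left coideal, so the second leg of the coproduct of an element of
  \<open>Bs\<close> may be taken in \<open>Bs\<close>. Ordinary congruence cannot see this, because
  \<open>sweedler\<close> sums over all basis vectors of \<open>H\<close>.\<close>

lemma sw_cong_B:
  assumes "b \<in> Bs" and "\<And>b1 b2. b2 \<in> Bs \<Longrightarrow> F b1 b2 = G b1 b2"
    and "\<And>b. klinear (\<lambda>a. F a b)" "\<And>a. klinear (\<lambda>b. F a b)"
    and "\<And>b. klinear (\<lambda>a. G a b)" "\<And>a. klinear (\<lambda>b. G a b)"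
  shows "sw b F = sw b G"
proof -
  obtain b' where b: "b = \<iota> b'" using assms(1) by blast
  show ?thesis unfolding b by (simp only: sw_iota[OF assms(3,4)] sw_iota[OF assms(5,6)] assms(2)[OF rangeI])
qed

lemma Bs_closed: "z h \<in> Bs" "zb h \<in> Bs" "one H \<in> Bs" "b \<in> Bs \<Longrightarrow> c \<in> Bs \<Longrightarrow> b \<cdot> c \<in> Bs"
  using rangeI[of \<iota> "aone B"] by (auto simp: z_def zb_def iota_one simp flip: iota_mul)

lemma pi_mul: "\<pi> (h \<cdot> k) = act C (\<pi> h) k"
  and ccomul_pi: "ccomul C (\<pi> h) = sw h (\<lambda>h1 h2. \<pi> h1 \<otimes> \<pi> h2)"
  and ccounit_pi: "ccounit C (\<pi> h) = eps h"
  using mod_C by (auto simp: module_quotient_coalgebra_def)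

lemma sw_ccomul_pi:
  assumes "\<And>b. klinear (\<lambda>a. F a b)" "\<And>a. klinear (\<lambda>b. F a b)"
  shows "sweedler (ccomul C (\<pi> h)) F = sw h (\<lambda>h1 h2. F (\<pi> h1) (\<pi> h2))"
  by (simp add: ccomul_pi sweedler_sweedler sweedler_pure assms)

lemma zeta_mul: "\<zeta> (\<iota> b \<cdot> h) = amul B b (\<zeta> h)"
  and gamma_colinear: "sw (\<gamma> x) (\<lambda>h1 h2. h1 \<otimes> \<pi> h2) = sweedler (ccomul C x) (\<lambda>x1 x2. \<gamma> x1 \<otimes> x2)"
  and zeta_one: "\<zeta> (one H) = aone B" and gamma_one: "\<gamma> (\<pi> (one H)) = one H"
  and eps_zeta: "eps (\<iota> (\<zeta> h)) = eps h" and eps_gamma: "eps (\<gamma> x) = ccounit C x"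
  and zeta_gamma: "sw h (\<lambda>h1 h2. \<iota> (\<zeta> h1) \<cdot> \<gamma> (\<pi> h2)) = h"
  and range_iota: "range \<iota> = {h. sw h (\<lambda>h1 h2. h1 \<otimes> \<pi> h2) = h \<otimes> \<pi> (one H)}"
  using pams unfolding partially_admissible_def by blast+

lemma z_mul: "b \<in> Bs \<Longrightarrow> z (b \<cdot> h) = b \<cdot> z h"
  by (auto simp: z_def zeta_mul iota_mul)

lemma z_one: "z (one H) = one H" and e_one: "e (one H) = one H"
  by (simp_all add: z_def e_def zeta_one iota_one gamma_one)

lemma eps_z [simp]: "eps (z h) = eps h" and eps_e [simp]: "eps (e h) = eps h"
  by (simp_all add: z_def e_def eps_zeta eps_gamma ccounit_pi)

lemma sw_ze: "sw h (\<lambda>h1 h2. z h1 \<cdot> e h2) = h"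
  by (simp add: z_def e_def zeta_gamma)

lemma z_id: "b \<in> Bs \<Longrightarrow> z b = b"
  using z_mul[of b "one H"] by (simp add: z_one)

lemma pi_coinv: "b \<in> Bs \<Longrightarrow> sw b (\<lambda>h1 h2. h1 \<otimes> \<pi> h2) = b \<otimes> \<pi> (one H)"
  using range_iota by blast

lemma pi_B: assumes "b \<in> Bs" shows "\<pi> b = eps b *s \<pi> (one H)"
proof -
  have "sweedler (sw b (\<lambda>h1 h2. h1 \<otimes> \<pi> h2)) (\<lambda>x y. eps x *s y) = sweedler (b \<otimes> \<pi> (one H)) (\<lambda>x y. eps x *s y)"
    by (simp add: pi_coinv assms)
  then show ?thesis
    by (simp add: sweedler_sweedler sweedler_pure lin sw_counit)
qed

lemma pi_B_mul: "b \<in> Bs \<Longrightarrow> \<pi> (b \<cdot> h) = eps b *s \<pi> h"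
  by (simp add: pi_mul pi_B vec.linear_scale[OF lin_act(1)[OF lin_id]] pi_mul[symmetric])

text \<open>Colinearity of \<open>\<gamma>\<close>, for functions whose second argument factors through \<open>\<pi>\<close>.\<close>

lemma sw_e:
  assumes "\<And>b. klinear (\<lambda>a. F a b)" "\<And>a. klinear (\<lambda>b. F a b)"
    and "\<And>a b b'. \<pi> b = \<pi> b' \<Longrightarrow> F a b = F a b'"
  shows "sw k (\<lambda>k1 k2. F (e k1) k2) = sw (e k) F"
proof -
  \<comment> \<open>Any section of \<open>\<pi>\<close> serves, linear or not:
    \<open>F a (s x)\<close> does not depend on the choice of lift and is therefore linear in
    \<open>x\<close>.\<close>
  define s where "s = inv \<pi>"
  have s: "\<pi> (s x) = x" for x unfolding s_def by (rule surj_f_inv_f[OF surj_pi])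
  have F: "F a b = F a (s (\<pi> b))" for a b by (rule assms) (simp add: s)
  have lin2: "klinear (\<lambda>x. F a (s x))" for a
    unfolding klinear_iff
  proof safe
    fix x y c
    have "F a (s (x + y)) = F a (s x + s y)"
      by (rule assms) (simp add: s vec.linear_add[OF linear_pi])
    then show "F a (s (x + y)) = F a (s x) + F a (s y)" by (simp add: vec.linear_add[OF assms(2)])
    have "F a (s (c *s x)) = F a (c *s s x)"
      by (rule assms) (simp add: s vec.linear_scale[OF linear_pi])
    then show "F a (s (c *s x)) = c *s F a (s x)" by (simp add: vec.linear_scale[OF assms(2)])
  qed
  have "sw (\<gamma> (\<pi> k)) (\<lambda>h1 h2. h1 \<otimes> \<pi> h2) = sweedler (ccomul C (\<pi> k)) (\<lambda>x1 x2. \<gamma> x1 \<otimes> x2)"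
    by (rule gamma_colinear)
  then have "sweedler (sw (\<gamma> (\<pi> k)) (\<lambda>h1 h2. h1 \<otimes> \<pi> h2)) (\<lambda>a x. F a (s x)) =
      sweedler (sweedler (ccomul C (\<pi> k)) (\<lambda>x1 x2. \<gamma> x1 \<otimes> x2)) (\<lambda>a x. F a (s x))" by simp
  moreover have "klinear (\<lambda>a. F (\<gamma> a) b)" for b
    by (rule lin_compose[OF assms(1) linear_gamma])
  ultimately have "sw (e k) (\<lambda>a b. F a (s (\<pi> b))) = sw k (\<lambda>a b. F (e a) (s (\<pi> b)))"
    by (simp add: sweedler_sweedler sweedler_pure lin lin2 assms(1,2) sw_ccomul_pi flip: e_def)
  then show ?thesis by (simp add: F[symmetric])
qed

end

section \<open>Twisted convolution and dual bases\<close>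

text \<open>Scalars stay nested instead of being multiplied together, since the counit rules consume
  one scalar factor at a time.\<close>

declare vec.scale_scale [simp del] vector_smult_assoc [simp del]

lemma bilinear_left: "kbilinear F \<Longrightarrow> klinear f \<Longrightarrow> klinear (\<lambda>x. F (f x) y)"
  by (rule lin_compose[of "\<lambda>x. F x y" f]) (auto simp: kbilinear_def)

lemma bilinear_right: "kbilinear F \<Longrightarrow> klinear f \<Longrightarrow> klinear (\<lambda>x. F y (f x))"
  by (rule lin_compose[of "F y" f]) (auto simp: kbilinear_def)

text \<open>The trivial premise keeps the simplifier from rejecting the instances of this rule as looping.\<close>

lemma sweedler_swap:
  "s = s \<Longrightarrow> sweedler s (\<lambda>a b. sweedler t (\<lambda>c d. F a b c d)) = sweedler t (\<lambda>c d. sweedler s (\<lambda>a b. F a b c d))"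
  by (rule sweedler_commute)

lemma sweedler_cong: "(\<And>a b. F a b = G a b) \<Longrightarrow> sweedler t F = sweedler t G"
  by (simp add: sweedler_def)

definition tensor_comul where
  "tensor_comul D D' t = sweedler t (\<lambda>a b. sweedler (D a) (\<lambda>a1 a2. sweedler (D' b) (\<lambda>b1 b2.
     (a1 \<otimes> b1) \<otimes> (a2 \<otimes> b2))))"

definition tensor_ev where
  "tensor_ev E E' s x = sweedler s (\<lambda>F G. sweedler x (\<lambda>h k. E F h \<otimes> E' G k))"

text \<open>The product formula for values, stated for arbitrary \<open>D\<close>,
  \<open>\<mu>\<close>, \<open>E\<close> and \<open>m\<close> so that it passes to tensor products:
  one computation for \<open>ev\<close> then gives the formulas for \<open>ev2\<close>,
  \<open>ev3\<close> and \<open>ev4\<close>.\<close>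

definition convolves where
  "convolves D \<mu> E m \<longleftrightarrow> klinear D \<and> kbilinear \<mu> \<and> kbilinear E \<and> kbilinear m \<and>
     (\<forall>F G x. E (m F G) x = sweedler (D x) (\<lambda>x1 x2. sweedler (D (E F x1)) (\<lambda>a1 a2. \<mu> a2 (E G (\<mu> x2 a1)))))"

lemma lin_tensor_comul: "klinear D \<Longrightarrow> klinear D' \<Longrightarrow> klinear (tensor_comul D D')"
  unfolding tensor_comul_def by (intro lin)

lemma lin_tensor_mul:
  assumes "kbilinear m" "kbilinear m'"
  shows "kbilinear (tensor_mul m m')"
  unfolding kbilinear_def tensor_mul_def
  by (intro conjI allI lin bilinear_left[OF assms(1)] bilinear_left[OF assms(2)])

lemma lin_tensor_ev:
  assumes "kbilinear E" "kbilinear E'"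
  shows "kbilinear (tensor_ev E E')"
  unfolding kbilinear_def tensor_ev_def by (intro conjI allI lin)

lemma tensor_comul_pure:
  assumes "klinear D" "klinear D'"
  shows "tensor_comul D D' (x \<otimes> y) = sweedler (D x) (\<lambda>a1 a2. sweedler (D' y) (\<lambda>b1 b2. (a1 \<otimes> b1) \<otimes> (a2 \<otimes> b2)))"
  unfolding tensor_comul_def
  by (rule sweedler_pure; intro lin lin_compose[OF assms(1)] lin_compose[OF assms(2)])

lemma tensor_mul_pure:
  assumes "kbilinear m" "kbilinear m'"
  shows "tensor_mul m m' (x \<otimes> y) (x' \<otimes> y') = m x x' \<otimes> m' y y'"
  by (simp add: tensor_mul_def sweedler_pure lin bilinear_left[OF assms(1)] bilinear_left[OF assms(2)]
      bilinear_right[OF assms(1)] bilinear_right[OF assms(2)])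

lemma tensor_ev_pure:
  assumes "kbilinear E" "kbilinear E'"
  shows "tensor_ev E E' (F \<otimes> G) (x \<otimes> y) = E F x \<otimes> E' G y"
  by (simp add: tensor_ev_def sweedler_pure lin bilinear_left[OF assms(1)] bilinear_left[OF assms(2)]
      bilinear_right[OF assms(1)] bilinear_right[OF assms(2)])

lemma sweedler_pull_left: "kbilinear m \<Longrightarrow> m (sweedler t F) v = sweedler t (\<lambda>a b. m (F a b) v)"
  by (rule linear_sweedler[of "\<lambda>x. m x v"]) (simp add: kbilinear_def)

lemma sweedler_pull_right: "kbilinear m \<Longrightarrow> m v (sweedler t F) = sweedler t (\<lambda>a b. m v (F a b))"
  by (rule linear_sweedler) (simp add: kbilinear_def)

lemmas sweedler_pull = sweedler_pull_left sweedler_pull_right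

text \<open>The two tensor factors do not interact, so on pure tensors only the order of the
  Sweedler sums has to be rearranged. \<open>tensor_ext\<close> then frees one argument at a
  time.\<close>

lemma convolves_tensor:
  assumes 1: "convolves D \<mu> E m" and 2: "convolves D' \<mu>' E' m'"
  shows "convolves (tensor_comul D D') (tensor_mul \<mu> \<mu>') (tensor_ev E E') (tensor_mul m m')"
proof -
  have D: "klinear D" "klinear D'" and mu: "kbilinear \<mu>" "kbilinear \<mu>'"
    and E: "kbilinear E" "kbilinear E'" and m: "kbilinear m" "kbilinear m'"
    and eq: "\<And>F G x. E (m F G) x = sweedler (D x) (\<lambda>x1 x2. sweedler (D (E F x1)) (\<lambda>a1 a2. \<mu> a2 (E G (\<mu> x2 a1))))"
      "\<And>F G x. E' (m' F G) x = sweedler (D' x) (\<lambda>x1 x2. sweedler (D' (E' F x1)) (\<lambda>a1 a2. \<mu>' a2 (E' G (\<mu>' x2 a1))))"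
    using assms by (simp_all add: convolves_def)
  let ?D = "tensor_comul D D'" and ?mu = "tensor_mul \<mu> \<mu>'" and ?E = "tensor_ev E E'" and ?m = "tensor_mul m m'"
  have D2: "klinear ?D" and mu2: "kbilinear ?mu" and E2: "kbilinear ?E" and m2: "kbilinear ?m"
    using D mu E m by (auto intro: lin_tensor_comul lin_tensor_mul lin_tensor_ev)
  note l = lin lin_compose[OF D(1)] lin_compose[OF D(2)] lin_compose[OF D2]
    bilinear_left[OF mu(1)] bilinear_left[OF mu(2)] bilinear_left[OF mu2]
    bilinear_left[OF E(1)] bilinear_left[OF E(2)] bilinear_left[OF E2]
    bilinear_left[OF m(1)] bilinear_left[OF m(2)] bilinear_left[OF m2]
    bilinear_right[OF mu(1)] bilinear_right[OF mu(2)] bilinear_right[OF mu2]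
    bilinear_right[OF E(1)] bilinear_right[OF E(2)] bilinear_right[OF E2]
    bilinear_right[OF m(1)] bilinear_right[OF m(2)] bilinear_right[OF m2]
  note p = tensor_comul_pure[OF D] tensor_mul_pure[OF mu] tensor_ev_pure[OF E] tensor_mul_pure[OF m]
  note pp = linear_sweedler[OF D2] sweedler_pull_left[OF mu2] sweedler_pull_right[OF mu2] sweedler_pull_left[OF E2] sweedler_pull_right[OF E2]
    sweedler_pull_left[OF mu(1)] sweedler_pull_left[OF mu(2)] sweedler_pull_left[OF E(1)] sweedler_pull_left[OF E(2)]
    sweedler_pull_right[OF mu(1)] sweedler_pull_right[OF mu(2)] sweedler_pull_right[OF E(1)] sweedler_pull_right[OF E(2)]
  have "?E (?m s t) x = sweedler (?D x) (\<lambda>x1 x2. sweedler (?D (?E s x1)) (\<lambda>a1 a2. ?mu a2 (?E t (?mu x2 a1))))"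
    (is "?L s t x = ?R s t x") for s t x
  proof -
    have pure: "?L (F \<otimes> F') (G \<otimes> G') (h \<otimes> h') = ?R (F \<otimes> F') (G \<otimes> G') (h \<otimes> h')" for F F' G G' h h'
      apply (simp only: p sweedler_pure sw_pull pp l eq)
      apply (subst (2) sweedler_commute)
      apply (simp only: sweedler_swap[where s = "D' (E' F' a)" for a])
      done
    have "?L (F \<otimes> F') (G \<otimes> G') x = ?R (F \<otimes> F') (G \<otimes> G') x" for F F' G G'
      by (rule tensor_ext[of "\<lambda>x. ?L (F \<otimes> F') (G \<otimes> G') x"]; (rule pure)?; intro l)
    then have "?L (F \<otimes> F') t x = ?R (F \<otimes> F') t x" for F F'
      by (rule_tac tensor_ext[of "\<lambda>t. ?L (F \<otimes> F') t x"]; assumption?; intro l)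
    then show ?thesis
      by (rule_tac tensor_ext[of "\<lambda>s. ?L s t x"]; assumption?; intro l)
  qed
  then show ?thesis using D2 mu2 E2 m2 by (simp add: convolves_def)
qed

text \<open>Each coordinate is read off from a single value by a functional \<open>w\<close>. Unlike
  mere injectivity of \<open>F \<mapsto> E F\<close>, this form passes to tensor products at once:
  coordinate \<open>(n, n')\<close> is read off at \<open>x \<otimes> x'\<close> by
  \<open>w \<otimes> w'\<close>.\<close>

definition separating where
  "separating E \<longleftrightarrow> (\<forall>n. \<exists>x w. \<forall>F. F $ n = scalar_product w (E F x))"

lemma separatingD: "separating E \<Longrightarrow> (\<And>x. E F x = E G x) \<Longrightarrow> F = G"
  unfolding separating_def vec_eq_iff[of F] by (metis (no_types))

lemma scalar_product_linear:
  fixes w :: "'k::field ^ 'n::finite"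
  shows "scalar_product w (\<Sum>i\<in>A. f i) = (\<Sum>i\<in>A. scalar_product w (f i))"
  "scalar_product w (c *s v) = c * scalar_product w v"
  by (simp_all add: scalar_product_def sum_distrib_left sum_component mult_ac sum.swap[of _ A])

lemma scalar_product_commute: "scalar_product x y = scalar_product y (x :: 'x::field ^ 'y::finite)"
  by (simp add: scalar_product_def mult.commute)

lemma scalar_product_tensor: "scalar_product (x \<otimes> y) (x' \<otimes> y') = scalar_product x x' * scalar_product y y'"
  unfolding scalar_product_def tensor_def UNIV_Times_UNIV[symmetric]
  by (simp add: sum.cartesian_product' sum_product mult_ac del: UNIV_Times_UNIV)

lemma scalar_product_bas: "scalar_product (bas i) x = x $ i" "scalar_product x (bas i) = x $ i"
  for x :: "'k::field ^ 'n::finite"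
  by (simp_all add: scalar_product_def axis_def if_distrib[of "\<lambda>u. u * _"] if_distrib[of "times _"] cong: if_cong)

lemma separating_tensor:
  fixes E :: "'k::field ^ 'a::finite \<Rightarrow> 'k ^ 'b::finite \<Rightarrow> 'k ^ 'c::finite"
    and E' :: "'k ^ 'd::finite \<Rightarrow> 'k ^ 'e::finite \<Rightarrow> 'k ^ 'f::finite"
  assumes "separating E" "separating E'" "kbilinear E" "kbilinear E'"
  shows "separating (tensor_ev E E')"
  unfolding separating_def
proof
  fix p :: "'a \<times> 'd"
  obtain n n' where p: "p = (n, n')" by fastforce
  obtain x w where 1: "\<And>F. F $ n = scalar_product w (E F x)" using assms(1) unfolding separating_def by metis
  obtain x' w' where 2: "\<And>F. F $ n' = scalar_product w' (E' F x')" using assms(2) unfolding separating_def by metis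
  have "s $ p = scalar_product (w \<otimes> w') (tensor_ev E E' s (x \<otimes> x'))" for s
  proof -
    have "tensor_ev E E' s (x \<otimes> x') = sweedler s (\<lambda>F G. E F x \<otimes> E' G x')"
      unfolding tensor_ev_def
      by (simp add: sweedler_pure lin bilinear_right[OF assms(3)] bilinear_right[OF assms(4)])
    then have "scalar_product (w \<otimes> w') (tensor_ev E E' s (x \<otimes> x')) =
       (\<Sum>q\<in>UNIV. s $ q * (bas (fst q) $ n * bas (snd q) $ n'))"
      by (simp add: sweedler_pairs scalar_product_linear scalar_product_tensor 1 2)
    also have "\<dots> = sweedler s (\<lambda>a b. a \<otimes> b) $ p"
      by (simp add: sweedler_pairs p tensor_def scalar_product_bas)
    finally show ?thesis by (simp add: sweedler_eta)
  qed
  then show "\<exists>x w. \<forall>F. F $ p = scalar_product w (tensor_ev E E' F x)" by blast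
qed

section \<open>Contraction of dual bases and evaluation of dual structure maps\<close>

lemma basis_ext:
  assumes "klinear f" "klinear g" "\<And>i. f (bas i) = g (bas i)"
  shows "f x = g x"
proof -
  have "f (\<Sum>i\<in>UNIV. x $ i *s bas i) = g (\<Sum>i\<in>UNIV. x $ i *s bas i)"
    by (simp only: vec.linear_sum[OF assms(1)] vec.linear_sum[OF assms(2)]
        vec.linear_scale[OF assms(1)] vec.linear_scale[OF assms(2)] assms(3))
  then show ?thesis by (simp add: basis_expansion)
qed

text \<open>Contracts a pair of dual bases. This is how the sums over \<open>bas i\<close> in the
  definitions of the left partial dual disappear once values are taken.\<close>

lemma sum_basis:
  assumes "klinear f"
  shows "(\<Sum>i\<in>UNIV. scalar_product (bas i) x *s f (bas i)) = f x"
proof -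
  have "f (\<Sum>i\<in>UNIV. x $ i *s bas i) = (\<Sum>i\<in>UNIV. x $ i *s f (bas i))"
    by (simp only: vec.linear_sum[OF assms] vec.linear_scale[OF assms])
  then show ?thesis by (simp add: basis_expansion scalar_product_bas)
qed

lemma sweedler_functionals:
  "sweedler t (\<lambda>a b. scalar_product a x *s (scalar_product b y *s v)) = scalar_product t (x \<otimes> y) *s v"
proof (rule tensor_ext[of "\<lambda>t. sweedler t (\<lambda>a b. scalar_product a x *s (scalar_product b y *s v))"])
  show "sweedler (a \<otimes> b) (\<lambda>a b. scalar_product a x *s (scalar_product b y *s v)) =
      scalar_product (a \<otimes> b) (x \<otimes> y) *s v" for a b
    by (simp add: lin sweedler_pure) (simp add: scalar_product_tensor vec.scale_scale)
qed (intro lin)+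

lemma tensor_functionals:
  "scalar_product (f \<otimes> g) t *s v = sweedler t (\<lambda>a b. scalar_product f a *s (scalar_product g b *s v))"
  by (rule tensor_ext[of "\<lambda>t. scalar_product (f \<otimes> g) t *s v"])
    (simp_all add: lin sweedler_pure, simp add: scalar_product_tensor vec.scale_scale)

lemma dual_mul_sp:
  assumes "klinear D"
  shows "scalar_product (dual_mul D f g) x *s v = sweedler (D x) (\<lambda>a b. scalar_product f a *s (scalar_product g b *s v))"
proof (rule basis_ext[of "\<lambda>x. scalar_product (dual_mul D f g) x *s v"])
  show "scalar_product (dual_mul D f g) (bas i) *s v =
      sweedler (D (bas i)) (\<lambda>a b. scalar_product f a *s (scalar_product g b *s v))" for i
    by (simp add: dual_mul_def scalar_product_bas) (rule tensor_functionals)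
qed (intro lin assms)+

lemma dual_comul_sp:
  assumes "kbilinear m"
  shows "sweedler (dual_comul m f) (\<lambda>a b. scalar_product a x *s (scalar_product b y *s v)) = scalar_product f (m x y) *s v"
    (is "?L x y = ?R x y")
proof -
  have "?L (bas i) (bas j) = ?R (bas i) (bas j)" for i j
    by (simp only: sweedler_functionals bas_tensor) (simp add: scalar_product_bas dual_comul_def)
  then have "?L (bas i) y = ?R (bas i) y" for i
    by (rule_tac basis_ext[of "\<lambda>y. ?L (bas i) y"]; assumption?; intro lin bilinear_right[OF assms])
  then show ?thesis
    by (rule_tac basis_ext[of "\<lambda>x. ?L x y"]; assumption?; intro lin bilinear_left[OF assms])
qed

lemma dual_coact_sp:
  assumes "kbilinear (act C)"
  shows "sweedler (dual_coact C f) (\<lambda>a b. scalar_product a x *s (scalar_product b y *s v)) = scalar_product f (act C x y) *s v"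
    (is "?L x y = ?R x y")
proof -
  have "?L (bas i) (bas j) = ?R (bas i) (bas j)" for i j
    by (simp only: sweedler_functionals bas_tensor) (simp add: scalar_product_bas dual_coact_def)
  then have "?L (bas i) y = ?R (bas i) y" for i
    by (rule_tac basis_ext[of "\<lambda>y. ?L (bas i) y"]; assumption?; intro lin bilinear_right[OF assms])
  then show ?thesis
    by (rule_tac basis_ext[of "\<lambda>x. ?L x y"]; assumption?; intro lin bilinear_left[OF assms])
qed

lemma dual_one_sp:
  assumes "kfunctional d"
  shows "scalar_product (dual_one d) x *s v = d x *s v"
  by (rule basis_ext[of "\<lambda>x. scalar_product (dual_one d) x *s v"])
    (simp_all add: dual_one_def scalar_product_bas lin lin_functional[OF assms])

lemma scalar_product_left:
  fixes x y w :: "'k::field ^ 'n::finite"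
  shows "scalar_product (x + y) w = scalar_product x w + scalar_product y w"
    "scalar_product (c *s x) w = c * scalar_product x w"
  by (simp_all add: scalar_product_def distrib_right sum.distrib sum_distrib_left mult.assoc)

lemma tensor_add: "(x + y) \<otimes> w = x \<otimes> w + y \<otimes> w" "w \<otimes> (x + y) = w \<otimes> x + w \<otimes> y"
  by (simp_all add: tensor_def vec_eq_iff algebra_simps)

lemma lin_dual_mul: "kbilinear (dual_mul D)"
  by (simp add: kbilinear_def klinear_iff dual_mul_def vec_eq_iff tensor_add tensor_scale scalar_product_left)

lemma lin_dual_map: "klinear (dual_map f)"
  by (simp add: dual_map_def klinear_iff matrix_vector_right_distrib vector_scalar_commute)

lemma lin_dual_comul: "klinear (dual_comul m)"
  by (simp add: klinear_iff dual_comul_def vec_eq_iff scalar_product_left)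

lemma lin_dual_coact: "klinear (dual_coact C)"
  by (simp add: klinear_iff dual_coact_def vec_eq_iff scalar_product_left)

lemmas lin_dual [lin] = bilinear_left[OF lin_dual_mul] bilinear_right[OF lin_dual_mul]
  lin_compose[OF lin_dual_map] lin_compose[OF lin_dual_comul] lin_compose[OF lin_dual_coact]

lemma linear_sum_pull: "klinear f \<Longrightarrow> f (\<Sum>i\<in>A. g i) = (\<Sum>i\<in>A. f (g i))"
  by (rule vec.linear_sum)

lemma sweedler_sum: "sweedler (\<Sum>i\<in>A. t i) F = (\<Sum>i\<in>A. sweedler (t i) F)"
  by (rule vec.linear_sum) (intro lin)

lemma sweedler_sum_commute: "(\<Sum>i\<in>A. sweedler t (F i)) = sweedler t (\<lambda>a b. \<Sum>i\<in>A. F i a b)"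
  by (simp add: sweedler_pairs vec.scale_sum_right) (rule sum.swap)

context partial_dual begin

lemma sw_ze_comul:
  assumes "\<And>b. klinear (\<lambda>a. F a b)" "\<And>a. klinear (\<lambda>b. F a b)"
  shows "sw m (\<lambda>m1 m2. sw (z m1) (\<lambda>p1 p2. sw (e m2) (\<lambda>k1 k2. F (p1 \<cdot> k1) (p2 \<cdot> k2)))) = sw m F"
proof -
  have "sw m F = sw (sw m (\<lambda>h1 h2. z h1 \<cdot> e h2)) F" by (simp only: sw_ze)
  then show ?thesis by (simp only: pull sw_mul assms)
qed

lemma z_z: "z (z h \<cdot> k) = z h \<cdot> z k"
  by (rule z_mul) (rule Bs_closed)

text \<open>The factor \<open>z m1\<close> lies in \<open>Bs\<close>, so it moves inside the other
  \<open>z\<close>, where it meets \<open>e m2\<close> and the two recombine to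
  \<open>m\<close>.\<close>

lemma sw_z_fold: "sw m (\<lambda>m1 m2. z m1 \<cdot> z (e m2 \<cdot> x)) = z (m \<cdot> x)"
proof -
  have "z (m \<cdot> x) = z (sw m (\<lambda>h1 h2. z h1 \<cdot> e h2) \<cdot> x)" by (simp only: sw_ze)
  then show ?thesis by (simp only: pull mul_assoc z_z)
qed

lemma sw_z_zb: "sw h (\<lambda>h1 h2. z h1 \<cdot> zb h2) = eps h *s one H"
  and sw_zb_z: "sw h (\<lambda>h1 h2. zb h1 \<cdot> z h2) = eps h *s one H"
proof -
  have "sw h (\<lambda>h1 h2. amul B (\<zeta> h1) (\<zeta>' h2)) = eps h *s aone B"
    "sw h (\<lambda>h1 h2. amul B (\<zeta>' h1) (\<zeta> h2)) = eps h *s aone B"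
    using conv_zeta by (auto simp: conv_inverse_def)
  then have "\<iota> (sw h (\<lambda>h1 h2. amul B (\<zeta> h1) (\<zeta>' h2))) = \<iota> (eps h *s aone B)"
    "\<iota> (sw h (\<lambda>h1 h2. amul B (\<zeta>' h1) (\<zeta> h2))) = \<iota> (eps h *s aone B)" by simp_all
  then show "sw h (\<lambda>h1 h2. z h1 \<cdot> zb h2) = eps h *s one H" "sw h (\<lambda>h1 h2. zb h1 \<cdot> z h2) = eps h *s one H"
    by (simp_all only: ze_pull ze_scale iota_mul iota_one z_def zb_def)
qed

lemma sw_e_eb: "sw h (\<lambda>h1 h2. e h1 \<cdot> eb h2) = eps h *s one H"
  and sw_eb_e: "sw h (\<lambda>h1 h2. eb h1 \<cdot> e h2) = eps h *s one H"
proof -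
  have "sweedler (ccomul C (\<pi> h)) (\<lambda>h1 h2. \<gamma> h1 \<cdot> \<gamma>' h2) = eps h *s one H"
    "sweedler (ccomul C (\<pi> h)) (\<lambda>h1 h2. \<gamma>' h1 \<cdot> \<gamma> h2) = eps h *s one H"
    using conv_gamma by (auto simp: conv_inverse_def ccounit_pi)
  then show "sw h (\<lambda>h1 h2. e h1 \<cdot> eb h2) = eps h *s one H" "sw h (\<lambda>h1 h2. eb h1 \<cdot> e h2) = eps h *s one H"
    by (simp_all only: sw_ccomul_pi lin e_def eb_def)
qed

text \<open>The counit applied to the first leg of the colinearity of \<open>\<gamma>\<close>. Hence
  values of elements of the left partial dual do not distinguish \<open>h\<close> from
  \<open>e h\<close>.\<close>

lemma pi_e: "\<pi> (e h) = \<pi> h"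
proof -
  have "sweedler (sw (\<gamma> (\<pi> h)) (\<lambda>h1 h2. h1 \<otimes> \<pi> h2)) (\<lambda>a b. eps a *s b) =
      sweedler (sweedler (ccomul C (\<pi> h)) (\<lambda>x1 x2. \<gamma> x1 \<otimes> x2)) (\<lambda>a b. eps a *s b)"
    by (simp only: gamma_colinear)
  then show ?thesis
    by (simp add: sweedler_sweedler sweedler_pure lin sw_counit sw_ccomul_pi flip: e_def)
qed

section \<open>Values of elements of the left partial dual and its algebra structure\<close>

definition ev :: "'k ^ ('c \<times> 'b) \<Rightarrow> 'k ^ 'h \<Rightarrow> 'k ^ 'h" where
  "ev F h = \<iota> (sweedler F (\<lambda>f b. scalar_product f (\<pi> h) *s b))"

lemma ev_Bs: "ev F h \<in> Bs" by (simp add: ev_def)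

lemma ev_cong: "\<pi> h = \<pi> h' \<Longrightarrow> ev F h = ev F h'" by (simp add: ev_def)

lemma lin_ev [lin]: "klinear f \<Longrightarrow> klinear (\<lambda>x. ev (f x) h)"  "klinear g \<Longrightarrow> klinear (\<lambda>x. ev F (g x))"
  unfolding ev_def by (intro lin; assumption)+

lemma bilinear_ev: "kbilinear ev" unfolding kbilinear_def by (intro conjI allI lin)

lemma ev_pull: "ev (sweedler t F') h = sweedler t (\<lambda>a b. ev (F' a b) h)"
  "ev F (sweedler t G) = sweedler t (\<lambda>a b. ev F (G a b))"
  by (rule linear_sweedler[of "\<lambda>F. ev F h"] linear_sweedler; intro lin)+

lemma ev_scale: "ev (c *s F) h = c *s ev F h" "ev F (c *s h) = c *s ev F h"
  by (rule vec.linear_scale[of "\<lambda>F. ev F h"] vec.linear_scale; intro lin)+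

lemma ev_pure: "ev (f \<otimes> b) h = scalar_product f (\<pi> h) *s \<iota> b"
  by (simp add: ev_def sweedler_pure lin ze_scale)

lemma ev_B_mul: "b \<in> Bs \<Longrightarrow> ev F (b \<cdot> h) = eps b *s ev F h"
  using ev_cong[of "b \<cdot> h" "eps b *s h" F] by (simp add: pi_B_mul ze_scale ev_scale)

text \<open>The coordinate \<open>(c, b)\<close> is read off at a lift of \<open>bas c\<close> along
  the surjection \<open>\<pi>\<close>, by the coordinate \<open>b\<close> of a linear left inverse
  of the injection \<open>\<iota>\<close>.\<close>

lemma separating_ev: "separating ev"
  unfolding separating_def
proof
  fix p :: "'c \<times> 'b"
  obtain c b where p: "p = (c, b)" by fastforce
  obtain x where x: "\<pi> x = bas c" using surj_pi by (metis surj_def)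
  obtain \<rho> where rho: "klinear \<rho>" "\<rho> \<circ> \<iota> = id"
    using vec.linear_injective_left_inverse[OF linear_iota inj_iota] by blast
  define w where "w = (\<chi> i. \<rho> (bas i) $ b)"
  have w: "scalar_product w y = \<rho> y $ b" for y
  proof -
    have "\<rho> y = \<rho> (\<Sum>i\<in>UNIV. y $ i *s bas i)" by (simp add: basis_expansion)
    also have "\<dots> = (\<Sum>i\<in>UNIV. y $ i *s \<rho> (bas i))"
      by (simp only: vec.linear_sum[OF rho(1)] vec.linear_scale[OF rho(1)])
    finally show ?thesis by (simp add: w_def scalar_product_def mult.commute)
  qed
  have "F $ p = scalar_product w (ev F x)" for F
  proof -
    have "scalar_product w (ev F x) = sweedler F (\<lambda>f b. scalar_product f (bas c) *s b) $ b"
      using rho(2) by (simp add: w ev_def x o_def id_def fun_eq_iff)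
    also have "\<dots> = sweedler F (\<lambda>f b. f \<otimes> b) $ p"
      by (simp add: sweedler_pairs p tensor_def scalar_product_bas)
    finally show ?thesis by (simp add: sweedler_eta)
  qed
  then show "\<exists>x w. \<forall>F. F $ p = scalar_product w (ev F x)" by blast
qed

abbreviation km where "km \<equiv> lpd_mul B C"
abbreviation ku where "ku \<equiv> cdual_one C \<otimes> aone B"
abbreviation kd where "kd \<equiv> lpd_comul H B C \<zeta> \<gamma>"

lemma lin_km: "kbilinear km"
  unfolding kbilinear_def lpd_mul_def by (intro conjI allI lin)

lemma lin_km' [lin]: "klinear f \<Longrightarrow> klinear (\<lambda>x. km (f x) y)" "klinear f \<Longrightarrow> klinear (\<lambda>x. km y (f x))"
  by (rule bilinear_left[OF lin_km] bilinear_right[OF lin_km]; assumption)+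

text \<open>The coaction on \<open>g\<close> and the pairing of \<open>g2\<close> with
  \<open>b1\<close> fuse, by duality, into \<open>g\<close> evaluated at
  \<open>act C (\<pi> h2) b1\<close>. This is \<open>\<pi> (h2 \<cdot> b1)\<close>, so the action on
  \<open>C\<close> becomes multiplication in \<open>H\<close>.\<close>

lemma ev_km: "ev (km F G) h = sw h (\<lambda>h1 h2. sw (ev F h1) (\<lambda>a1 a2. a2 \<cdot> ev G (h2 \<cdot> a1)))"
proof -
  have 1: "ev (km (f \<otimes> b) (g \<otimes> c)) h = sw h (\<lambda>h1 h2. sw (ev (f \<otimes> b) h1) (\<lambda>a1 a2. a2 \<cdot> ev (g \<otimes> c) (h2 \<cdot> a1)))"
    for f b g c
  proof -
    have "ev (km (f \<otimes> b) (g \<otimes> c)) h = sweedler (dual_coact C g) (\<lambda>g1 g2. sweedler (coact B b) (\<lambda>b1 b2.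
        scalar_product g2 b1 *s (scalar_product (cdual_mul C f g1) (\<pi> h) *s (\<iota> b2 \<cdot> \<iota> c))))"
      by (simp only: lpd_mul_def sweedler_pure lin ev_pull ev_scale ev_pure iota_mul)
    also have "\<dots> = sweedler (dual_coact C g) (\<lambda>g1 g2. sweedler (coact B b) (\<lambda>b1 b2. sw h (\<lambda>h1 h2.
        scalar_product f (\<pi> h1) *s (scalar_product g1 (\<pi> h2) *s (scalar_product g2 b1 *s (\<iota> b2 \<cdot> \<iota> c))))))"
      by (simp only: dual_mul_sp[OF linear_ccomul] sw_ccomul_pi lin scale_sweedler)
        (simp add: vec.scale_scale mult_ac)
    also have "\<dots> = sw h (\<lambda>h1 h2. sweedler (coact B b) (\<lambda>b1 b2.
        scalar_product f (\<pi> h1) *s (scalar_product g (act C (\<pi> h2) b1) *s (\<iota> b2 \<cdot> \<iota> c))))"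
      apply (simp only: sweedler_swap[where s = "dual_coact C g"])
      apply (subst sweedler_commute)
      apply (simp only: scale_sweedler[symmetric] dual_coact_sp[OF bilinear_act])
      done
    also have "\<dots> = sw h (\<lambda>h1 h2. sw (ev (f \<otimes> b) h1) (\<lambda>a1 a2. a2 \<cdot> ev (g \<otimes> c) (h2 \<cdot> a1)))"
      by (simp only: ev_pure sweedler_scale scale mul_scale sw_iota lin scale_sweedler pi_mul)
    finally show ?thesis .
  qed
  have "ev (km (f \<otimes> b) G) h = sw h (\<lambda>h1 h2. sw (ev (f \<otimes> b) h1) (\<lambda>a1 a2. a2 \<cdot> ev G (h2 \<cdot> a1)))" for f b
    by (rule tensor_ext[of "\<lambda>G. ev (km (f \<otimes> b) G) h", OF _ _ 1]; intro lin)
  then show ?thesis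
    by (rule_tac tensor_ext[of "\<lambda>F. ev (km F G) h"]; assumption?; intro lin)
qed

lemma convolves_ev: "convolves (comul H) (mul H) ev km"
  unfolding convolves_def using linear_comul bilinear_mul bilinear_ev lin_km ev_km by blast

lemma ev_ku: "ev ku h = eps h *s one H"
  by (simp add: ev_pure dual_one_sp[OF functional_ccounit] iota_one ccounit_pi)

lemma ev_ext: "(\<And>h. ev F h = ev G h) \<Longrightarrow> F = G"
  by (rule separatingD[OF separating_ev])

lemma algebra_K: "algebra_str km ku"
  unfolding algebra_str_def
proof (intro conjI allI)
  show "kbilinear km" by (rule lin_km)
  show "km (km F G) K = km F (km G K)" for F G K
    by (rule ev_ext) (simp only: ev_km sw_mul sw_coassoc lin pull mul_assoc,
       simp only: sweedler_swap[where s = "comul H (ev F a)" for a] sw_coassoc lin)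
  show "km ku F = F" for F
    by (rule ev_ext) (simp only: ev_km ev_ku sw_one sweedler_scale scale mul_one lin sw_counit)
  show "km F ku = F" for F
    by (rule ev_ext) (simp only: ev_km ev_ku scale mul_one lin sw_counit eps_mul vec.scale_scale[symmetric],
        simp only: scale_sweedler[symmetric] sw_counit lin)
qed

abbreviation "D2 \<equiv> tensor_comul (comul H) (comul H)"
abbreviation "D3 \<equiv> tensor_comul (comul H) D2"
abbreviation "D4 \<equiv> tensor_comul (comul H) D3"
abbreviation "m2 \<equiv> tensor_mul (mul H) (mul H)"
abbreviation "m3 \<equiv> tensor_mul (mul H) m2"
abbreviation "m4 \<equiv> tensor_mul (mul H) m3"
abbreviation "ev2 \<equiv> tensor_ev ev ev"
abbreviation "ev3 \<equiv> tensor_ev ev ev2"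
abbreviation "ev4 \<equiv> tensor_ev ev ev3"
abbreviation "km2 \<equiv> tensor_mul km km"
abbreviation "km3 \<equiv> tensor_mul km km2"
abbreviation "km4 \<equiv> tensor_mul km km3"

lemmas conv2 = convolves_tensor[OF convolves_ev convolves_ev]
lemmas conv3 = convolves_tensor[OF convolves_ev conv2]
lemmas conv4 = convolves_tensor[OF convolves_ev conv3]

lemmas linD = linear_comul lin_tensor_comul[OF linear_comul linear_comul]
  lin_tensor_comul[OF linear_comul lin_tensor_comul[OF linear_comul linear_comul]]
  lin_tensor_comul[OF linear_comul lin_tensor_comul[OF linear_comul lin_tensor_comul[OF linear_comul linear_comul]]]
lemmas bilm2 = lin_tensor_mul[OF bilinear_mul bilinear_mul]
lemmas bilm3 = lin_tensor_mul[OF bilinear_mul bilm2]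
lemmas bilm4 = lin_tensor_mul[OF bilinear_mul bilm3]
lemmas bilkm2 = lin_tensor_mul[OF lin_km lin_km]
lemmas bilkm3 = lin_tensor_mul[OF lin_km bilkm2]
lemmas bilkm4 = lin_tensor_mul[OF lin_km bilkm3]
lemmas bilev2 = lin_tensor_ev[OF bilinear_ev bilinear_ev]
lemmas bilev3 = lin_tensor_ev[OF bilinear_ev bilev2]
lemmas bilev4 = lin_tensor_ev[OF bilinear_ev bilev3]

lemmas lin_tens = lin lin_compose[OF linD(2)] lin_compose[OF linD(3)] lin_compose[OF linD(4)]
  bilinear_left[OF bilm2] bilinear_left[OF bilm3] bilinear_left[OF bilm4]
  bilinear_right[OF bilm2] bilinear_right[OF bilm3] bilinear_right[OF bilm4]
  bilinear_left[OF bilkm2] bilinear_left[OF bilkm3] bilinear_left[OF bilkm4]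
  bilinear_right[OF bilkm2] bilinear_right[OF bilkm3] bilinear_right[OF bilkm4]
  bilinear_left[OF bilev2] bilinear_left[OF bilev3] bilinear_left[OF bilev4]
  bilinear_right[OF bilev2] bilinear_right[OF bilev3] bilinear_right[OF bilev4]

lemmas pull_tens = pull ev_pull linear_sweedler[OF linD(2)] linear_sweedler[OF linD(3)] linear_sweedler[OF linD(4)]
  sweedler_pull_left[OF bilm2] sweedler_pull_left[OF bilm3] sweedler_pull_left[OF bilm4]
  sweedler_pull_right[OF bilm2] sweedler_pull_right[OF bilm3] sweedler_pull_right[OF bilm4]
  sweedler_pull_left[OF bilev2] sweedler_pull_left[OF bilev3] sweedler_pull_left[OF bilev4]
  sweedler_pull_right[OF bilev2] sweedler_pull_right[OF bilev3] sweedler_pull_right[OF bilev4]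

lemmas pure_tens = sweedler_pure tensor_comul_pure[OF linD(1) linD(1)] tensor_comul_pure[OF linD(1) linD(2)]
  tensor_comul_pure[OF linD(1) linD(3)] tensor_mul_pure[OF bilinear_mul bilinear_mul]
  tensor_mul_pure[OF bilinear_mul bilm2] tensor_mul_pure[OF bilinear_mul bilm3]
  tensor_ev_pure[OF bilinear_ev bilinear_ev] tensor_ev_pure[OF bilinear_ev bilev2] tensor_ev_pure[OF bilinear_ev bilev3]
  tensor_mul_pure[OF lin_km lin_km] tensor_mul_pure[OF lin_km bilkm2] tensor_mul_pure[OF lin_km bilkm3]

lemma ev_km2: "ev2 (km2 s t) x = sweedler (D2 x) (\<lambda>x1 x2. sweedler (D2 (ev2 s x1)) (\<lambda>a1 a2. m2 a2 (ev2 t (m2 x2 a1))))"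
  and ev_km3: "ev3 (km3 s' t') x' = sweedler (D3 x') (\<lambda>x1 x2. sweedler (D3 (ev3 s' x1)) (\<lambda>a1 a2. m3 a2 (ev3 t' (m3 x2 a1))))"
  and ev_km4: "ev4 (km4 s'' t'') x'' = sweedler (D4 x'') (\<lambda>x1 x2. sweedler (D4 (ev4 s'' x1)) (\<lambda>a1 a2. m4 a2 (ev4 t'' (m4 x2 a1))))"
  using conv2 conv3 conv4 unfolding convolves_def by blast+

lemma ev2_ext: assumes "\<And>h k. ev2 s (h \<otimes> k) = ev2 t (h \<otimes> k)" shows "s = t"
proof (rule separatingD[OF separating_tensor[OF separating_ev separating_ev bilinear_ev bilinear_ev]])
  show "ev2 s x = ev2 t x" for x
    by (rule tensor_ext[of "ev2 s" "ev2 t"]) (use bilev2 assms in \<open>auto simp: kbilinear_def\<close>)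
qed

text \<open>These conditional rules move Sweedler sums over coproducts of values of \<open>z\<close>, \<open>zb\<close>, \<open>e\<close>, \<open>eb\<close>, \<open>ev\<close>
  inside all other sums, which makes simplification by \<open>norm2\<close> below confluent enough to decide the identities.\<close>

definition is_var where "is_var t \<longleftrightarrow> True"
lemma is_var: "NO_MATCH (comul H (z a)) t \<Longrightarrow> NO_MATCH (comul H (zb a)) t \<Longrightarrow> NO_MATCH (comul H (e a)) t \<Longrightarrow>
   NO_MATCH (comul H (eb a)) t \<Longrightarrow> NO_MATCH (comul H (ev b a)) t \<Longrightarrow> is_var t"
  by (simp add: is_var_def)

lemma float_var:
  "is_var t \<Longrightarrow> sw (z x) (\<lambda>a b. sweedler t (\<lambda>c d. F a b c d)) = sweedler t (\<lambda>c d. sw (z x) (\<lambda>a b. F a b c d))"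
  "is_var t \<Longrightarrow> sw (zb x) (\<lambda>a b. sweedler t (\<lambda>c d. F a b c d)) = sweedler t (\<lambda>c d. sw (zb x) (\<lambda>a b. F a b c d))"
  "is_var t \<Longrightarrow> sw (e x) (\<lambda>a b. sweedler t (\<lambda>c d. F a b c d)) = sweedler t (\<lambda>c d. sw (e x) (\<lambda>a b. F a b c d))"
  "is_var t \<Longrightarrow> sw (eb x) (\<lambda>a b. sweedler t (\<lambda>c d. F a b c d)) = sweedler t (\<lambda>c d. sw (eb x) (\<lambda>a b. F a b c d))"
  "is_var t \<Longrightarrow> sw (ev f x) (\<lambda>a b. sweedler t (\<lambda>c d. F a b c d)) = sweedler t (\<lambda>c d. sw (ev f x) (\<lambda>a b. F a b c d))"
  by (rule sweedler_commute)+

lemmas norm = is_var float_var sw_mul sw_coassoc lin pull ev_pull mul_assoc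

section \<open>Values of the coproduct, of the associator and of its inverse\<close>

lemma lin_kd: "klinear kd"
  unfolding lpd_comul_def by (intro lin)

lemma lin_kd' [lin]: "klinear f \<Longrightarrow> klinear (\<lambda>x. kd (f x))"
  by (rule lin_compose[OF lin_kd])

text \<open>Contracting both dual bases leaves \<open>z g2 \<cdot> z (e k2 \<cdot> b1)\<close> with
  \<open>g1\<close>, \<open>g2\<close> the legs of \<open>e k1\<close>. Colinearity of
  \<open>\<gamma>\<close> turns \<open>e k1\<close> and \<open>k2\<close> into the legs of
  \<open>e k\<close>, after which \<open>sw_z_fold\<close> merges the two values of
  \<open>z\<close>.\<close>

lemma ev_kd: "ev2 (kd F) (h \<otimes> k) = sw (e k) (\<lambda>g1 g2. sw (ev F (h \<cdot> g1)) (\<lambda>c1 c2. z (g2 \<cdot> c1) \<otimes> c2))"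
proof -
  have *: "ev2 (kd (f \<otimes> b)) (h \<otimes> k) = sw (e k) (\<lambda>g1 g2. sw (ev (f \<otimes> b) (h \<cdot> g1)) (\<lambda>c1 c2. z (g2 \<cdot> c1) \<otimes> c2))" for f b
  proof -
    have key: "(\<Sum>i\<in>UNIV. scalar_product (bas i) u *s (\<Sum>j\<in>UNIV. scalar_product (bas j) y *s
        (c *s (\<iota> (amul B (bas i) (\<zeta> (\<gamma> (bas j) \<cdot> b1))) \<otimes> \<iota> b2)))) = c *s ((\<iota> u \<cdot> z (\<gamma> y \<cdot> b1)) \<otimes> \<iota> b2)" for u y b1 b2 c
      by (subst sum_basis[of "\<lambda>y. c *s (\<iota> (amul B (bas i) (\<zeta> (\<gamma> y \<cdot> b1))) \<otimes> \<iota> b2)" for i], intro lin,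
          subst sum_basis[of "\<lambda>u. c *s (\<iota> (amul B u (\<zeta> (\<gamma> y \<cdot> b1))) \<otimes> \<iota> b2)"], intro lin, simp only: iota_mul z_def)
    have "ev2 (kd (f \<otimes> b)) (h \<otimes> k) = sweedler (dual_coact C f) (\<lambda>f1 f2. sweedler (coact B b) (\<lambda>b1 b2.
        \<Sum>i\<in>UNIV. \<Sum>j\<in>UNIV. scalar_product (cdual_mul C (dual_map \<gamma> (dual_mul (comul H) f2 (dual_map \<zeta> (bas i)))) (bas j)) (\<pi> k) *s
          (scalar_product f1 (\<pi> h) *s
           (\<iota> (amul B (bas i) (\<zeta> (\<gamma> (bas j) \<cdot> b1))) \<otimes> \<iota> b2))))"
      by (simp only: lpd_comul_def sweedler_pure lin sweedler_pull[OF bilev2]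
           linear_sum_pull[OF bilinear_left[OF bilev2 lin_id]] pure_tens ev_pure tensor_scale dual_bialg_def bialg.simps)
    also have "\<dots> = sw k (\<lambda>k1 k2. sw (\<gamma> (\<pi> k1)) (\<lambda>g1 g2. sweedler (coact B b) (\<lambda>b1 b2.
        sweedler (dual_coact C f) (\<lambda>f1 f2. scalar_product f1 (\<pi> h) *s (scalar_product f2 g1 *s
         ((\<iota> (\<zeta> g2) \<cdot> z (\<gamma> (\<pi> k2) \<cdot> b1)) \<otimes> \<iota> b2))))))"
      apply (simp only: dual_mul_sp[OF linear_ccomul] dual_mul_sp[OF linear_comul] sw_ccomul_pi lin
         scalar_product_dual_map[OF linear_gamma] scalar_product_dual_map[OF linear_zeta] scale_sweedler sweedler_sum_commute
         vec.scale_sum_right[symmetric] key)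
      apply (simp only: sweedler_swap[where s = "coact B b"])
      apply (simp only: sweedler_swap[where s = "dual_coact C f"])
      apply (simp add: vec.scale_scale mult_ac)
      done
    also have "\<dots> = sw k (\<lambda>k1 k2. sw (e k1) (\<lambda>g1 g2. sw (ev (f \<otimes> b) (h \<cdot> g1)) (\<lambda>b1 b2. (z g2 \<cdot> z (e k2 \<cdot> b1)) \<otimes> b2)))"
      apply (simp only: dual_coact_sp[OF bilinear_act] ev_pure sweedler_scale scale mul_scale sw_iota lin scale_sweedler pi_mul z_def[symmetric] e_def[symmetric])
      done
    also have "\<dots> = sw (e k) (\<lambda>g1 g. sw g (\<lambda>g2 g3. sw (ev (f \<otimes> b) (h \<cdot> g1)) (\<lambda>b1 b2. (z g2 \<cdot> z (e g3 \<cdot> b1)) \<otimes> b2)))"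
      apply (subst sw_e; (intro lin)?)
      apply (simp only: e_def)
      apply (simp only: norm)
      done
    also have "\<dots> = sw (e k) (\<lambda>g1 g2. sw (ev (f \<otimes> b) (h \<cdot> g1)) (\<lambda>c1 c2. z (g2 \<cdot> c1) \<otimes> c2))"
    proof (rule sweedler_cong)
      fix g1 g
      have "sw g (\<lambda>g2 g3. sw (ev (f \<otimes> b) (h \<cdot> g1)) (\<lambda>b1 b2. (z g2 \<cdot> z (e g3 \<cdot> b1)) \<otimes> b2)) =
        sw (ev (f \<otimes> b) (h \<cdot> g1)) (\<lambda>b1 b2. sw g (\<lambda>g2 g3. z g2 \<cdot> z (e g3 \<cdot> b1)) \<otimes> b2)"
        by (simp only: pull) (rule sweedler_commute)
      then show "sw g (\<lambda>g2 g3. sw (ev (f \<otimes> b) (h \<cdot> g1)) (\<lambda>b1 b2. (z g2 \<cdot> z (e g3 \<cdot> b1)) \<otimes> b2)) =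
         sw (ev (f \<otimes> b) (h \<cdot> g1)) (\<lambda>c1 c2. z (g \<cdot> c1) \<otimes> c2)"
        by (simp only: sw_z_fold)
    qed
    finally show ?thesis .
  qed
  show ?thesis
    by (rule tensor_ext[of "\<lambda>F. ev2 (kd F) (h \<otimes> k)", OF _ _ *]; intro lin lin_tens)
qed

abbreviation "kphi' \<equiv> lpd_assoc_inv H B C \<zeta> \<gamma>"

text \<open>An explicit candidate for the associator, which the definitions give only as the inverse
  of \<open>kphi'\<close>. It is made so that its twisted product with \<open>kphi'\<close> folds
  into \<open>zb x1 \<cdot> z x2\<close>, which cancels.\<close>

definition kphi where
  "kphi = (\<Sum>j\<in>UNIV. \<Sum>k\<in>UNIV. sw (\<gamma> (bas j)) (\<lambda>g1 g2. sw (\<gamma> (bas k)) (\<lambda>l1 l2. sweedler (coact B (\<zeta> l2)) (\<lambda>c1 c2.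
     (cdual_one C \<otimes> amul B (\<zeta>' (g1 \<cdot> l1)) (\<zeta> (g2 \<cdot> c1))) \<otimes> (bas j \<otimes> c2) \<otimes> (bas k \<otimes> aone B)))))"

lemma sp_one_C: "scalar_product (cdual_one C) (\<pi> h) *s v = eps h *s v"
  by (simp add: dual_one_sp[OF functional_ccounit] ccounit_pi)

lemma sp_one_C': "scalar_product (cdual_one C) (\<pi> h) = eps h"
  using sp_one_C[where v = "1 :: ('k, 'h) vec"] by (simp add: vec_eq_iff)

lemmas tens_scale = vec.linear_scale[OF linD(2)] vec.linear_scale[OF linD(3)] vec.linear_scale[OF linD(4)]
  vec.linear_scale[OF bilinear_left[OF bilm2 lin_id]] vec.linear_scale[OF bilinear_left[OF bilm3 lin_id]] vec.linear_scale[OF bilinear_left[OF bilm4 lin_id]]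
  vec.linear_scale[OF bilinear_right[OF bilm2 lin_id]] vec.linear_scale[OF bilinear_right[OF bilm3 lin_id]] vec.linear_scale[OF bilinear_right[OF bilm4 lin_id]]
  vec.linear_scale[OF bilinear_left[OF bilev2 lin_id]] vec.linear_scale[OF bilinear_left[OF bilev3 lin_id]] vec.linear_scale[OF bilinear_left[OF bilev4 lin_id]]
  vec.linear_scale[OF bilinear_right[OF bilev2 lin_id]] vec.linear_scale[OF bilinear_right[OF bilev3 lin_id]] vec.linear_scale[OF bilinear_right[OF bilev4 lin_id]]

lemma ev_one: "ev (cdual_one C \<otimes> b) h = eps h *s \<iota> b"
  by (simp only: ev_pure sp_one_C')

lemma ev3_ext: assumes "\<And>h k l. ev3 s (h \<otimes> k \<otimes> l) = ev3 t (h \<otimes> k \<otimes> l)" shows "s = t"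
proof (rule separatingD[OF separating_tensor[OF separating_ev separating_tensor[OF separating_ev separating_ev bilinear_ev bilinear_ev] bilinear_ev bilev2]])
  have "ev3 s (h \<otimes> x) = ev3 t (h \<otimes> x)" for h x
    by (rule tensor_ext[of "\<lambda>x. ev3 s (h \<otimes> x)"]; (rule assms)?; intro lin_tens)
  then show "ev3 s x = ev3 t x" for x
    by (rule_tac tensor_ext[of "\<lambda>x. ev3 s x"]; assumption?; intro lin_tens)
qed

lemma ev4_ext: assumes "\<And>h k l m. ev4 s (h \<otimes> k \<otimes> l \<otimes> m) = ev4 t (h \<otimes> k \<otimes> l \<otimes> m)" shows "s = t"
proof (rule separatingD[OF separating_tensor[OF separating_ev separating_tensor[OF separating_ev separating_tensor[OF separating_ev separating_ev bilinear_ev bilinear_ev] bilinear_ev bilev2] bilinear_ev bilev3]])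
  have "ev4 s (h \<otimes> k \<otimes> x) = ev4 t (h \<otimes> k \<otimes> x)" for h k x
    by (rule tensor_ext[of "\<lambda>x. ev4 s (h \<otimes> k \<otimes> x)"]; (rule assms)?; intro lin_tens)
  then have "ev4 s (h \<otimes> x) = ev4 t (h \<otimes> x)" for h x
    by (rule_tac tensor_ext[of "\<lambda>x. ev4 s (h \<otimes> x)"]; assumption?; intro lin_tens)
  then show "ev4 s x = ev4 t x" for x
    by (rule_tac tensor_ext[of "\<lambda>x. ev4 s x"]; assumption?; intro lin_tens)
qed

lemma eps_pull: "eps (sweedler t F) *s v = sweedler t (\<lambda>a b. eps (F a b) *s v)"
  by (rule linear_sweedler[of "\<lambda>x. eps x *s v"]) (intro lin)

lemma eps_zb [simp]: "eps (zb h) = eps h" and eps_eb [simp]: "eps (eb h) = eps h"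
proof -
  have "eps (sw h (\<lambda>h1 h2. z h1 \<cdot> zb h2)) *s one H = eps (eps h *s one H) *s one H" by (simp only: sw_z_zb)
  then have "eps (zb h) *s one H = eps h *s one H"
    by (simp add: eps_pull eps_scale sw_counit lin flip: vec.scale_scale)
  then have "eps (eps (zb h) *s one H) = eps (eps h *s one H)" by (rule arg_cong)
  then show "eps (zb h) = eps h" by (simp add: eps_scale)
  have "eps (sw h (\<lambda>h1 h2. e h1 \<cdot> eb h2)) *s one H = eps (eps h *s one H) *s one H" by (simp only: sw_e_eb)
  then have "eps (eb h) *s one H = eps h *s one H"
    by (simp add: eps_pull eps_scale sw_counit lin flip: vec.scale_scale)
  then have "eps (eps (eb h) *s one H) = eps (eps h *s one H)" by (rule arg_cong)
  then show "eps (eb h) = eps h" by (simp add: eps_scale)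
qed

lemma ev_kphi: "ev3 kphi (h \<otimes> m \<otimes> w) = eps h *s sw (e m) (\<lambda>g1 g2. sw (e w) (\<lambda>l1 l2. sw (z l2) (\<lambda>c1 c2.
    (zb (g1 \<cdot> l1) \<cdot> z (g2 \<cdot> c1)) \<otimes> c2 \<otimes> one H)))"
proof -
  let ?V = "\<lambda>x y. sw (\<gamma> x) (\<lambda>g1 g2. sw (\<gamma> y) (\<lambda>l1 l2. sw (z l2) (\<lambda>c1 c2.
    (zb (g1 \<cdot> l1) \<cdot> z (g2 \<cdot> c1)) \<otimes> c2 \<otimes> one H)))"
  have "ev3 kphi (h \<otimes> m \<otimes> w) = (\<Sum>j\<in>UNIV. \<Sum>k\<in>UNIV. eps h *s (scalar_product (bas j) (\<pi> m) *s (scalar_product (bas k) (\<pi> w) *s ?V (bas j) (bas k))))"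
    by (simp only: kphi_def sweedler_pull[OF bilev3] linear_sum_pull[OF bilinear_left[OF bilev3 lin_id]] pure_tens
      lin sp_one_C' ev_pure tensor_scale iota_mul iota_one zb_def[symmetric] z_def sw_iota scale_sweedler[symmetric])
      (simp only: vec.scale_scale mult_ac)
  also have "\<dots> = eps h *s (\<Sum>j\<in>UNIV. scalar_product (bas j) (\<pi> m) *s (\<Sum>k\<in>UNIV. scalar_product (bas k) (\<pi> w) *s ?V (bas j) (bas k)))"
    by (simp only: vec.scale_sum_right)
  also have "\<dots> = eps h *s ?V (\<pi> m) (\<pi> w)"
    by (subst sum_basis[of "?V x" for x], intro lin, subst sum_basis[of "\<lambda>x. ?V x y" for y], intro lin, rule refl)
  finally show ?thesis unfolding e_def .
qed

lemma ev_kphi': "ev3 kphi' (h \<otimes> m \<otimes> w) = eps h *s sw (e w) (\<lambda>l1 l2. z (e m \<cdot> l1) \<otimes> z l2 \<otimes> one H)"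
proof -
  have key: "(\<Sum>i\<in>UNIV. scalar_product (bas i) x *s (\<Sum>j\<in>UNIV. scalar_product (bas j) y *s
      (c *s (\<iota> (bas i) \<otimes> \<iota> (bas j) \<otimes> one H)))) = c *s (\<iota> x \<otimes> \<iota> y \<otimes> one H)" for x y c
    by (subst sum_basis[of "\<lambda>y. c *s (\<iota> (bas i) \<otimes> \<iota> y \<otimes> one H)" for i], intro lin,
          subst sum_basis[of "\<lambda>x. c *s (\<iota> x \<otimes> \<iota> y \<otimes> one H)"], intro lin, rule refl)
  have "ev3 kphi' (h \<otimes> m \<otimes> w) = (\<Sum>i\<in>UNIV. \<Sum>j\<in>UNIV. sweedler (dual_comul (mul H) (dual_map \<zeta> (bas i))) (\<lambda>z1 z2.
     scalar_product z1 (e m) *s (scalar_product (dual_mul (comul H) z2 (dual_map \<zeta> (bas j))) (e w) *s (eps h *s (\<iota> (bas i) \<otimes> \<iota> (bas j) \<otimes> one H)))))"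
    apply (simp only: lpd_assoc_inv_def sweedler_pull[OF bilev3] linear_sum_pull[OF bilinear_left[OF bilev3 lin_id]] pure_tens
      lin sp_one_C' ev_pure tensor_scale iota_mul iota_one dual_bialg_def bialg.simps scalar_product_dual_map[OF linear_gamma] e_def)
    apply (simp only: vec.scale_scale mult_ac)
    done
  also have "\<dots> = eps h *s sw (e w) (\<lambda>l1 l2. z (e m \<cdot> l1) \<otimes> z l2 \<otimes> one H)"
    apply (simp only: dual_mul_sp[OF linear_comul] scale_sweedler sweedler_swap[where s="dual_comul m f" for m f]
      dual_comul_sp[OF bilinear_mul] scalar_product_dual_map[OF linear_zeta] sweedler_sum_commute)
    apply (simp only: vec.scale_sum_right[symmetric] key z_def)
    done
  finally show ?thesis .
qed

lemmas norm2 = is_var float_var sw_mul sw_coassoc lin_tens pull_tens(1-3) mul_pull ze_pull ev_pull eps_pull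
  mul_assoc scale eps_mul vec.scale_scale[symmetric] scale_sweedler[symmetric] sw_counit ev_scale eps_z eps_zb eps_e eps_eb

text \<open>Colinearity of \<open>\<gamma>\<close> turns the convolution of
  \<open>z \<circ> e\<close> with \<open>e\<close> into \<open>z * e\<close> evaluated at
  \<open>e k\<close>, that is, into \<open>e k\<close>. Convolving with \<open>eb\<close> on the
  right cancels \<open>e\<close> from both sides.\<close>

lemma z_e: "z (e h) = eps h *s one H"
proof -
  have *: "sw k (\<lambda>k1 k2. z (e k1) \<cdot> e k2) = e k" for k
  proof -
    have "sw k (\<lambda>k1 k2. z (e k1) \<cdot> e k2) = sw (e k) (\<lambda>k1 k2. z k1 \<cdot> e k2)"
      by (subst sw_e[where k = k, symmetric]; (intro lin)?; simp add: e_def)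
    then show ?thesis by (simp only: sw_ze)
  qed
  have "sw h (\<lambda>h1 h2. sw h1 (\<lambda>k1 k2. z (e k1) \<cdot> e k2) \<cdot> eb h2) = sw h (\<lambda>k1 h. z (e k1) \<cdot> sw h (\<lambda>k2 h2. e k2 \<cdot> eb h2))"
    by (simp add: norm2)
  then show ?thesis by (simp only: * sw_e_eb scale mul_one sw_counit lin)
qed

text \<open>Recombines \<open>z m1\<close> and \<open>e m2\<close> to \<open>m\<close> underneath
  their coproducts. The premise is required only for \<open>p2\<close> in \<open>Bs\<close>, which
  is what allows \<open>z_mul\<close> to draw \<open>p2\<close> into a neighbouring
  \<open>z\<close>.\<close>

lemma sw_fold:
  assumes "\<And>p1 p2 k1 k2. p2 \<in> Bs \<Longrightarrow> F p1 p2 k1 k2 = G (p1 \<cdot> k1) (p2 \<cdot> k2)"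
    and "\<And>b c d. klinear (\<lambda>a. F a b c d)" "\<And>a c d. klinear (\<lambda>b. F a b c d)"
    and "\<And>b. klinear (\<lambda>a. G a b)" "\<And>a. klinear (\<lambda>b. G a b)"
  shows "sw m (\<lambda>m1 m2. sw (z m1) (\<lambda>p1 p2. sw (e m2) (\<lambda>k1 k2. F p1 p2 k1 k2))) = sw m G"
proof -
  have "sw m (\<lambda>m1 m2. sw (z m1) (\<lambda>p1 p2. sw (e m2) (\<lambda>k1 k2. F p1 p2 k1 k2))) =
      sw m (\<lambda>m1 m2. sw (z m1) (\<lambda>p1 p2. sw (e m2) (\<lambda>k1 k2. G (p1 \<cdot> k1) (p2 \<cdot> k2))))"
    by (rule sweedler_cong, rule sw_cong_B[OF Bs_closed(1)])
      (simp add: assms(1), (intro lin lin_compose[OF assms(4)] lin_compose[OF assms(5)] assms(2,3))+)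
  then show ?thesis by (simp only: sw_ze_comul assms)
qed

text \<open>One side is enough, because in finite dimension a one-sided inverse is two-sided. The
  computation alternates between colinearity of \<open>\<gamma>\<close>, which gathers arguments
  under one coproduct, and the two folding rules for \<open>z\<close> and \<open>e\<close>.\<close>

lemma kphi_inverse: "km3 kphi kphi' = ku \<otimes> ku \<otimes> ku"
proof (rule ev3_ext)
  fix h m w
  have "ev3 (km3 kphi kphi') (h \<otimes> m \<otimes> w) = eps h *s sw m (\<lambda>m1 m2. sw w (\<lambda>w1 w2. sw (e m1) (\<lambda>g1 g2. sw (e w1) (\<lambda>l1 l.
      sw (z l) (\<lambda>c1 c. sw c (\<lambda>c2 c3. sw (e w2) (\<lambda>k1 k2. (zb (g1 \<cdot> l1) \<cdot> (z (g2 \<cdot> c1) \<cdot> z (e (m2 \<cdot> c2) \<cdot> k1))) \<otimes> (c3 \<cdot> z k2) \<otimes> one H)))))))"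
    apply (simp only: ev_km3 pure_tens pull_tens lin_tens ev_kphi ev_kphi' scale tens_scale)
    by (simp add: norm2 sw_one)
  \<comment> \<open>Colinearity of \<open>\<gamma>\<close>: \<open>e m1\<close> and
    \<open>m2\<close> are replaced by the two legs of \<open>e m\<close>. This is allowed because
    \<open>m2\<close> occurs only under \<open>e\<close>, hence only through \<open>\<pi>\<close>.
    The same move recurs in all later computations of this kind.\<close>
  also have "\<dots> = eps h *s sw (e m) (\<lambda>g m2. sw w (\<lambda>w1 w2. sw g (\<lambda>g1 g2. sw (e w1) (\<lambda>l1 l.
      sw (z l) (\<lambda>c1 c. sw c (\<lambda>c2 c3. sw (e w2) (\<lambda>k1 k2. (zb (g1 \<cdot> l1) \<cdot> (z (g2 \<cdot> c1) \<cdot> z (e (m2 \<cdot> c2) \<cdot> k1))) \<otimes> (c3 \<cdot> z k2) \<otimes> one H)))))))"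
    by (subst sw_e[where k = m, symmetric]; (intro lin)?; simp add: e_def pi_mul)
  also have "\<dots> = eps h *s sw (e m) (\<lambda>g1 g. sw w (\<lambda>w1 w2. sw (e w1) (\<lambda>l1 l.
      sw (z l) (\<lambda>c c3. sw (e w2) (\<lambda>k1 k2. (zb (g1 \<cdot> l1) \<cdot> sw (g \<cdot> c) (\<lambda>x1 x2. z x1 \<cdot> z (e x2 \<cdot> k1))) \<otimes> (c3 \<cdot> z k2) \<otimes> one H)))))"
    by (simp add: norm2)
  also have "\<dots> = eps h *s sw w (\<lambda>w1 w2. sw (e w1) (\<lambda>l1 l. sw (e m) (\<lambda>g1 g.
      sw (z l) (\<lambda>c1 c2. sw (e w2) (\<lambda>k1 k2. (zb (g1 \<cdot> l1) \<cdot> z (g \<cdot> (c1 \<cdot> k1))) \<otimes> (c2 \<cdot> z k2) \<otimes> one H)))))"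
    apply (simp only: sw_z_fold mul_assoc)
    apply (simp only: sweedler_swap[where s = "comul H (e m)"])
    done
  also have "\<dots> = eps h *s sw (e w) (\<lambda>l w2. sw l (\<lambda>l1 l. sw (e m) (\<lambda>g1 g.
      sw (z l) (\<lambda>c1 c2. sw (e w2) (\<lambda>k1 k2. (zb (g1 \<cdot> l1) \<cdot> z (g \<cdot> (c1 \<cdot> k1))) \<otimes> (c2 \<cdot> z k2) \<otimes> one H)))))"
    by (subst sw_e[where k = w, symmetric]; (intro lin)?; simp add: e_def pi_mul)
  also have "\<dots> = eps h *s sw (e w) (\<lambda>l1 l. sw (e m) (\<lambda>g1 g. sw l (\<lambda>l2 l3.
      sw (z l2) (\<lambda>c1 c2. sw (e l3) (\<lambda>k1 k2. (zb (g1 \<cdot> l1) \<cdot> z (g \<cdot> (c1 \<cdot> k1))) \<otimes> (c2 \<cdot> z k2) \<otimes> one H)))))"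
    by (simp add: norm2)
  also have "\<dots> = eps h *s sw (e w) (\<lambda>l1 l. sw (e m) (\<lambda>g1 g. sw l (\<lambda>l2 l3. (zb (g1 \<cdot> l1) \<cdot> z (g \<cdot> l2)) \<otimes> z l3 \<otimes> one H)))"
    by (intro arg_cong[of _ _ "\<lambda>x. _ *s x"], rule sweedler_cong, rule sweedler_cong, rule sw_fold) (simp add: z_mul, (intro lin)+)
  \<comment> \<open>Now \<open>zb\<close> and \<open>z\<close> sit on the two legs of the single
    element \<open>e m \<cdot> l\<close> and cancel; the remaining \<open>z\<close> then has
    argument \<open>e w\<close> and is trivial by \<open>z_e\<close>.\<close>
  also have "\<dots> = eps h *s sw (e w) (\<lambda>l l3. sw (e m \<cdot> l) (\<lambda>x1 x2. zb x1 \<cdot> z x2) \<otimes> z l3 \<otimes> one H)"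
    by (simp add: norm2)
  also have "\<dots> = ev3 (ku \<otimes> ku \<otimes> ku) (h \<otimes> m \<otimes> w)"
    by (simp only: sw_zb_z pure_tens ev_ku) (simp add: norm2 z_e vec.scale_left_commute)
  finally show "ev3 (km3 kphi kphi') (h \<otimes> m \<otimes> w) = ev3 (ku \<otimes> ku \<otimes> ku) (h \<otimes> m \<otimes> w)" .
qed

section \<open>Multiplicativity and quasi-coassociativity of the coproduct\<close>

lemma kd_mult: "kd (km F G) = km2 (kd F) (kd G)"
proof (rule ev2_ext)
  fix h k
  have "ev2 (km2 (kd F) (kd G)) (h \<otimes> k) = sw h (\<lambda>h1 h2. sw k (\<lambda>k1 k2. sw (e k1) (\<lambda>g1 g2. sw (ev F (h1 \<cdot> g1)) (\<lambda>a1 a2. sw (z (g2 \<cdot> a1)) (\<lambda>p1 p2. sw a2 (\<lambda>q1 q2. sw (e (k2 \<cdot> q1)) (\<lambda>l1 l2. sw (ev G (h2 \<cdot> p1 \<cdot> l1)) (\<lambda>d1 d2. (p2 \<cdot> z (l2 \<cdot> d1)) \<otimes> (q2 \<cdot> d2)))))))))"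
    apply (simp only: ev_km2 pure_tens pull_tens lin_tens ev_kd scale tens_scale)
    done
  also have "\<dots> = sw h (\<lambda>h1 h2. sw (e k) (\<lambda>g1 k2. sw g1 (\<lambda>g1 g2. sw (ev F (h1 \<cdot> g1)) (\<lambda>a1 a2. sw (z (g2 \<cdot> a1)) (\<lambda>p1 p2. sw a2 (\<lambda>q1 q2. sw (e (k2 \<cdot> q1)) (\<lambda>l1 l2. sw (ev G (h2 \<cdot> p1 \<cdot> l1)) (\<lambda>d1 d2. (p2 \<cdot> z (l2 \<cdot> d1)) \<otimes> (q2 \<cdot> d2)))))))))"
    by (subst sw_e[symmetric]; (intro lin)?; simp add: e_def pi_mul)
  also have "\<dots> = sw h (\<lambda>h1 h2. sw (e k) (\<lambda>g1 g. sw (ev F (h1 \<cdot> g1)) (\<lambda>a a2. sw (g \<cdot> a) (\<lambda>m1 m2. sw (z m1) (\<lambda>p1 p2. sw (e m2) (\<lambda>l1 l2. sw (ev G (h2 \<cdot> (p1 \<cdot> l1))) (\<lambda>d1 d2. (p2 \<cdot> z (l2 \<cdot> d1)) \<otimes> (a2 \<cdot> d2))))))))"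
   by (simp add: norm2)
  \<comment> \<open>The legs of \<open>m = g \<cdot> a\<close> carry \<open>z m1\<close> and
    \<open>e m2\<close>, so \<open>sw_fold\<close> applies; \<open>p2\<close> lies in
    \<open>Bs\<close> and is drawn into \<open>z (l2 \<cdot> d1)\<close>.\<close>
  also have "\<dots> = sw h (\<lambda>h1 h2. sw (e k) (\<lambda>g1 g. sw (ev F (h1 \<cdot> g1)) (\<lambda>a a2. sw (g \<cdot> a) (\<lambda>m1 m2. sw (ev G (h2 \<cdot> m1)) (\<lambda>d1 d2. z (m2 \<cdot> d1) \<otimes> (a2 \<cdot> d2))))))"
    by (rule sweedler_cong, rule sweedler_cong, rule sweedler_cong, rule sw_fold) (simp add: z_mul mul_assoc, (intro lin)+)
  also have "\<dots> = ev2 (kd (km F G)) (h \<otimes> k)"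
    by (simp add: ev_kd ev_km norm2)
  finally show "ev2 (kd (km F G)) (h \<otimes> k) = ev2 (km2 (kd F) (kd G)) (h \<otimes> k)" by simp
qed

lemma ev_id_kd: "ev3 (sweedler (kd F) (\<lambda>x1 x2. x1 \<otimes> kd x2)) (h \<otimes> m \<otimes> w) =
  sw (e w) (\<lambda>g1 g2. sw (e (m \<cdot> g1)) (\<lambda>k1 k2. sw (ev F (h \<cdot> k1)) (\<lambda>c1 c2. sw c2 (\<lambda>d1 d2. z (k2 \<cdot> c1) \<otimes> z (g2 \<cdot> d1) \<otimes> d2))))"
proof -
  have 1: "sweedler (kd F) (\<lambda>F1 F2. sw (ev F2 y) (\<lambda>c1 c2. ev F1 h \<otimes> z (g2 \<cdot> c1) \<otimes> c2)) =
     sw (e y) (\<lambda>k1 k2. sw (ev F (h \<cdot> k1)) (\<lambda>c1 c2. sw c2 (\<lambda>d1 d2. z (k2 \<cdot> c1) \<otimes> z (g2 \<cdot> d1) \<otimes> d2)))" (is "?L = ?R") for y g2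
  proof -
    have "?L = sweedler (ev2 (kd F) (h \<otimes> y)) (\<lambda>a b. sw b (\<lambda>c1 c2. a \<otimes> z (g2 \<cdot> c1) \<otimes> c2))"
      by (simp only: tensor_ev_def[of ev ev] sweedler_sweedler sweedler_pure lin)
    also have "\<dots> = ?R" by (simp only: ev_kd sweedler_sweedler sweedler_pure lin)
    finally show ?thesis .
  qed
  have "ev3 (sweedler (kd F) (\<lambda>x1 x2. x1 \<otimes> kd x2)) (h \<otimes> m \<otimes> w) =
    sw (e w) (\<lambda>g1 g2. sweedler (kd F) (\<lambda>F1 F2. sw (ev F2 (m \<cdot> g1)) (\<lambda>c1 c2. ev F1 h \<otimes> z (g2 \<cdot> c1) \<otimes> c2)))"
    by (simp only: sweedler_pull[OF bilev3] pure_tens ev_kd pull lin) (rule sweedler_commute)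
  then show ?thesis by (simp only: 1)
qed

lemma ev_kd_id: "ev3 (sweedler (kd F) (\<lambda>x1 x2. sweedler (kd x1) (\<lambda>a b. a \<otimes> b \<otimes> x2))) (h \<otimes> m \<otimes> w) =
  sw (e m) (\<lambda>k1 k2. sw (e w) (\<lambda>g1 g2. sw (ev F (h \<cdot> k1 \<cdot> g1)) (\<lambda>c1 c2. sw (z (g2 \<cdot> c1)) (\<lambda>s1 s2. z (k2 \<cdot> s1) \<otimes> s2 \<otimes> c2))))"
proof -
  have 0: "sweedler (kd G) (\<lambda>a b. ev a h \<otimes> ev b m \<otimes> v) = sw (e m) (\<lambda>k1 k2. sw (ev G (h \<cdot> k1)) (\<lambda>c1 c2. z (k2 \<cdot> c1) \<otimes> c2 \<otimes> v))"
    (is "?L = ?R") for G v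
  proof -
    have "?L = sweedler (ev2 (kd G) (h \<otimes> m)) (\<lambda>a b. a \<otimes> b \<otimes> v)"
      by (simp only: tensor_ev_def[of ev ev] sweedler_sweedler sweedler_pure lin)
    also have "\<dots> = ?R" by (simp only: ev_kd sweedler_sweedler sweedler_pure lin)
    finally show ?thesis .
  qed
  have 1: "sweedler (kd F) (\<lambda>F1 F2. sw (ev F1 y) (\<lambda>c1 c2. z (k2 \<cdot> c1) \<otimes> c2 \<otimes> ev F2 w)) =
     sw (e w) (\<lambda>g1 g2. sw (ev F (y \<cdot> g1)) (\<lambda>c1 c2. sw (z (g2 \<cdot> c1)) (\<lambda>s1 s2. z (k2 \<cdot> s1) \<otimes> s2 \<otimes> c2)))" (is "?L = ?R") for y k2
  proof -
    have "?L = sweedler (ev2 (kd F) (y \<otimes> w)) (\<lambda>a b. sw a (\<lambda>c1 c2. z (k2 \<cdot> c1) \<otimes> c2 \<otimes> b))"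
      by (simp only: tensor_ev_def[of ev ev] sweedler_sweedler sweedler_pure lin)
    also have "\<dots> = ?R" by (simp only: ev_kd sweedler_sweedler sweedler_pure lin)
    finally show ?thesis .
  qed
  have "ev3 (sweedler (kd F) (\<lambda>x1 x2. sweedler (kd x1) (\<lambda>a b. a \<otimes> b \<otimes> x2))) (h \<otimes> m \<otimes> w) =
    sw (e m) (\<lambda>k1 k2. sweedler (kd F) (\<lambda>F1 F2. sw (ev F1 (h \<cdot> k1)) (\<lambda>c1 c2. z (k2 \<cdot> c1) \<otimes> c2 \<otimes> ev F2 w)))"
    by (simp only: sweedler_pull[OF bilev3] pure_tens 0 lin) (rule sweedler_commute)
  then show ?thesis by (simp only: 1)
qed

text \<open>Multiplying the axiom by the inverse associator leaves only \<open>kphi'\<close>, whose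
  values are simpler than those of \<open>kphi\<close>. Both sides are brought to a common form with
  a single coproduct of \<open>e m \<cdot> l\<close>.\<close>

lemma kd_quasi_coassoc:
  "km3 kphi' (sweedler (kd F) (\<lambda>x1 x2. x1 \<otimes> kd x2)) =
   km3 (sweedler (kd F) (\<lambda>x1 x2. sweedler (kd x1) (\<lambda>a b. a \<otimes> b \<otimes> x2))) kphi'"
proof -
  \<comment> \<open>The iterated coproducts are kept opaque, so that they are rewritten only through
    their known values \<open>evX\<close> and \<open>evY\<close>.\<close>
  define X where "X = sweedler (kd F) (\<lambda>x1 x2. x1 \<otimes> kd x2)"
  define Y where "Y = sweedler (kd F) (\<lambda>x1 x2. sweedler (kd x1) (\<lambda>a b. a \<otimes> b \<otimes> x2))"
  note evX = ev_id_kd[of F, folded X_def] and evY = ev_kd_id[of F, folded Y_def]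
  have "km3 kphi' X = km3 Y kphi'"
  proof (rule ev3_ext)
  fix h m w
  have "ev3 (km3 kphi' X) (h \<otimes> m \<otimes> w) =
    sw m (\<lambda>m1 m2. sw w (\<lambda>w1 w2. sw (e w1) (\<lambda>l1 l2. sw (z (e m1 \<cdot> l1)) (\<lambda>p1 p2. sw (z l2) (\<lambda>q1 q2.
     sw (e w2) (\<lambda>g1 g2. sw (e (m2 \<cdot> q1 \<cdot> g1)) (\<lambda>k1 k2. sw (ev F (h \<cdot> p1 \<cdot> k1)) (\<lambda>c1 c2. sw c2 (\<lambda>d1 d2.
      (p2 \<cdot> z (k2 \<cdot> c1)) \<otimes> (q2 \<cdot> z (g2 \<cdot> d1)) \<otimes> d2)))))))))"
    apply (simp only: ev_km3 pure_tens pull_tens lin_tens ev_kphi ev_kphi' scale tens_scale evX)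
    by (simp add: norm2 sw_one)
  also have "\<dots> = sw m (\<lambda>m1 m2. sw (e w) (\<lambda>l w2. sw l (\<lambda>l1 l2. sw (z (e m1 \<cdot> l1)) (\<lambda>p1 p2. sw (z l2) (\<lambda>q1 q2.
     sw (e w2) (\<lambda>g1 g2. sw (e (m2 \<cdot> (q1 \<cdot> g1))) (\<lambda>k1 k2. sw (ev F (h \<cdot> p1 \<cdot> k1)) (\<lambda>c1 c2. sw c2 (\<lambda>d1 d2.
      (p2 \<cdot> z (k2 \<cdot> c1)) \<otimes> (q2 \<cdot> z (g2 \<cdot> d1)) \<otimes> d2)))))))))"
    by (subst sw_e[where k = w, symmetric]; (intro lin)?; simp add: e_def pi_mul mul_assoc)
  also have "\<dots> = sw m (\<lambda>m1 m2. sw (e w) (\<lambda>l1 l. sw (z (e m1 \<cdot> l1)) (\<lambda>p1 p2. sw l (\<lambda>l2 l3. sw (z l2) (\<lambda>q1 q2.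
     sw (e l3) (\<lambda>g1 g2. sw (e (m2 \<cdot> (q1 \<cdot> g1))) (\<lambda>k1 k2. sw (ev F (h \<cdot> p1 \<cdot> k1)) (\<lambda>c1 c2. sw c2 (\<lambda>d1 d2.
      (p2 \<cdot> z (k2 \<cdot> c1)) \<otimes> (q2 \<cdot> z (g2 \<cdot> d1)) \<otimes> d2)))))))))"
    by (simp add: norm2)
  also have "\<dots> = sw m (\<lambda>m1 m2. sw (e w) (\<lambda>l1 l. sw (z (e m1 \<cdot> l1)) (\<lambda>p1 p2. sw l (\<lambda>y1 y2.
     sw (e (m2 \<cdot> y1)) (\<lambda>k1 k2. sw (ev F (h \<cdot> p1 \<cdot> k1)) (\<lambda>c1 c2. sw c2 (\<lambda>d1 d2.
      (p2 \<cdot> z (k2 \<cdot> c1)) \<otimes> z (y2 \<cdot> d1) \<otimes> d2)))))))"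
    by (rule sweedler_cong, rule sweedler_cong, rule sweedler_cong, rule sw_fold) (simp add: z_mul mul_assoc, (intro lin)+)
  also have "\<dots> = sw (e m) (\<lambda>g1 g2. sw (e w) (\<lambda>l1 l. sw (z (g1 \<cdot> l1)) (\<lambda>p1 p2. sw l (\<lambda>y1 y2.
     sw (e (g2 \<cdot> y1)) (\<lambda>k1 k2. sw (ev F (h \<cdot> p1 \<cdot> k1)) (\<lambda>c1 c2. sw c2 (\<lambda>d1 d2.
      (p2 \<cdot> z (k2 \<cdot> c1)) \<otimes> z (y2 \<cdot> d1) \<otimes> d2)))))))"
    by (subst sw_e[where k = m, symmetric]; (intro lin)?; simp add: e_def pi_mul)
  also have "\<dots> = sw (e w) (\<lambda>l y2. sw (e m \<cdot> l) (\<lambda>x1 x2. sw (z x1) (\<lambda>p1 p2.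
     sw (e x2) (\<lambda>k1 k2. sw (ev F (h \<cdot> (p1 \<cdot> k1))) (\<lambda>c1 c2. sw c2 (\<lambda>d1 d2.
      (p2 \<cdot> z (k2 \<cdot> c1)) \<otimes> z (y2 \<cdot> d1) \<otimes> d2))))))"
    apply (simp only: sweedler_swap[where s = "comul H (e m)"])
    apply (simp add: norm2)
    done
  also have "\<dots> = sw (e w) (\<lambda>l y2. sw (e m \<cdot> l) (\<lambda>x1 x2. sw (ev F (h \<cdot> x1)) (\<lambda>c1 c2. sw c2 (\<lambda>d1 d2.
      z (x2 \<cdot> c1) \<otimes> z (y2 \<cdot> d1) \<otimes> d2))))"
    by (rule sweedler_cong, rule sw_fold) (simp add: z_mul mul_assoc, (intro lin)+)
  finally have L: "ev3 (km3 kphi' X) (h \<otimes> m \<otimes> w) = \<dots>" .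
  have "ev3 (km3 Y kphi') (h \<otimes> m \<otimes> w) =
    sw m (\<lambda>m1 m2. sw w (\<lambda>w1 w2. sw (e m1) (\<lambda>k1 k2. sw (e w1) (\<lambda>g1 g2. sw (ev F (h \<cdot> k1 \<cdot> g1)) (\<lambda>c1 r. sw (z (g2 \<cdot> c1)) (\<lambda>s1 s2.
     sw s2 (\<lambda>q1 q2. sw r (\<lambda>r1 r2. sw (e (w2 \<cdot> r1)) (\<lambda>l1 l2. (z (k2 \<cdot> s1) \<cdot> z (e (m2 \<cdot> q1) \<cdot> l1)) \<otimes> (q2 \<cdot> z l2) \<otimes> r2)))))))))"
    apply (simp only: ev_km3 pure_tens pull_tens lin_tens ev_kphi ev_kphi' scale tens_scale evY)
    apply (simp add: norm2 sw_one)
    done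
  also have "\<dots> = sw (e m) (\<lambda>k m2. sw w (\<lambda>w1 w2. sw k (\<lambda>k1 k2. sw (e w1) (\<lambda>g1 g2. sw (ev F (h \<cdot> k1 \<cdot> g1)) (\<lambda>c1 r. sw (z (g2 \<cdot> c1)) (\<lambda>s1 s2.
     sw s2 (\<lambda>q1 q2. sw r (\<lambda>r1 r2. sw (e (w2 \<cdot> r1)) (\<lambda>l1 l2. (z (k2 \<cdot> s1) \<cdot> z (e (m2 \<cdot> q1) \<cdot> l1)) \<otimes> (q2 \<cdot> z l2) \<otimes> r2)))))))))"
    by (subst sw_e[where k = m, symmetric]; (intro lin)?; simp add: e_def pi_mul)
  also have "\<dots> = sw (e m) (\<lambda>k1 k. sw w (\<lambda>w1 w2. sw (e w1) (\<lambda>g1 g2. sw (ev F (h \<cdot> k1 \<cdot> g1)) (\<lambda>c1 r. sw (z (g2 \<cdot> c1)) (\<lambda>s q2.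
     sw (k \<cdot> s) (\<lambda>x1 x2. sw r (\<lambda>r1 r2. sw (e (w2 \<cdot> r1)) (\<lambda>l1 l2. (z x1 \<cdot> z (e x2 \<cdot> l1)) \<otimes> (q2 \<cdot> z l2) \<otimes> r2))))))))"
    by (simp add: norm2)
  also have "\<dots> = sw (e m) (\<lambda>k1 k. sw w (\<lambda>w1 w2. sw (e w1) (\<lambda>g1 g2. sw (ev F (h \<cdot> k1 \<cdot> g1)) (\<lambda>c1 r. sw (z (g2 \<cdot> c1)) (\<lambda>s q2.
     sw r (\<lambda>r1 r2. sw (e (w2 \<cdot> r1)) (\<lambda>l1 l2. sw (k \<cdot> s) (\<lambda>x1 x2. z x1 \<cdot> z (e x2 \<cdot> l1)) \<otimes> (q2 \<cdot> z l2) \<otimes> r2)))))))"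
    by (simp only: pull sweedler_swap[where s = "comul H (k \<cdot> s)" for k s])
  also have "\<dots> = sw w (\<lambda>w1 w2. sw (e w1) (\<lambda>g1 g2. sw (e m) (\<lambda>k1 k. sw (ev F (h \<cdot> k1 \<cdot> g1)) (\<lambda>c1 r. sw (z (g2 \<cdot> c1)) (\<lambda>s q2.
     sw r (\<lambda>r1 r2. sw (e (w2 \<cdot> r1)) (\<lambda>l1 l2. z (k \<cdot> (s \<cdot> l1)) \<otimes> (q2 \<cdot> z l2) \<otimes> r2)))))))"
    apply (simp only: sw_z_fold mul_assoc)
    apply (simp only: sweedler_swap[where s = "comul H (e m)"])
    done
  also have "\<dots> = sw (e w) (\<lambda>g w2. sw g (\<lambda>g1 g2. sw (e m) (\<lambda>k1 k. sw (ev F (h \<cdot> k1 \<cdot> g1)) (\<lambda>c1 r. sw (z (g2 \<cdot> c1)) (\<lambda>s q2.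
     sw r (\<lambda>r1 r2. sw (e (w2 \<cdot> r1)) (\<lambda>l1 l2. z (k \<cdot> (s \<cdot> l1)) \<otimes> (q2 \<cdot> z l2) \<otimes> r2)))))))"
    by (subst sw_e[where k = w, symmetric]; (intro lin)?; simp add: e_def pi_mul)
  also have "\<dots> = sw (e w) (\<lambda>g1 g. sw (e m) (\<lambda>k1 k. sw (ev F (h \<cdot> k1 \<cdot> g1)) (\<lambda>c r2. sw (g \<cdot> c) (\<lambda>x1 x2. sw (z x1) (\<lambda>s q2.
     sw (e x2) (\<lambda>l1 l2. z (k \<cdot> (s \<cdot> l1)) \<otimes> (q2 \<cdot> z l2) \<otimes> r2))))))"
    by (simp add: norm2)
  also have "\<dots> = sw (e w) (\<lambda>g1 g. sw (e m) (\<lambda>k1 k. sw (ev F (h \<cdot> k1 \<cdot> g1)) (\<lambda>c r2. sw (g \<cdot> c) (\<lambda>x1 x2.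
     z (k \<cdot> x1) \<otimes> z x2 \<otimes> r2))))"
    by (rule sweedler_cong, rule sweedler_cong, rule sweedler_cong, rule sw_fold) (simp add: z_mul mul_assoc, (intro lin)+)
  also have "\<dots> = sw (e w) (\<lambda>l y2. sw (e m \<cdot> l) (\<lambda>x1 x2. sw (ev F (h \<cdot> x1)) (\<lambda>c1 c2. sw c2 (\<lambda>d1 d2.
      z (x2 \<cdot> c1) \<otimes> z (y2 \<cdot> d1) \<otimes> d2))))"
    by (simp add: norm2)
  finally show "ev3 (km3 kphi' X) (h \<otimes> m \<otimes> w) =
    ev3 (km3 Y kphi') (h \<otimes> m \<otimes> w)"
    by (simp only: L)
  qed
  then show ?thesis by (simp only: X_def Y_def)
qed

text \<open>If the legs enter only through their values, the sum is determined by the value of the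
  whole tensor. In this way a map can be applied to a single leg of \<open>kphi'\<close> or
  \<open>kphi\<close> without unfolding it.\<close>

lemma sweedler_ev3:
  assumes "\<And>b c. klinear (\<lambda>a. F a b c)" "\<And>a c. klinear (\<lambda>b. F a b c)" "\<And>a b. klinear (\<lambda>c. F a b c)"
  shows "sweedler t (\<lambda>a u. sweedler u (\<lambda>b c. F (ev a x) (ev b y) (ev c w))) =
    sweedler (ev3 t (x \<otimes> y \<otimes> w)) (\<lambda>p v. sweedler v (\<lambda>q r. F p q r))"
  by (simp only: tensor_ev_def[of ev] sweedler_sweedler sweedler_pure lin assms)

lemma sweedler_ev2:
  assumes "\<And>b. klinear (\<lambda>a. F a b)" "\<And>a. klinear (\<lambda>b. F a b)"
  shows "sweedler t (\<lambda>a b. F (ev a x) (ev b y)) = sweedler (ev2 t (x \<otimes> y)) F"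
  by (simp only: tensor_ev_def[of ev] sweedler_sweedler sweedler_pure lin assms)

lemma sweedler_kd:
  assumes "\<And>b. klinear (\<lambda>a. F a b)" "\<And>a. klinear (\<lambda>b. F a b)"
  shows "sweedler (kd G) (\<lambda>a b. F (ev a x) (ev b y)) = sw (e y) (\<lambda>k1 k2. sw (ev G (x \<cdot> k1)) (\<lambda>c1 c2. F (z (k2 \<cdot> c1)) c2))"
  by (simp only: sweedler_ev2 assms ev_kd sweedler_sweedler sweedler_pure)

section \<open>The pentagon for the inverse associator\<close>

definition "pent1 = sweedler3 kphi' (\<lambda>a b c. sweedler (kd a) (\<lambda>a1 a2. a1 \<otimes> a2 \<otimes> b \<otimes> c))"
definition "pent2 = sweedler3 kphi' (\<lambda>a b c. a \<otimes> b \<otimes> kd c)"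
definition "pent3 = sweedler3 kphi' (\<lambda>a b c. a \<otimes> b \<otimes> c \<otimes> ku)"
definition "pent4 = sweedler3 kphi' (\<lambda>a b c. sweedler (kd b) (\<lambda>b1 b2. a \<otimes> b1 \<otimes> b2 \<otimes> c))"

lemma ev_pent1: "ev4 pent1 (x \<otimes> y \<otimes> v \<otimes> u) = eps x *s sw (e u) (\<lambda>l1 l2. sw (z (e v \<cdot> l1)) (\<lambda>c1 c2.
  z (e y \<cdot> c1) \<otimes> c2 \<otimes> z l2 \<otimes> one H))"
proof -
  have "ev4 pent1 (x \<otimes> y \<otimes> v \<otimes> u) = sweedler kphi' (\<lambda>a t. sweedler t (\<lambda>b c. sweedler (kd a) (\<lambda>a1 a2.
      ev a1 x \<otimes> ev a2 y \<otimes> ev b v \<otimes> ev c u)))"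
    by (simp only: pent1_def sweedler3_def sweedler_pull[OF bilev4] pure_tens)
  also have "\<dots> = sweedler kphi' (\<lambda>a t. sweedler t (\<lambda>b c. sw (e y) (\<lambda>k1 k2. sw (ev a (x \<cdot> k1)) (\<lambda>c1 c2.
      z (k2 \<cdot> c1) \<otimes> c2 \<otimes> ev b v \<otimes> ev c u))))"
    by (simp only: sweedler_kd[where F = "\<lambda>p q. p \<otimes> q \<otimes> r" for r] lin)
  also have "\<dots> = sw (e y) (\<lambda>k1 k2. sweedler kphi' (\<lambda>a t. sweedler t (\<lambda>b c. sw (ev a (x \<cdot> k1)) (\<lambda>c1 c2.
      z (k2 \<cdot> c1) \<otimes> c2 \<otimes> ev b v \<otimes> ev c u))))"
    by (simp only: sweedler_swap[where t = "comul H (e y)"])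
  also have "\<dots> = eps x *s sw (e u) (\<lambda>l1 l2. sw (z (e v \<cdot> l1)) (\<lambda>c1 c2. z (e y \<cdot> c1) \<otimes> c2 \<otimes> z l2 \<otimes> one H))"
    by (simp only: sweedler_ev3[where F = "\<lambda>p q r. sw p (\<lambda>c1 c2. z (k2 \<cdot> c1) \<otimes> c2 \<otimes> q \<otimes> r)" for k2] lin)
      (simp add: ev_kphi' norm2 pure_tens)
  finally show ?thesis .
qed

lemma ev_pent2: "ev4 pent2 (x \<otimes> y \<otimes> v \<otimes> u) = eps x *s sw (e u) (\<lambda>g1 g2. sw (e (v \<cdot> g1)) (\<lambda>l1 l2.
  z (e y \<cdot> l1) \<otimes> z l2 \<otimes> z g2 \<otimes> one H))"
proof -
  have "ev4 pent2 (x \<otimes> y \<otimes> v \<otimes> u) = sweedler kphi' (\<lambda>a t. sweedler t (\<lambda>b c. sw (e u) (\<lambda>k1 k2. sw (ev c (v \<cdot> k1)) (\<lambda>c1 c2.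
      ev a x \<otimes> ev b y \<otimes> z (k2 \<cdot> c1) \<otimes> c2))))"
    by (simp only: pent2_def sweedler3_def sweedler_pull[OF bilev4] pure_tens ev_kd pull)
  also have "\<dots> = sw (e u) (\<lambda>k1 k2. sweedler kphi' (\<lambda>a t. sweedler t (\<lambda>b c. sw (ev c (v \<cdot> k1)) (\<lambda>c1 c2.
      ev a x \<otimes> ev b y \<otimes> z (k2 \<cdot> c1) \<otimes> c2))))"
    by (simp only: sweedler_swap[where t = "comul H (e u)"])
  also have "\<dots> = eps x *s sw (e u) (\<lambda>g1 g2. sw (e (v \<cdot> g1)) (\<lambda>l1 l2. z (e y \<cdot> l1) \<otimes> z l2 \<otimes> z g2 \<otimes> one H))"
    by (simp only: sweedler_ev3[where F = "\<lambda>p q r. sw r (\<lambda>c1 c2. p \<otimes> q \<otimes> z (k2 \<cdot> c1) \<otimes> c2)" for k2] lin)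
      (simp add: ev_kphi' norm2 pure_tens sw_one)
  finally show ?thesis .
qed

lemma ev_pent3: "ev4 pent3 (x \<otimes> y \<otimes> v \<otimes> u) = eps x *s (eps u *s sw (e v) (\<lambda>l1 l2.
  z (e y \<cdot> l1) \<otimes> z l2 \<otimes> one H \<otimes> one H))"
proof -
  have "ev4 pent3 (x \<otimes> y \<otimes> v \<otimes> u) = sweedler kphi' (\<lambda>a t. sweedler t (\<lambda>b c. eps u *s (ev a x \<otimes> ev b y \<otimes> ev c v \<otimes> one H)))"
    by (simp only: pent3_def sweedler3_def sweedler_pull[OF bilev4] pure_tens ev_ku scale)
  also have "\<dots> = eps x *s (eps u *s sw (e v) (\<lambda>l1 l2. z (e y \<cdot> l1) \<otimes> z l2 \<otimes> one H \<otimes> one H))"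
    by (simp only: sweedler_ev3[where F = "\<lambda>p q r. eps u *s (p \<otimes> q \<otimes> r \<otimes> one H)"] lin)
      (simp add: ev_kphi' norm2 pure_tens, simp only: vec.scale_left_commute)
  finally show ?thesis .
qed

lemma ev_pent4: "ev4 pent4 (x \<otimes> y \<otimes> v \<otimes> u) = eps x *s sw (e v) (\<lambda>k1 k2. sw (e u) (\<lambda>l1 l2. sw (z l2) (\<lambda>c1 c2.
  z (e (y \<cdot> k1) \<cdot> l1) \<otimes> z (k2 \<cdot> c1) \<otimes> c2 \<otimes> one H)))"
proof -
  have "ev4 pent4 (x \<otimes> y \<otimes> v \<otimes> u) = sweedler kphi' (\<lambda>a t. sweedler t (\<lambda>b c. sweedler (kd b) (\<lambda>a1 a2.
      ev a x \<otimes> ev a1 y \<otimes> ev a2 v \<otimes> ev c u)))"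
    by (simp only: pent4_def sweedler3_def sweedler_pull[OF bilev4] pure_tens)
  also have "\<dots> = sweedler kphi' (\<lambda>a t. sweedler t (\<lambda>b c. sw (e v) (\<lambda>k1 k2. sw (ev b (y \<cdot> k1)) (\<lambda>c1 c2.
      ev a x \<otimes> z (k2 \<cdot> c1) \<otimes> c2 \<otimes> ev c u))))"
    by (simp only: sweedler_kd[where F = "\<lambda>p q. r \<otimes> p \<otimes> q \<otimes> s" for r s] lin)
  also have "\<dots> = sw (e v) (\<lambda>k1 k2. sweedler kphi' (\<lambda>a t. sweedler t (\<lambda>b c. sw (ev b (y \<cdot> k1)) (\<lambda>c1 c2.
      ev a x \<otimes> z (k2 \<cdot> c1) \<otimes> c2 \<otimes> ev c u))))"
    by (simp only: sweedler_swap[where t = "comul H (e v)"])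
  also have "\<dots> = eps x *s sw (e v) (\<lambda>k1 k2. sw (e u) (\<lambda>l1 l2. sw (z l2) (\<lambda>c1 c2. z (e (y \<cdot> k1) \<cdot> l1) \<otimes> z (k2 \<cdot> c1) \<otimes> c2 \<otimes> one H)))"
    by (simp only: sweedler_ev3[where F = "\<lambda>p q r. sw q (\<lambda>c1 c2. p \<otimes> z (k2 \<cdot> c1) \<otimes> c2 \<otimes> r)" for k2] lin)
      (simp add: ev_kphi' norm2 pure_tens)
  finally show ?thesis .
qed

lemma ev_pent5: "ev4 (ku \<otimes> kphi') (x \<otimes> y \<otimes> v \<otimes> u) = eps x *s (eps y *s sw (e u) (\<lambda>l1 l2.
  one H \<otimes> z (e v \<cdot> l1) \<otimes> z l2 \<otimes> one H))"
  by (simp only: pure_tens ev_ku ev_kphi' scale pull scale_sweedler) (simp only: vec.scale_left_commute)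

lemma ev_pent12: "ev4 (km4 pent1 pent2) (x \<otimes> y \<otimes> v \<otimes> u) =
   eps x *s sw (e u) (\<lambda>l b. sw (e v \<cdot> l) (\<lambda>x1 x2. z (e y \<cdot> x1) \<otimes> z x2 \<otimes> z b \<otimes> one H))"
proof -
  have "ev4 (km4 pent1 pent2) (x \<otimes> y \<otimes> v \<otimes> u) =
   eps x *s sw y (\<lambda>y1 y2. sw v (\<lambda>v1 v2. sw u (\<lambda>u1 u2. sw (e u1) (\<lambda>l1 l2. sw (z (e v1 \<cdot> l1)) (\<lambda>c1 c. sw c (\<lambda>q1 q2. sw (z l2) (\<lambda>r1 r2.
   sw (e u2) (\<lambda>g1 g2. sw (e (v2 \<cdot> (r1 \<cdot> g1))) (\<lambda>k1 k2. (z (e y1 \<cdot> c1) \<cdot> z (e (y2 \<cdot> q1) \<cdot> k1)) \<otimes> (q2 \<cdot> z k2) \<otimes> (r2 \<cdot> z g2) \<otimes> one H)))))))))"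
    apply (simp only: ev_km4 pure_tens pull_tens lin_tens ev_pent1 ev_pent2 scale tens_scale)
    apply (simp add: norm2 sw_one)
    done
  also have "\<dots> = eps x *s sw y (\<lambda>y1 y2. sw v (\<lambda>v1 v2. sw (e u) (\<lambda>l u2. sw l (\<lambda>l1 l2. sw (z (e v1 \<cdot> l1)) (\<lambda>c1 c. sw c (\<lambda>q1 q2. sw (z l2) (\<lambda>r1 r2.
   sw (e u2) (\<lambda>g1 g2. sw (e (v2 \<cdot> (r1 \<cdot> g1))) (\<lambda>k1 k2. (z (e y1 \<cdot> c1) \<cdot> z (e (y2 \<cdot> q1) \<cdot> k1)) \<otimes> (q2 \<cdot> z k2) \<otimes> (r2 \<cdot> z g2) \<otimes> one H)))))))))"
    by (subst sw_e[where k = u, symmetric]; (intro lin)?; simp add: e_def pi_mul)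
  also have "\<dots> = eps x *s sw y (\<lambda>y1 y2. sw v (\<lambda>v1 v2. sw (e u) (\<lambda>l1 l. sw l (\<lambda>l2 l3. sw (z (e v1 \<cdot> l1)) (\<lambda>c1 c. sw c (\<lambda>q1 q2. sw (z l2) (\<lambda>r1 r2.
   sw (e l3) (\<lambda>g1 g2. sw (e (v2 \<cdot> (r1 \<cdot> g1))) (\<lambda>k1 k2. (z (e y1 \<cdot> c1) \<cdot> z (e (y2 \<cdot> q1) \<cdot> k1)) \<otimes> (q2 \<cdot> z k2) \<otimes> (r2 \<cdot> z g2) \<otimes> one H)))))))))"
    by (simp add: norm2)
  \<comment> \<open>Only a reordering of sums: it brings the coproduct of \<open>l\<close> next to
    \<open>z l2\<close> and \<open>e l3\<close>, as \<open>sw_fold\<close> requires.\<close>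
  also have "\<dots> = eps x *s sw y (\<lambda>y1 y2. sw v (\<lambda>v1 v2. sw (e u) (\<lambda>l1 l. sw (z (e v1 \<cdot> l1)) (\<lambda>c1 c. sw c (\<lambda>q1 q2. sw l (\<lambda>l2 l3. sw (z l2) (\<lambda>r1 r2.
   sw (e l3) (\<lambda>g1 g2. sw (e (v2 \<cdot> (r1 \<cdot> g1))) (\<lambda>k1 k2. (z (e y1 \<cdot> c1) \<cdot> z (e (y2 \<cdot> q1) \<cdot> k1)) \<otimes> (q2 \<cdot> z k2) \<otimes> (r2 \<cdot> z g2) \<otimes> one H)))))))))"
    apply (rule arg_cong[of _ _ "\<lambda>t. eps x *s t"], rule sweedler_cong, rule sweedler_cong, rule sweedler_cong)
    apply (subst sweedler_commute, rule sweedler_cong, rule sweedler_commute)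
    done
  also have "\<dots> = eps x *s sw y (\<lambda>y1 y2. sw v (\<lambda>v1 v2. sw (e u) (\<lambda>l1 l. sw (z (e v1 \<cdot> l1)) (\<lambda>c1 c. sw c (\<lambda>q1 q2. sw l (\<lambda>a b.
   sw (e (v2 \<cdot> a)) (\<lambda>k1 k2. (z (e y1 \<cdot> c1) \<cdot> z (e (y2 \<cdot> q1) \<cdot> k1)) \<otimes> (q2 \<cdot> z k2) \<otimes> z b \<otimes> one H)))))))"
    by (intro arg_cong[of _ _ "\<lambda>x. _ *s x"], rule sweedler_cong, rule sweedler_cong, rule sweedler_cong, rule sweedler_cong, rule sweedler_cong, rule sw_fold) (simp add: z_mul mul_assoc, (intro lin)+)
  also have "\<dots> = eps x *s sw y (\<lambda>y1 y2. sw (e v) (\<lambda>h1 h2. sw (e u) (\<lambda>l1 l. sw (z (h1 \<cdot> l1)) (\<lambda>c1 c. sw c (\<lambda>q1 q2. sw l (\<lambda>a b.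
   sw (e (h2 \<cdot> a)) (\<lambda>k1 k2. (z (e y1 \<cdot> c1) \<cdot> z (e (y2 \<cdot> q1) \<cdot> k1)) \<otimes> (q2 \<cdot> z k2) \<otimes> z b \<otimes> one H)))))))"
    by (subst sw_e[where k = v, symmetric]; (intro lin)?; simp add: e_def pi_mul)
  also have "\<dots> = eps x *s sw (e y) (\<lambda>y1 y2. sw (e v) (\<lambda>h1 h2. sw (e u) (\<lambda>l1 l. sw (z (h1 \<cdot> l1)) (\<lambda>c1 c. sw c (\<lambda>q1 q2. sw l (\<lambda>a b.
   sw (e (h2 \<cdot> a)) (\<lambda>k1 k2. (z (y1 \<cdot> c1) \<cdot> z (e (y2 \<cdot> q1) \<cdot> k1)) \<otimes> (q2 \<cdot> z k2) \<otimes> z b \<otimes> one H)))))))"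
    by (subst sw_e[where k = y, symmetric]; (intro lin)?; simp add: e_def pi_mul)
  also have "\<dots> = eps x *s sw (e v) (\<lambda>h1 h2. sw (e u) (\<lambda>l1 l. sw (z (h1 \<cdot> l1)) (\<lambda>c q2. sw (e y \<cdot> c) (\<lambda>x1 x2. sw l (\<lambda>a b.
   sw (e (h2 \<cdot> a)) (\<lambda>k1 k2. (z x1 \<cdot> z (e x2 \<cdot> k1)) \<otimes> (q2 \<cdot> z k2) \<otimes> z b \<otimes> one H))))))"
    apply (rule arg_cong[of _ _ "\<lambda>t. eps x *s t"])
    apply (simp only: sweedler_swap[where s = "comul H (e y)"])
    apply (simp add: norm2)
    apply (simp only: sweedler_swap[where s = "comul H (e y)"])
    done
  also have "\<dots> = eps x *s sw (e v) (\<lambda>h1 h2. sw (e u) (\<lambda>l1 l. sw (z (h1 \<cdot> l1)) (\<lambda>c q2. sw l (\<lambda>a b.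
   sw (e (h2 \<cdot> a)) (\<lambda>k1 k2. sw (e y \<cdot> c) (\<lambda>x1 x2. z x1 \<cdot> z (e x2 \<cdot> k1)) \<otimes> (q2 \<cdot> z k2) \<otimes> z b \<otimes> one H)))))"
    by (simp only: pull sweedler_swap[where s = "comul H (e y \<cdot> c)" for c])
  also have "\<dots> = eps x *s sw (e u) (\<lambda>l b. sw (e v \<cdot> l) (\<lambda>x1 x2. sw (z x1) (\<lambda>c q2.
   sw (e x2) (\<lambda>k1 k2. z (e y \<cdot> (c \<cdot> k1)) \<otimes> (q2 \<cdot> z k2) \<otimes> z b \<otimes> one H))))"
    apply (rule arg_cong[of _ _ "\<lambda>t. eps x *s t"])
    apply (simp only: sw_z_fold sweedler_swap[where s = "comul H (e v)"])
    apply (simp add: norm2)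
    done
  also have "\<dots> = eps x *s sw (e u) (\<lambda>l b. sw (e v \<cdot> l) (\<lambda>x1 x2. z (e y \<cdot> x1) \<otimes> z x2 \<otimes> z b \<otimes> one H))"
    by (intro arg_cong[of _ _ "\<lambda>x. _ *s x"], rule sweedler_cong, rule sw_fold) (simp add: z_mul mul_assoc, (intro lin)+)
  finally show ?thesis .
qed

lemma ev_pent45: "ev4 (km4 pent4 (ku \<otimes> kphi')) (x \<otimes> y \<otimes> v \<otimes> u) =
   eps x *s sw (e v) (\<lambda>k1 k. sw (e u) (\<lambda>l1 l. sw l (\<lambda>a b. z (e (y \<cdot> k1) \<cdot> l1) \<otimes> z (k \<cdot> a) \<otimes> z b \<otimes> one H)))"
proof -
  have "ev4 (km4 pent4 (ku \<otimes> kphi')) (x \<otimes> y \<otimes> v \<otimes> u) =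
   eps x *s sw v (\<lambda>v1 v2. sw u (\<lambda>u1 u2. sw (e v1) (\<lambda>k1 k2. sw (e u1) (\<lambda>l1 l2. sw (z l2) (\<lambda>c1 c. sw c (\<lambda>r1 r2. sw (e u2) (\<lambda>g1 g2.
    z (e (y \<cdot> k1) \<cdot> l1) \<otimes> (z (k2 \<cdot> c1) \<cdot> z (e (v2 \<cdot> r1) \<cdot> g1)) \<otimes> (r2 \<cdot> z g2) \<otimes> one H)))))))"
    apply (simp only: ev_km4 ev_pent4 ev_pent5 pure_tens(1-7) pull_tens lin_tens  scale tens_scale)
    apply (simp add: norm2 sw_one ev_pent5 tens_scale)
    done
  also have "\<dots> = eps x *s sw (e v) (\<lambda>k v2. sw u (\<lambda>u1 u2. sw k (\<lambda>k1 k2. sw (e u1) (\<lambda>l1 l2. sw (z l2) (\<lambda>c1 c. sw c (\<lambda>r1 r2. sw (e u2) (\<lambda>g1 g2.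
    z (e (y \<cdot> k1) \<cdot> l1) \<otimes> (z (k2 \<cdot> c1) \<cdot> z (e (v2 \<cdot> r1) \<cdot> g1)) \<otimes> (r2 \<cdot> z g2) \<otimes> one H)))))))"
    by (subst sw_e[where k = v, symmetric]; (intro lin)?; simp add: e_def pi_mul)
  also have "\<dots> = eps x *s sw (e v) (\<lambda>k1 k. sw u (\<lambda>u1 u2. sw (e u1) (\<lambda>l1 l2. sw (z l2) (\<lambda>c r2. sw (e u2) (\<lambda>g1 g2.
    z (e (y \<cdot> k1) \<cdot> l1) \<otimes> sw (k \<cdot> c) (\<lambda>x1 x2. z x1 \<cdot> z (e x2 \<cdot> g1)) \<otimes> (r2 \<cdot> z g2) \<otimes> one H)))))"
    by (simp add: norm2)
  also have "\<dots> = eps x *s sw u (\<lambda>u1 u2. sw (e u1) (\<lambda>l1 l2. sw (e v) (\<lambda>k1 k. sw (z l2) (\<lambda>c r2. sw (e u2) (\<lambda>g1 g2.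
    z (e (y \<cdot> k1) \<cdot> l1) \<otimes> z (k \<cdot> (c \<cdot> g1)) \<otimes> (r2 \<cdot> z g2) \<otimes> one H)))))"
    apply (simp only: sw_z_fold mul_assoc)
    apply (simp only: sweedler_swap[where s = "comul H (e v)"])
    done
  also have "\<dots> = eps x *s sw (e u) (\<lambda>l u2. sw l (\<lambda>l1 l2. sw (e v) (\<lambda>k1 k. sw (z l2) (\<lambda>c r2. sw (e u2) (\<lambda>g1 g2.
    z (e (y \<cdot> k1) \<cdot> l1) \<otimes> z (k \<cdot> (c \<cdot> g1)) \<otimes> (r2 \<cdot> z g2) \<otimes> one H)))))"
    by (subst sw_e[where k = u, symmetric]; (intro lin)?; simp add: e_def pi_mul)
  also have "\<dots> = eps x *s sw (e u) (\<lambda>l1 l. sw (e v) (\<lambda>k1 k. sw l (\<lambda>l2 l3. sw (z l2) (\<lambda>c r2. sw (e l3) (\<lambda>g1 g2.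
    z (e (y \<cdot> k1) \<cdot> l1) \<otimes> z (k \<cdot> (c \<cdot> g1)) \<otimes> (r2 \<cdot> z g2) \<otimes> one H)))))"
    by (simp add: norm2)
  also have "\<dots> = eps x *s sw (e u) (\<lambda>l1 l. sw (e v) (\<lambda>k1 k. sw l (\<lambda>a b. z (e (y \<cdot> k1) \<cdot> l1) \<otimes> z (k \<cdot> a) \<otimes> z b \<otimes> one H)))"
    by (intro arg_cong[of _ _ "\<lambda>x. _ *s x"], rule sweedler_cong, rule sweedler_cong, rule sw_fold) (simp add: z_mul mul_assoc, (intro lin)+)
  also have "\<dots> = eps x *s sw (e v) (\<lambda>k1 k. sw (e u) (\<lambda>l1 l. sw l (\<lambda>a b. z (e (y \<cdot> k1) \<cdot> l1) \<otimes> z (k \<cdot> a) \<otimes> z b \<otimes> one H)))"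
    by (subst sweedler_commute, rule refl)
  finally show ?thesis .
qed

text \<open>Inverting the pentagon reverses the order of the factors on both sides, and the
  resulting identity mentions \<open>kphi'\<close> alone.\<close>

lemma inverse_pentagon: "km4 pent1 pent2 = km4 pent3 (km4 pent4 (ku \<otimes> kphi'))"
proof (rule ev4_ext)
  fix x y v u
  \<comment> \<open>Naming the inner product lets its value, already computed in
    \<open>ev_pent45\<close>, act as a single rewrite rule.\<close>
  define Z where "Z = km4 pent4 (ku \<otimes> kphi')"
  have "ev4 (km4 pent3 Z) (x \<otimes> y \<otimes> v \<otimes> u) = eps x *s sw y (\<lambda>y1 y2. sw v (\<lambda>v1 v2. sw (e v1) (\<lambda>l1 l2. sw (z l2) (\<lambda>q1 q2. sw (e v2) (\<lambda>k1 k2.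
    sw (e u) (\<lambda>m1 m. sw m (\<lambda>a b. (z (e y1 \<cdot> l1) \<cdot> z (e (y2 \<cdot> (q1 \<cdot> k1)) \<cdot> m1)) \<otimes> (q2 \<cdot> z (k2 \<cdot> a)) \<otimes> z b \<otimes> one H)))))))"
    apply (simp only: ev_km4 ev_pent3 ev_pent45[folded Z_def] pure_tens pull_tens lin_tens  scale tens_scale)
    apply (simp add: norm2 sw_one)
    done
  also have "\<dots> = eps x *s sw y (\<lambda>y1 y2. sw (e v) (\<lambda>l v2. sw l (\<lambda>l1 l2. sw (z l2) (\<lambda>q1 q2. sw (e v2) (\<lambda>k1 k2.
    sw (e u) (\<lambda>m1 m. sw m (\<lambda>a b. (z (e y1 \<cdot> l1) \<cdot> z (e (y2 \<cdot> (q1 \<cdot> k1)) \<cdot> m1)) \<otimes> (q2 \<cdot> z (k2 \<cdot> a)) \<otimes> z b \<otimes> one H)))))))"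
    by (subst sw_e[where k = v, symmetric]; (intro lin)?; simp add: e_def pi_mul)
  also have "\<dots> = eps x *s sw y (\<lambda>y1 y2. sw (e v) (\<lambda>l1 l. sw l (\<lambda>l2 l3. sw (z l2) (\<lambda>q1 q2. sw (e l3) (\<lambda>k1 k2.
    sw (e u) (\<lambda>m1 m. sw m (\<lambda>a b. (z (e y1 \<cdot> l1) \<cdot> z (e (y2 \<cdot> (q1 \<cdot> k1)) \<cdot> m1)) \<otimes> (q2 \<cdot> z (k2 \<cdot> a)) \<otimes> z b \<otimes> one H)))))))"
    by (simp add: norm2)
  also have "\<dots> = eps x *s sw y (\<lambda>y1 y2. sw (e v) (\<lambda>l1 l. sw l (\<lambda>w1 w2.
    sw (e u) (\<lambda>m1 m. sw m (\<lambda>a b. (z (e y1 \<cdot> l1) \<cdot> z (e (y2 \<cdot> w1) \<cdot> m1)) \<otimes> z (w2 \<cdot> a) \<otimes> z b \<otimes> one H)))))"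
    by (intro arg_cong[of _ _ "\<lambda>x. _ *s x"], rule sweedler_cong, rule sweedler_cong, rule sw_fold) (simp add: z_mul mul_assoc, (intro lin)+)
  also have "\<dots> = eps x *s sw (e y) (\<lambda>y1 y2. sw (e v) (\<lambda>l1 l. sw l (\<lambda>w1 w2.
    sw (e u) (\<lambda>m1 m. sw m (\<lambda>a b. (z (y1 \<cdot> l1) \<cdot> z (e (y2 \<cdot> w1) \<cdot> m1)) \<otimes> z (w2 \<cdot> a) \<otimes> z b \<otimes> one H)))))"
    by (subst sw_e[where k = y, symmetric]; (intro lin)?; simp add: e_def pi_mul)
  also have "\<dots> = eps x *s sw (e v) (\<lambda>l w2. sw (e y \<cdot> l) (\<lambda>x1 x2.
    sw (e u) (\<lambda>m1 m. sw m (\<lambda>a b. (z x1 \<cdot> z (e x2 \<cdot> m1)) \<otimes> z (w2 \<cdot> a) \<otimes> z b \<otimes> one H))))"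
    apply (rule arg_cong[of _ _ "\<lambda>t. eps x *s t"])
    apply (simp only: sweedler_swap[where s = "comul H (e y)"])
    apply (simp add: norm2)
    apply (simp only: sweedler_swap[where s = "comul H (e y)"])
    done
  also have "\<dots> = eps x *s sw (e v) (\<lambda>l w2.
    sw (e u) (\<lambda>m1 m. sw m (\<lambda>a b. sw (e y \<cdot> l) (\<lambda>x1 x2. z x1 \<cdot> z (e x2 \<cdot> m1)) \<otimes> z (w2 \<cdot> a) \<otimes> z b \<otimes> one H)))"
    by (simp only: pull sweedler_swap[where s = "comul H (e y \<cdot> l)" for l])
  also have "\<dots> = eps x *s sw (e u) (\<lambda>l b. sw (e v \<cdot> l) (\<lambda>x1 x2. z (e y \<cdot> x1) \<otimes> z x2 \<otimes> z b \<otimes> one H))"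
    apply (simp only: sw_z_fold sweedler_swap[where s = "comul H (e v)"])
    apply (simp add: norm2)
    done
  finally show "ev4 (km4 pent1 pent2) (x \<otimes> y \<otimes> v \<otimes> u) = ev4 (km4 pent3 Z) (x \<otimes> y \<otimes> v \<otimes> u)"
    by (simp only: ev_pent12)
qed

end

section \<open>Quasi-bialgebras\<close>

lemma algebra_strD:
  assumes "algebra_str m u"
  shows "kbilinear m" "m (m x y) w = m x (m y w)" "m u x = x" "m x u = x"
  using assms by (auto simp: algebra_str_def)

lemma algebra_str_tensor:
  assumes "algebra_str m u" "algebra_str n v"
  shows "algebra_str (tensor_mul m n) (u \<otimes> v)"
proof -
  note a = algebra_strD[OF assms(1)] and b = algebra_strD[OF assms(2)]
  note bil = lin_tensor_mul[OF a(1) b(1)]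
  note l = lin bilinear_left[OF bil] bilinear_right[OF bil]
  let ?m = "tensor_mul m n"
  note p = tensor_mul_pure[OF a(1) b(1)]
  have "?m (?m x y) w = ?m x (?m y w)" for x y w
  proof -
    have "?m (?m (x1 \<otimes> x2) (y1 \<otimes> y2)) (w1 \<otimes> w2) = ?m (x1 \<otimes> x2) (?m (y1 \<otimes> y2) (w1 \<otimes> w2))" for x1 x2 y1 y2 w1 w2
      by (simp add: p a b)
    then have "?m (?m (x1 \<otimes> x2) (y1 \<otimes> y2)) w = ?m (x1 \<otimes> x2) (?m (y1 \<otimes> y2) w)" for x1 x2 y1 y2
      by (rule_tac tensor_ext[of "\<lambda>w. ?m (?m (x1 \<otimes> x2) (y1 \<otimes> y2)) w"]; assumption?; intro l)
    then have "?m (?m (x1 \<otimes> x2) y) w = ?m (x1 \<otimes> x2) (?m y w)" for x1 x2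
      by (rule_tac tensor_ext[of "\<lambda>y. ?m (?m (x1 \<otimes> x2) y) w"]; assumption?; intro l)
    then show ?thesis
      by (rule_tac tensor_ext[of "\<lambda>x. ?m (?m x y) w"]; assumption?; intro l)
  qed
  moreover have "?m (u \<otimes> v) x = x" for x
    by (rule tensor_ext[of "\<lambda>x. ?m (u \<otimes> v) x" "\<lambda>x. x"]; (intro l)?; simp add: p a b)
  moreover have "?m x (u \<otimes> v) = x" for x
    by (rule tensor_ext[of "\<lambda>x. ?m x (u \<otimes> v)" "\<lambda>x. x"]; (intro l)?; simp add: p a b)
  ultimately show ?thesis using bil by (simp add: algebra_str_def)
qed

text \<open>Left multiplication by \<open>y\<close> is injective because \<open>x\<close> undoes it,
  hence surjective by finite dimension; so \<open>y\<close> has a right inverse, which must equal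
  \<open>x\<close>.\<close>

lemma left_inverse_imp_inverse:
  fixes m :: "'k::field ^ 'n::finite \<Rightarrow> 'k ^ 'n \<Rightarrow> 'k ^ 'n"
  assumes "algebra_str m u" "m x y = u"
  shows "m y x = u"
proof -
  note a = algebra_strD[OF assms(1)]
  have "inj (m y)" by (rule inj_on_inverseI[of _ "m x"]) (simp add: a(2)[symmetric] assms(2) a)
  then have "surj (m y)"
    using a(1) by (intro vec.linear_injective_imp_surjective) (auto simp: kbilinear_def)
  then obtain w where w: "m y w = u" by (metis surj_def)
  have "w = m (m x y) w" by (simp add: assms(2) a)
  also have "\<dots> = x" by (simp add: a w)
  finally show ?thesis using w by simp
qed

lemma inverse_unique:
  assumes "algebra_str m u" "m x y = u" "m y x' = u"
  shows "x = x'"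
  using algebra_strD[OF assms(1)] assms(2,3) by metis

section \<open>Algebras with a multiplicative coproduct, and inversion of the pentagon\<close>

locale multiplicative_comul =
  fixes m :: "'k::field ^ 'n::finite \<Rightarrow> 'k ^ 'n \<Rightarrow> 'k ^ 'n" and u and \<Delta> :: "'k ^ 'n \<Rightarrow> 'k ^ ('n \<times> 'n)"
  assumes alg: "algebra_str m u" and lin_Delta: "klinear \<Delta>"
    and Delta_mult: "\<Delta> (m x y) = tensor_mul m m (\<Delta> x) (\<Delta> y)" and Delta_one: "\<Delta> u = u \<otimes> u"
begin

lemmas alg2 = algebra_str_tensor[OF alg alg]
lemmas alg3 = algebra_str_tensor[OF alg alg2, folded mul3_def]
lemmas alg4 = algebra_str_tensor[OF alg alg3, folded mul4_def]
lemmas bil = algebra_strD(1)[OF alg] algebra_strD(1)[OF alg2] algebra_strD(1)[OF alg3] algebra_strD(1)[OF alg4]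

lemmas lins = lin lin_compose[OF lin_Delta] bilinear_left[OF bil(1)] bilinear_right[OF bil(1)]
  bilinear_left[OF bil(2)] bilinear_right[OF bil(2)] bilinear_left[OF bil(3)] bilinear_right[OF bil(3)]
  bilinear_left[OF bil(4)] bilinear_right[OF bil(4)]

lemma mul2_pure: "tensor_mul m m (x \<otimes> y) (x' \<otimes> y') = m x x' \<otimes> m y y'"
  and mul3_pure: "mul3 m (x \<otimes> v) (x' \<otimes> v') = m x x' \<otimes> tensor_mul m m v v'"
  and mul4_pure: "mul4 m (x \<otimes> w) (x' \<otimes> w') = m x x' \<otimes> mul3 m w w'"
  by (simp_all only: mul3_def mul4_def tensor_mul_pure[OF bil(1) bil(1)] tensor_mul_pure[OF bil(1) bil(2)]
      tensor_mul_pure[OF bil(1) bil(3)[unfolded mul3_def]])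

lemma hom3:
  assumes "klinear f" "kbilinear n"
    and "\<And>a b c a' b' c'. f (m a a' \<otimes> m b b' \<otimes> m c c') = n (f (a \<otimes> b \<otimes> c)) (f (a' \<otimes> b' \<otimes> c'))"
  shows "f (mul3 m s t) = n (f s) (f t)"
proof -
  note l = lins lin_compose[OF assms(1)] bilinear_left[OF assms(2)] bilinear_right[OF assms(2)]
  have "f (mul3 m (a \<otimes> b \<otimes> c) (a' \<otimes> b' \<otimes> c')) = n (f (a \<otimes> b \<otimes> c)) (f (a' \<otimes> b' \<otimes> c'))" for a b c a' b' c'
    by (simp only: mul3_pure mul2_pure assms(3))
  then have "f (mul3 m (a \<otimes> b \<otimes> c) (a' \<otimes> t)) = n (f (a \<otimes> b \<otimes> c)) (f (a' \<otimes> t))" for a b c a' t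
    by (rule_tac tensor_ext[of "\<lambda>t. f (mul3 m (a \<otimes> b \<otimes> c) (a' \<otimes> t))"]; assumption?; intro l)
  then have "f (mul3 m (a \<otimes> b \<otimes> c) t) = n (f (a \<otimes> b \<otimes> c)) (f t)" for a b c
    by (rule_tac tensor_ext[of "\<lambda>t. f (mul3 m (a \<otimes> b \<otimes> c) t)"]; assumption?; intro l)
  then have "f (mul3 m (a \<otimes> s) t) = n (f (a \<otimes> s)) (f t)" for a s
    by (rule_tac tensor_ext[of "\<lambda>s. f (mul3 m (a \<otimes> s) t)"]; assumption?; intro l)
  then show ?thesis
    by (rule_tac tensor_ext[of "\<lambda>s. f (mul3 m s t)"]; assumption?; intro l)
qed

lemma hom3_inverse:
  assumes "klinear f" and "\<And>a b c a' b' c'. f (m a a' \<otimes> m b b' \<otimes> m c c') = mul4 m (f (a \<otimes> b \<otimes> c)) (f (a' \<otimes> b' \<otimes> c'))"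
    and "f (u \<otimes> u \<otimes> u) = u \<otimes> u \<otimes> u \<otimes> u" and "mul3 m s t = u \<otimes> u \<otimes> u"
  shows "mul4 m (f s) (f t) = u \<otimes> u \<otimes> u \<otimes> u"
  using hom3[OF assms(1) bil(4) assms(2), of s t] assms(3,4) by simp

text \<open>These maps and \<open>u \<otimes> t\<close> are the five ways in which the associator
  enters the pentagon. All are multiplicative and unital, so they carry inverses to inverses
  (\<open>pl_inverse\<close>).\<close>

definition "pl1 t = sweedler3 t (\<lambda>a b c. sweedler (\<Delta> a) (\<lambda>a1 a2. a1 \<otimes> a2 \<otimes> b \<otimes> c))"
definition "pl2 t = sweedler3 t (\<lambda>a b c. a \<otimes> b \<otimes> \<Delta> c)"
definition "pl3 t = sweedler3 t (\<lambda>a b c. a \<otimes> b \<otimes> c \<otimes> u)"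
definition "pl4 t = sweedler3 t (\<lambda>a b c. sweedler (\<Delta> b) (\<lambda>b1 b2. a \<otimes> b1 \<otimes> b2 \<otimes> c))"

lemma pl_lin: "klinear pl1" "klinear pl2" "klinear pl3" "klinear pl4"
  unfolding pl1_def pl2_def pl3_def pl4_def sweedler3_def by (intro lin)+

lemma pl_pure:
  "pl1 (a \<otimes> b \<otimes> c) = sweedler (\<Delta> a) (\<lambda>a1 a2. a1 \<otimes> a2 \<otimes> b \<otimes> c)"
  "pl2 (a \<otimes> b \<otimes> c) = a \<otimes> b \<otimes> \<Delta> c" "pl3 (a \<otimes> b \<otimes> c) = a \<otimes> b \<otimes> c \<otimes> u"
  "pl4 (a \<otimes> b \<otimes> c) = sweedler (\<Delta> b) (\<lambda>b1 b2. a \<otimes> b1 \<otimes> b2 \<otimes> c)"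
  unfolding pl1_def pl2_def pl3_def pl4_def sweedler3_def by (simp_all only: sweedler_pure lins)

lemma sweedler_Delta_mult:
  assumes "\<And>b. klinear (\<lambda>a. F a b)" "\<And>a. klinear (\<lambda>b. F a b)"
  shows "sweedler (\<Delta> (m x y)) F = sweedler (\<Delta> x) (\<lambda>a b. sweedler (\<Delta> y) (\<lambda>c d. F (m a c) (m b d)))"
  by (simp only: Delta_mult tensor_mul_def[of m m] sweedler_sweedler sweedler_pure assms)

lemma pl_inverse:
  assumes "mul3 m s t = u \<otimes> u \<otimes> u"
  shows "mul4 m (pl1 s) (pl1 t) = u \<otimes> u \<otimes> u \<otimes> u" "mul4 m (pl2 s) (pl2 t) = u \<otimes> u \<otimes> u \<otimes> u"
    "mul4 m (pl3 s) (pl3 t) = u \<otimes> u \<otimes> u \<otimes> u" "mul4 m (pl4 s) (pl4 t) = u \<otimes> u \<otimes> u \<otimes> u"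
    "mul4 m (u \<otimes> s) (u \<otimes> t) = u \<otimes> u \<otimes> u \<otimes> u"
proof -
  note pull4 = sweedler_pull_left[OF bil(4)] sweedler_pull_right[OF bil(4)]
  note unit = algebra_strD(3)[OF alg]
  show "mul4 m (pl1 s) (pl1 t) = u \<otimes> u \<otimes> u \<otimes> u"
    by (rule hom3_inverse[OF pl_lin(1) _ _ assms],
        simp only: pl_pure sweedler_Delta_mult lin pull4 mul4_pure mul3_pure mul2_pure, rule sweedler_commute,
        simp only: pl_pure Delta_one sweedler_pure lin)
  show "mul4 m (pl2 s) (pl2 t) = u \<otimes> u \<otimes> u \<otimes> u"
    by (rule hom3_inverse[OF pl_lin(2) _ _ assms])
      (simp_all only: pl_pure Delta_mult mul4_pure mul3_pure mul2_pure Delta_one)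
  show "mul4 m (pl3 s) (pl3 t) = u \<otimes> u \<otimes> u \<otimes> u"
    by (rule hom3_inverse[OF pl_lin(3) _ _ assms])
      (simp_all only: pl_pure mul4_pure mul3_pure mul2_pure unit)
  show "mul4 m (pl4 s) (pl4 t) = u \<otimes> u \<otimes> u \<otimes> u"
    by (rule hom3_inverse[OF pl_lin(4) _ _ assms],
        simp only: pl_pure sweedler_Delta_mult lin pull4 mul4_pure mul3_pure mul2_pure, rule sweedler_commute,
        simp only: pl_pure Delta_one sweedler_pure lin)
  show "mul4 m (u \<otimes> s) (u \<otimes> t) = u \<otimes> u \<otimes> u \<otimes> u"
    by (simp only: mul4_pure unit assms)
qed

text \<open>The two sides of the assumed identity are inverse to the two sides of the pentagon, and
  inverses are unique.\<close>

lemma pentagon_from_inverse: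
  assumes "mul3 m s t = u \<otimes> u \<otimes> u"
    and "mul4 m (pl1 t) (pl2 t) = mul4 m (pl3 t) (mul4 m (pl4 t) (u \<otimes> t))"
  shows "mul4 m (pl2 s) (pl1 s) = mul4 m (mul4 m (u \<otimes> s) (pl4 s)) (pl3 s)"
proof (rule inverse_unique[OF alg4])
  have ts: "mul3 m t s = u \<otimes> u \<otimes> u" by (rule left_inverse_imp_inverse[OF alg3 assms(1)])
  note a = algebra_strD(2-4)[OF alg4] and i = pl_inverse[OF assms(1)] and j = pl_inverse[OF ts]
  have mid: "mul4 m x (mul4 m y w) = w" if "mul4 m x y = u \<otimes> u \<otimes> u \<otimes> u" for x y w
    using a(1)[of x y w] that by (simp add: a)
  show "mul4 m (mul4 m (pl2 s) (pl1 s)) (mul4 m (pl1 t) (pl2 t)) = u \<otimes> u \<otimes> u \<otimes> u"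
    by (simp only: a mid[OF i(1)] i)
  show "mul4 m (mul4 m (pl1 t) (pl2 t)) (mul4 m (mul4 m (u \<otimes> s) (pl4 s)) (pl3 s)) = u \<otimes> u \<otimes> u \<otimes> u"
    by (simp only: assms(2) a mid[OF j(5)] mid[OF j(4)] j)
qed

end

text \<open>Quasi-coassociativity and the pentagon are requested for the inverse associator, and
  invertibility on one side only. Finite dimension supplies the other side, and with it the axioms
  can be inverted back.\<close>

lemma quasi_bialgebraI:
  assumes "algebra_str (mul K) (one K)" "klinear (comul K)" "kfunctional (counit K)"
    "\<And>x y. comul K (mul K x y) = tensor_mul (mul K) (mul K) (comul K x) (comul K y)"
    "comul K (one K) = one K \<otimes> one K"
    "\<And>x y. counit K (mul K x y) = counit K x * counit K y" "counit K (one K) = 1"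
    "\<And>x. sweedler (comul K x) (\<lambda>x1 x2. counit K x1 *s x2) = x"
    "\<And>x. sweedler (comul K x) (\<lambda>x1 x2. counit K x2 *s x1) = x"
    and inv: "mul3 (mul K) (assoc K) (assoc_inv K) = one K \<otimes> one K \<otimes> one K"
    and coassoc: "\<And>x. mul3 (mul K) (assoc_inv K) (sweedler (comul K x) (\<lambda>x1 x2. x1 \<otimes> comul K x2)) =
      mul3 (mul K) (sweedler (comul K x) (\<lambda>x1 x2. sweedler (comul K x1) (\<lambda>x11 x12. x11 \<otimes> x12 \<otimes> x2))) (assoc_inv K)"
    and pentagon: "mul4 (mul K)
        (sweedler3 (assoc_inv K) (\<lambda>a b c. sweedler (comul K a) (\<lambda>a1 a2. a1 \<otimes> a2 \<otimes> b \<otimes> c)))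
        (sweedler3 (assoc_inv K) (\<lambda>a b c. a \<otimes> b \<otimes> comul K c)) =
      mul4 (mul K) (sweedler3 (assoc_inv K) (\<lambda>a b c. a \<otimes> b \<otimes> c \<otimes> one K))
        (mul4 (mul K) (sweedler3 (assoc_inv K) (\<lambda>a b c. sweedler (comul K b) (\<lambda>b1 b2. a \<otimes> b1 \<otimes> b2 \<otimes> c)))
          (one K \<otimes> assoc_inv K))"
    and "sweedler3 (assoc K) (\<lambda>a b c. counit K b *s (a \<otimes> c)) = one K \<otimes> one K"
  shows "quasi_bialgebra K"
proof -
  interpret multiplicative_comul "mul K" "one K" "comul K"
    by (rule multiplicative_comul.intro) (fact assms)+
  have inv': "mul3 (mul K) (assoc_inv K) (assoc K) = one K \<otimes> one K \<otimes> one K"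
    by (rule left_inverse_imp_inverse[OF alg3 inv])
  have "sweedler (comul K x) (\<lambda>x1 x2. x1 \<otimes> comul K x2) =
    mul3 (mul K) (mul3 (mul K) (assoc K)
       (sweedler (comul K x) (\<lambda>x1 x2. sweedler (comul K x1) (\<lambda>x11 x12. x11 \<otimes> x12 \<otimes> x2)))) (assoc_inv K)" (is "?L = _") for x
  proof -
    have "?L = mul3 (mul K) (mul3 (mul K) (assoc K) (assoc_inv K)) ?L" by (simp only: inv algebra_strD[OF alg3])
    then show ?thesis by (simp only: algebra_strD(2)[OF alg3] coassoc)
  qed
  then show ?thesis
    using assms(1-9,13) inv inv' pentagon_from_inverse[OF inv pentagon[folded pl1_def pl2_def pl3_def pl4_def]]
    by (simp add: quasi_bialgebra_def inverse_in_def pl1_def pl2_def pl3_def pl4_def)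
qed

section \<open>Opposite quasi-bialgebras and transport of structure\<close>

definition tmap where "tmap f g t = sweedler t (\<lambda>a b. f a \<otimes> g b)"

lemma lin_tmap: "klinear (tmap f g)"
  unfolding tmap_def by (intro lin)

lemma tmap_pure: "klinear f \<Longrightarrow> klinear g \<Longrightarrow> tmap f g (x \<otimes> y) = f x \<otimes> g y"
  unfolding tmap_def by (simp only: sweedler_pure lin)

lemma sweedler_tmap:
  assumes "\<And>b. klinear (\<lambda>a. F a b)" "\<And>a. klinear (\<lambda>b. F a b)"
  shows "sweedler (tmap f g t) F = sweedler t (\<lambda>a b. F (f a) (g b))"
  unfolding tmap_def by (simp only: sweedler_sweedler sweedler_pure assms)

lemma tmap_pull: "tmap f g (sweedler t F) = sweedler t (\<lambda>a b. tmap f g (F a b))"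
  by (rule linear_sweedler[OF lin_tmap])

lemma tensor_mul_tmap:
  assumes "kbilinear m'" "kbilinear n'" "klinear f" "klinear g"
    and "\<And>x y. f (m x y) = m' (f x) (f y)" "\<And>x y. g (n x y) = n' (g x) (g y)"
  shows "tmap f g (tensor_mul m n s t) = tensor_mul m' n' (tmap f g s) (tmap f g t)"
proof -
  have "tensor_mul m' n' (tmap f g s) (tmap f g t) =
      sweedler s (\<lambda>a b. sweedler t (\<lambda>c d. m' (f a) (f c) \<otimes> n' (g b) (g d)))"
    unfolding tensor_mul_def
    by (simp only: sweedler_tmap lin bilinear_left[OF assms(1)] bilinear_left[OF assms(2)]
        bilinear_right[OF assms(1)] bilinear_right[OF assms(2)])
  then show ?thesis
    unfolding tensor_mul_def by (simp only: tmap_pull tmap_pure assms)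
qed

lemma sweedler_flip: "sweedler (flip t) F = sweedler t (\<lambda>a b. F b a)"
  by (simp add: sweedler_def flip_def) (rule sum.swap)

lemma flip_sweedler: "flip t = sweedler t (\<lambda>a b. b \<otimes> a)"
  by (metis sweedler_eta sweedler_flip)

lemma lin_flip: "klinear flip"
  unfolding flip_sweedler by (intro lin)

lemma lin_flip13: "klinear flip13"
  by (simp add: klinear_iff flip13_def vec_eq_iff)

lemma flip13_sweedler: "flip13 t = sweedler3 t (\<lambda>a b c. c \<otimes> b \<otimes> a)"
proof -
  have "flip13 (a \<otimes> u) = sweedler u (\<lambda>b c. c \<otimes> b \<otimes> a)" for a u
    by (rule tensor_ext[of "\<lambda>u. flip13 (a \<otimes> u)"]) (simp_all only: lin lin_compose[OF lin_flip13] flip13_tensor sweedler_pure)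
  then show ?thesis unfolding sweedler3_def
    by (rule_tac tensor_ext[of flip13]) (simp_all only: lin lin_flip13 sweedler_pure)
qed

lemma tensor_mul_op: "tensor_mul (\<lambda>x y. m y x) (\<lambda>x y. n y x) s t = tensor_mul m n t s"
  unfolding tensor_mul_def by (rule sweedler_commute)

lemma mul_op: "mul3 (\<lambda>x y. m y x) s t = mul3 m t s" "mul4 (\<lambda>x y. m y x) s' t' = mul4 m t' s'"
proof -
  have 2: "tensor_mul (\<lambda>x y. m y x) (\<lambda>x y. m y x) = (\<lambda>s t. tensor_mul m m t s)"
    by (intro ext) (rule tensor_mul_op)
  have 3: "mul3 (\<lambda>x y. m y x) = (\<lambda>s t. mul3 m t s)"
    unfolding mul3_def 2 by (intro ext) (rule tensor_mul_op)
  show "mul3 (\<lambda>x y. m y x) s t = mul3 m t s" by (simp only: 3)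
  show "mul4 (\<lambda>x y. m y x) s' t' = mul4 m t' s'"
    unfolding mul4_def 3 by (rule tensor_mul_op)
qed

definition flip14 :: "'k::field ^ ('a::finite \<times> 'b::finite \<times> 'c::finite \<times> 'd::finite) \<Rightarrow> 'k ^ ('d \<times> 'c \<times> 'b \<times> 'a)" where
  "flip14 t = sweedler t (\<lambda>a s. sweedler s (\<lambda>b v. sweedler v (\<lambda>c d. d \<otimes> c \<otimes> b \<otimes> a)))"

lemma lin_flip14: "klinear flip14"
  unfolding flip14_def by (intro lin)

lemma flip14_pure: "flip14 (a \<otimes> b \<otimes> c \<otimes> d) = d \<otimes> c \<otimes> b \<otimes> a"
  unfolding flip14_def by (simp only: sweedler_pure lin)

context multiplicative_comul begin

lemma flip13_mul: "flip13 (mul3 m s t) = mul3 m (flip13 s) (flip13 t)"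
  by (rule hom3[OF lin_flip13 bil(3)]) (simp only: flip13_tensor mul3_pure mul2_pure)

lemma flip14_mul: "flip14 (mul4 m s t) = mul4 m (flip14 s) (flip14 t)"
proof -
  note l = lins lin_compose[OF lin_flip14]
  let ?E = "\<lambda>s t. flip14 (mul4 m s t) = mul4 m (flip14 s) (flip14 t)"
  have "?E (a \<otimes> b \<otimes> c \<otimes> d) (a' \<otimes> b' \<otimes> c' \<otimes> d')" for a b c d a' b' c' d'
    by (simp only: flip14_pure mul4_pure mul3_pure mul2_pure)
  then have "?E (a \<otimes> b \<otimes> c \<otimes> d) (a' \<otimes> b' \<otimes> t)" for a b c d a' b' t
    by (rule_tac tensor_ext[of "\<lambda>t. flip14 (mul4 m (a \<otimes> b \<otimes> c \<otimes> d) (a' \<otimes> b' \<otimes> t))"]; assumption?; intro l)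
  then have "?E (a \<otimes> b \<otimes> c \<otimes> d) (a' \<otimes> t)" for a b c d a' t
    by (rule_tac tensor_ext[of "\<lambda>t. flip14 (mul4 m (a \<otimes> b \<otimes> c \<otimes> d) (a' \<otimes> t))"]; assumption?; intro l)
  then have "?E (a \<otimes> b \<otimes> c \<otimes> d) (t)" for a b c d t
    by (rule_tac tensor_ext[of "\<lambda>t. flip14 (mul4 m (a \<otimes> b \<otimes> c \<otimes> d) (t))"]; assumption?; intro l)
  then have "?E (a \<otimes> b \<otimes> s) (t)" for a b s t
    by (rule_tac tensor_ext[of "\<lambda>s. flip14 (mul4 m (a \<otimes> b \<otimes> s) (t))"]; assumption?; intro l)
  then have "?E (a \<otimes> s) (t)" for a s t
    by (rule_tac tensor_ext[of "\<lambda>s. flip14 (mul4 m (a \<otimes> s) (t))"]; assumption?; intro l)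
  then show ?thesis
    by (rule_tac tensor_ext[of "\<lambda>s. flip14 (mul4 m s t)"]; assumption?; intro l)
qed

end

lemma quasi_op_cop_simps [simp]:
  "mul (quasi_op_cop K) = (\<lambda>x y. mul K y x)" "one (quasi_op_cop K) = one K"
  "comul (quasi_op_cop K) = (\<lambda>x. flip (comul K x))" "counit (quasi_op_cop K) = counit K"
  "assoc (quasi_op_cop K) = flip13 (assoc K)" "assoc_inv (quasi_op_cop K) = flip13 (assoc_inv K)"
  by (simp_all add: quasi_op_cop_def op_cop_def)

lemma quasi_bialgebraD:
  assumes "quasi_bialgebra K"
  shows "algebra_str (mul K) (one K)" "klinear (comul K)" "kfunctional (counit K)"
    "comul K (mul K x y) = tensor_mul (mul K) (mul K) (comul K x) (comul K y)"
    "comul K (one K) = one K \<otimes> one K" "counit K (mul K x y) = counit K x * counit K y"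
    "counit K (one K) = 1" "sweedler (comul K x) (\<lambda>x1 x2. counit K x1 *s x2) = x"
    "sweedler (comul K x) (\<lambda>x1 x2. counit K x2 *s x1) = x"
    "mul3 (mul K) (assoc K) (assoc_inv K) = one K \<otimes> one K \<otimes> one K"
    "mul3 (mul K) (assoc_inv K) (assoc K) = one K \<otimes> one K \<otimes> one K"
    "sweedler (comul K x) (\<lambda>x1 x2. x1 \<otimes> comul K x2) =
          mul3 (mul K) (mul3 (mul K) (assoc K)
              (sweedler (comul K x) (\<lambda>x1 x2. sweedler (comul K x1) (\<lambda>x11 x12. x11 \<otimes> x12 \<otimes> x2))))
            (assoc_inv K)"
    "mul4 (mul K)
       (sweedler3 (assoc K) (\<lambda>a b c. a \<otimes> b \<otimes> comul K c))
       (sweedler3 (assoc K) (\<lambda>a b c. sweedler (comul K a) (\<lambda>a1 a2. a1 \<otimes> a2 \<otimes> b \<otimes> c))) =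
     mul4 (mul K)
       (mul4 (mul K) (one K \<otimes> assoc K)
         (sweedler3 (assoc K) (\<lambda>a b c. sweedler (comul K b) (\<lambda>b1 b2. a \<otimes> b1 \<otimes> b2 \<otimes> c))))
       (sweedler3 (assoc K) (\<lambda>a b c. a \<otimes> b \<otimes> c \<otimes> one K))"
    "sweedler3 (assoc K) (\<lambda>a b c. counit K b *s (a \<otimes> c)) = one K \<otimes> one K"
  using assms unfolding quasi_bialgebra_def inverse_in_def by blast+

lemma multiplicative_comulI: "quasi_bialgebra K \<Longrightarrow> multiplicative_comul (mul K) (one K) (comul K)"
  by (rule multiplicative_comul.intro) (rule quasi_bialgebraD; assumption)+

text \<open>Reversing the tensor factors exchanges \<open>pl1\<close> with \<open>pl2\<close> and
  \<open>pl3\<close> with \<open>one K \<otimes> t\<close>, and fixes \<open>pl4\<close>. The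
  opposite product reverses the order of multiplication as well, so the pentagon is carried to
  itself.\<close>

lemma quasi_bialgebra_op_cop:
  assumes "quasi_bialgebra K"
  shows "quasi_bialgebra (quasi_op_cop K)"
proof -
  note K = quasi_bialgebraD[OF assms]
  interpret multiplicative_comul "mul K" "one K" "comul K" by (rule multiplicative_comulI[OF assms])
  note a3 = algebra_strD(2-4)[OF alg3] and a4 = algebra_strD(2-4)[OF alg4]
  let ?A = "\<lambda>x. sweedler (comul K x) (\<lambda>x1 x2. sweedler (comul K x1) (\<lambda>x11 x12. x11 \<otimes> x12 \<otimes> x2))"
  let ?B = "\<lambda>x. sweedler (comul K x) (\<lambda>x1 x2. x1 \<otimes> comul K x2)"
  note lf = lins lin_compose[OF lin_flip] lin_compose[OF lin_flip13] lin_compose[OF lin_flip14]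
  have flip_A: "sweedler (flip (comul K x)) (\<lambda>x1 x2. x1 \<otimes> flip (comul K x2)) = flip13 (?A x)" for x
    by (simp only: sweedler_flip, simp only: flip_sweedler[of "comul K y" for y] sweedler_tensor2 linear_sweedler[OF lin_flip13] flip13_tensor)
  have flip_B: "sweedler (flip (comul K x)) (\<lambda>x1 x2. sweedler (flip (comul K x1)) (\<lambda>x11 x12. x11 \<otimes> x12 \<otimes> x2)) = flip13 (?B x)" for x
    by (simp only: sweedler_flip flip13_sweedler linear_sweedler[OF lin_flip13] sweedler3_def sweedler_sweedler sweedler_pure lin)
  have flip_one: "flip13 (one K \<otimes> one K \<otimes> one K) = one K \<otimes> one K \<otimes> one K"
    by (rule flip13_tensor)
  \<comment> \<open>Quasi-coassociativity solved for the other bracketing. Reversing tensor factors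
    also exchanges the two bracketings, so this is the identity needed under the opposite
    product.\<close>
  have 1: "?A x = mul3 (mul K) (assoc_inv K) (mul3 (mul K) (?B x) (assoc K))" for x
  proof -
    have "mul3 (mul K) (assoc_inv K) (mul3 (mul K) (?B x) (assoc K)) =
      mul3 (mul K) (mul3 (mul K) (assoc_inv K) (assoc K)) (mul3 (mul K) (?A x) (mul3 (mul K) (assoc_inv K) (assoc K)))"
      by (simp only: K(12) a3)
    then show ?thesis by (simp only: K a3)
  qed
  have pl: "sweedler3 (flip13 t) (\<lambda>a b c. a \<otimes> b \<otimes> flip (comul K c)) = flip14 (pl1 t)"
    "sweedler3 (flip13 t) (\<lambda>a b c. sweedler (flip (comul K a)) (\<lambda>a1 a2. a1 \<otimes> a2 \<otimes> b \<otimes> c)) = flip14 (pl2 t)"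
    "sweedler3 (flip13 t) (\<lambda>a b c. a \<otimes> b \<otimes> c \<otimes> one K) = flip14 (one K \<otimes> t)"
    "one K \<otimes> flip13 t = flip14 (pl3 t)"
    "sweedler3 (flip13 t) (\<lambda>a b c. sweedler (flip (comul K b)) (\<lambda>b1 b2. a \<otimes> b1 \<otimes> b2 \<otimes> c)) = flip14 (pl4 t)"
    "sweedler3 (flip13 t) (\<lambda>a b c. counit K b *s (a \<otimes> c)) = flip (sweedler3 t (\<lambda>a b c. counit K b *s (a \<otimes> c)))" for t
    unfolding pl1_def pl2_def pl3_def pl4_def flip13_sweedler sweedler3_def flip14_def
    by (simp_all only: sweedler_sweedler sweedler_pure lf lin_functional[OF K(3)] sweedler_flip flip_sweedler sweedler_tensor2
        sweedler_scale scale_sweedler)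
  show ?thesis
    unfolding quasi_bialgebra_def inverse_in_def quasi_op_cop_simps mul_op[of "mul K"] pl sweedler_flip
    apply (intro conjI allI)
    subgoal using K(1) by (auto simp: algebra_str_def kbilinear_def)
    subgoal by (intro lf)
    subgoal by (rule K)
    subgoal by (subst tensor_mul_op[of "mul K" "mul K"]) (simp only: K(4) flip_sweedler tensor_mul_def[of "mul K"] sweedler_sweedler sweedler_pure lf)
    subgoal by (simp only: K flip_tensor)
    subgoal by (simp add: K mult.commute)
    subgoal by (rule K)
    subgoal by (rule K)
    subgoal by (rule K)
    subgoal by (simp only: flip13_mul[symmetric] K flip_one)
    subgoal by (simp only: flip13_mul[symmetric] K flip_one)
    subgoal for x by (simp only: flip_A[unfolded sweedler_flip] flip_B[unfolded sweedler_flip] flip13_mul[symmetric] 1[of x])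
    subgoal by (simp only: pl[unfolded sweedler_flip] flip14_mul[symmetric] K(13)[folded pl1_def pl2_def pl3_def pl4_def] a4)
    subgoal by (simp only: pl(6) K flip_tensor)
    done
qed

lemma quasi_antipode_op_cop:
  assumes "algebra_str (mul K) (one K)" "quasi_antipode K S \<alpha> \<beta>"
  shows "quasi_antipode (quasi_op_cop K) S \<beta> \<alpha>"
proof -
  note a = algebra_strD[OF assms(1)]
  have lin_S: "klinear S" using assms(2) by (simp add: quasi_antipode_def)
  note l = lin bilinear_left[OF a(1)] bilinear_right[OF a(1)] lin_compose[OF lin_S]
  have 3: "sweedler3 (flip13 t) (\<lambda>a b c. mul K c (mul K \<alpha> (mul K (S b) (mul K \<beta> a)))) =
     sweedler3 t (\<lambda>a b c. mul K a (mul K \<alpha> (mul K (S b) (mul K \<beta> c))))"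
    "sweedler3 (flip13 t) (\<lambda>a b c. mul K (S c) (mul K \<alpha> (mul K b (mul K \<beta> (S a))))) =
     sweedler3 t (\<lambda>a b c. mul K (S a) (mul K \<alpha> (mul K b (mul K \<beta> (S c)))))" for t \<alpha> \<beta>
    unfolding flip13_sweedler sweedler3_def by (simp_all only: sweedler_sweedler sweedler_pure l)
  have e1: "sweedler t (\<lambda>x1 x2. mul K (mul K (S x1) \<alpha>) x2) = sweedler t (\<lambda>x1 x2. mul K (S x1) (mul K \<alpha> x2))" for t \<alpha>
    by (simp only: a(2))
  have e2: "sweedler3 t (\<lambda>a b c. mul K (mul K (mul K (mul K a \<beta>) (S b)) \<alpha>) c) =
     sweedler3 t (\<lambda>a b c. mul K a (mul K \<beta> (mul K (S b) (mul K \<alpha> c))))" for t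
    unfolding sweedler3_def by (intro sweedler_cong) (simp only: a(2))
  show ?thesis
    using assms(2)[unfolded quasi_antipode_def e1 e2]
    unfolding quasi_antipode_def quasi_op_cop_simps sweedler_flip by (simp add: a 3)
qed

text \<open>That \<open>L\<close> is a quasi-bialgebra is a conclusion here. For the second left
  partial dual it therefore suffices to identify its structure maps; none of the axioms has to be
  computed again.\<close>

locale quasi_transport =
  fixes K :: "('k::field, 'm::finite) qbialg" and L :: "('k, 'n::finite) qbialg" and \<theta> :: "'k ^ 'm \<Rightarrow> 'k ^ 'n"
  assumes quasi_K: "quasi_bialgebra K" and lin_theta: "klinear \<theta>" and bij_theta: "bij \<theta>"
    and mul_L: "mul L (\<theta> x) (\<theta> y) = \<theta> (mul K x y)" and one_L: "one L = \<theta> (one K)"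
    and comul_L: "comul L (\<theta> x) = tmap \<theta> \<theta> (comul K x)" and counit_L: "counit L (\<theta> x) = counit K x"
    and assoc_L: "assoc L = tmap \<theta> (tmap \<theta> \<theta>) (assoc K)"
    and assoc_inv_L: "assoc_inv L = tmap \<theta> (tmap \<theta> \<theta>) (assoc_inv K)"
begin

lemmas K = quasi_bialgebraD[OF quasi_K]

lemma theta_inv [simp]: "\<theta> (inv \<theta> y) = y" "inv \<theta> (\<theta> x) = x"
  using bij_theta by (simp_all add: bij_is_surj surj_f_inv_f bij_is_inj inv_f_f)

lemma lin_inv: "klinear (inv \<theta>)"
  unfolding klinear_iff
proof safe
  fix x y c
  have "inv \<theta> (\<theta> (inv \<theta> x) + \<theta> (inv \<theta> y)) = inv \<theta> x + inv \<theta> y"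
    by (subst vec.linear_add[OF lin_theta, symmetric]) (rule theta_inv)
  then show "inv \<theta> (x + y) = inv \<theta> x + inv \<theta> y" by (simp only: theta_inv)
  have "inv \<theta> (c *s \<theta> (inv \<theta> x)) = c *s inv \<theta> x"
    by (subst vec.linear_scale[OF lin_theta, symmetric]) (rule theta_inv)
  then show "inv \<theta> (c *s x) = c *s inv \<theta> x" by (simp only: theta_inv)
qed

abbreviation "\<theta>2 \<equiv> tmap \<theta> \<theta>"
abbreviation "\<theta>3 \<equiv> tmap \<theta> \<theta>2"
abbreviation "\<theta>4 \<equiv> tmap \<theta> \<theta>3"

lemma mul_L': "mul L x y = \<theta> (mul K (inv \<theta> x) (inv \<theta> y))" by (simp flip: mul_L)
lemma comul_L': "comul L x = \<theta>2 (comul K (inv \<theta> x))" by (simp flip: comul_L)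
lemma counit_L': "counit L x = counit K (inv \<theta> x)" by (simp flip: counit_L)

lemmas lin_th = lin lin_compose[OF lin_theta] lin_compose[OF lin_inv] lin_compose[OF lin_tmap]
  bilinear_left[OF algebra_strD(1)[OF K(1)]] bilinear_right[OF algebra_strD(1)[OF K(1)]] lin_compose[OF K(2)]

lemma bil_L: "kbilinear (mul L)"
  unfolding kbilinear_def mul_L' by (intro conjI allI lin_th)

lemma lin_comul_L: "klinear (comul L)"
  unfolding comul_L' by (intro lin_th)

lemma lin_counit_L: "kfunctional (counit L)"
  using K(3) lin_inv by (simp add: kfunctional_iff klinear_iff counit_L')

lemmas bil_L2 = lin_tensor_mul[OF bil_L bil_L]
lemmas bil_L3 = lin_tensor_mul[OF bil_L bil_L2, folded mul3_def]
lemmas lin_L = lin_th bilinear_left[OF bil_L] bilinear_right[OF bil_L] lin_compose[OF lin_comul_L]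
  lin_functional[OF lin_counit_L]

lemma mul2_L: "tensor_mul (mul L) (mul L) (\<theta>2 s) (\<theta>2 t) = \<theta>2 (tensor_mul (mul K) (mul K) s t)"
  by (rule tensor_mul_tmap[OF bil_L bil_L lin_theta lin_theta, symmetric]) (simp_all only: mul_L)

lemma mul3_L: "mul3 (mul L) (\<theta>3 s) (\<theta>3 t) = \<theta>3 (mul3 (mul K) s t)"
  unfolding mul3_def
  by (rule tensor_mul_tmap[OF bil_L bil_L2 lin_theta lin_tmap, symmetric]) (simp_all only: mul_L mul2_L)

lemma mul4_L: "mul4 (mul L) (\<theta>4 s) (\<theta>4 t) = \<theta>4 (mul4 (mul K) s t)"
  unfolding mul4_def
  by (rule tensor_mul_tmap[OF bil_L bil_L3 lin_theta lin_tmap, symmetric]) (simp_all only: mul_L mul3_L)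

lemmas th_pure = tmap_pure[OF lin_theta lin_theta] tmap_pure[OF lin_theta lin_tmap]
lemmas th = one_L comul_L counit_L assoc_L assoc_inv_L mul_L mul2_L mul3_L mul4_L

lemma sweedler3_L:
  assumes "\<And>b c. klinear (\<lambda>a. F a b c)" "\<And>a c. klinear (\<lambda>b. F a b c)" "\<And>a b. klinear (\<lambda>c. F a b c)"
  shows "sweedler3 (\<theta>3 t) F = sweedler3 t (\<lambda>a b c. F (\<theta> a) (\<theta> b) (\<theta> c))"
  unfolding sweedler3_def by (simp only: sweedler_tmap lin assms)

lemma th3_pull: "\<theta>4 (sweedler3 t F) = sweedler3 t (\<lambda>a b c. \<theta>4 (F a b c))" "\<theta>2 (sweedler3 t G) = sweedler3 t (\<lambda>a b c. \<theta>2 (G a b c))"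
  unfolding sweedler3_def by (simp_all only: tmap_pull)

lemma theta_pull: "\<theta> (sweedler t F) = sweedler t (\<lambda>a b. \<theta> (F a b))" "\<theta> (sweedler3 s G) = sweedler3 s (\<lambda>a b c. \<theta> (G a b c))"
  unfolding sweedler3_def by (simp_all only: linear_sweedler[OF lin_theta])

lemma theta_scale: "\<theta> (c *s x) = c *s \<theta> x" "\<theta>2 (c *s t) = c *s \<theta>2 t"
  by (rule vec.linear_scale[OF lin_theta] vec.linear_scale[OF lin_tmap])+

lemma quasi_L: "quasi_bialgebra L"
proof -
  have assoc: "mul L (mul L (\<theta> x) (\<theta> y)) (\<theta> w) = mul L (\<theta> x) (mul L (\<theta> y) (\<theta> w))"
    "mul L (one L) (\<theta> x) = \<theta> x" "mul L (\<theta> x) (one L) = \<theta> x" for x y w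
    by (simp_all only: th algebra_strD[OF K(1)])
  have mult: "comul L (mul L (\<theta> x) (\<theta> y)) = tensor_mul (mul L) (mul L) (comul L (\<theta> x)) (comul L (\<theta> y))"
    "counit L (mul L (\<theta> x) (\<theta> y)) = counit L (\<theta> x) * counit L (\<theta> y)" for x y
    by (simp_all only: th K)
  have counit: "sweedler (comul L (\<theta> x)) (\<lambda>x1 x2. counit L x1 *s x2) = \<theta> x"
    "sweedler (comul L (\<theta> x)) (\<lambda>x1 x2. counit L x2 *s x1) = \<theta> x" for x
    by (simp_all only: th sweedler_tmap lin_L theta_scale[symmetric] theta_pull[symmetric] K)
  have coassoc: "sweedler (comul L (\<theta> x)) (\<lambda>x1 x2. x1 \<otimes> comul L x2) =
     mul3 (mul L) (mul3 (mul L) (assoc L) (sweedler (comul L (\<theta> x)) (\<lambda>x1 x2. sweedler (comul L x1) (\<lambda>x11 x12. x11 \<otimes> x12 \<otimes> x2))))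
        (assoc_inv L)" for x
  proof -
    have "sweedler (comul L (\<theta> x)) (\<lambda>x1 x2. sweedler (comul L x1) (\<lambda>x11 x12. x11 \<otimes> x12 \<otimes> x2)) =
       \<theta>3 (sweedler (comul K x) (\<lambda>x1 x2. sweedler (comul K x1) (\<lambda>x11 x12. x11 \<otimes> x12 \<otimes> x2)))"
      by (simp only: th sweedler_tmap lin_L tmap_pull th_pure)
    moreover have "sweedler (comul L (\<theta> x)) (\<lambda>x1 x2. x1 \<otimes> comul L x2) = \<theta>3 (sweedler (comul K x) (\<lambda>x1 x2. x1 \<otimes> comul K x2))"
      by (simp only: th sweedler_tmap lin_L tmap_pull th_pure)
    ultimately show ?thesis by (simp only: th K(12)[of x])
  qed
  have pl: "sweedler3 (assoc L) (\<lambda>a b c. a \<otimes> b \<otimes> comul L c) = \<theta>4 (sweedler3 (assoc K) (\<lambda>a b c. a \<otimes> b \<otimes> comul K c))"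
    "sweedler3 (assoc L) (\<lambda>a b c. sweedler (comul L a) (\<lambda>a1 a2. a1 \<otimes> a2 \<otimes> b \<otimes> c)) =
     \<theta>4 (sweedler3 (assoc K) (\<lambda>a b c. sweedler (comul K a) (\<lambda>a1 a2. a1 \<otimes> a2 \<otimes> b \<otimes> c)))"
    "sweedler3 (assoc L) (\<lambda>a b c. sweedler (comul L b) (\<lambda>b1 b2. a \<otimes> b1 \<otimes> b2 \<otimes> c)) =
     \<theta>4 (sweedler3 (assoc K) (\<lambda>a b c. sweedler (comul K b) (\<lambda>b1 b2. a \<otimes> b1 \<otimes> b2 \<otimes> c)))"
    "sweedler3 (assoc L) (\<lambda>a b c. a \<otimes> b \<otimes> c \<otimes> one L) = \<theta>4 (sweedler3 (assoc K) (\<lambda>a b c. a \<otimes> b \<otimes> c \<otimes> one K))"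
    "one L \<otimes> assoc L = \<theta>4 (one K \<otimes> assoc K)"
    "sweedler3 (assoc L) (\<lambda>a b c. counit L b *s (a \<otimes> c)) = \<theta>2 (sweedler3 (assoc K) (\<lambda>a b c. counit K b *s (a \<otimes> c)))"
    by (simp_all only: th sweedler3_L lin_L th3_pull th_pure tmap_pull sweedler_tmap theta_scale)
  show ?thesis
    unfolding quasi_bialgebra_def inverse_in_def algebra_str_def pl
    apply (intro conjI allI bil_L lin_comul_L lin_counit_L)
    subgoal for x y w by (rule assoc(1)[of "inv \<theta> x" "inv \<theta> y" "inv \<theta> w", unfolded theta_inv])
    subgoal for x by (rule assoc(2)[of "inv \<theta> x", unfolded theta_inv])
    subgoal for x by (rule assoc(3)[of "inv \<theta> x", unfolded theta_inv])
    subgoal for x y by (rule mult(1)[of "inv \<theta> x" "inv \<theta> y", unfolded theta_inv])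
    subgoal by (simp only: th K th_pure)
    subgoal for x y by (rule mult(2)[of "inv \<theta> x" "inv \<theta> y", unfolded theta_inv])
    subgoal by (simp only: th K)
    subgoal for x by (rule counit(1)[of "inv \<theta> x", unfolded theta_inv])
    subgoal for x by (rule counit(2)[of "inv \<theta> x", unfolded theta_inv])
    subgoal by (simp only: th K th_pure)
    subgoal by (simp only: th K th_pure)
    subgoal for x by (rule coassoc[of "inv \<theta> x", unfolded theta_inv])
    subgoal by (simp only: mul4_L K)
    subgoal by (simp only: th K th_pure)
    done
qed

lemma iso_L: "quasi_bialgebra_iso K L \<theta>"
  unfolding quasi_bialgebra_iso_def using quasi_K quasi_L lin_theta bij_theta
  by (simp add: th tmap_def sweedler3_def sweedler_tensor2)

lemma antipode_L:
  assumes "quasi_antipode K S \<alpha> \<beta>"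
  shows "quasi_antipode L (\<theta> \<circ> S \<circ> inv \<theta>) (\<theta> \<alpha>) (\<theta> \<beta>)"
proof -
  let ?S = "\<lambda>x. \<theta> (S (inv \<theta> x))"
  have S: "klinear S" "\<And>x y. S (mul K x y) = mul K (S y) (S x)" "S (one K) = one K"
    "\<And>x. sweedler (comul K x) (\<lambda>x1 x2. mul K (mul K (S x1) \<alpha>) x2) = counit K x *s \<alpha>"
    "\<And>x. sweedler (comul K x) (\<lambda>x1 x2. mul K (mul K x1 \<beta>) (S x2)) = counit K x *s \<beta>"
    "sweedler3 (assoc K) (\<lambda>a b c. mul K (mul K (mul K (mul K a \<beta>) (S b)) \<alpha>) c) = one K"
    "sweedler3 (assoc_inv K) (\<lambda>a b c. mul K (mul K (mul K (mul K (S a) \<alpha>) b) \<beta>) (S c)) = one K"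
    using assms by (simp_all add: quasi_antipode_def)
  note l = lin_L lin_compose[OF S(1)] lin_compose[OF lin_theta]
  have lin_S: "klinear ?S" by (intro l)
  have anti: "?S (mul L (\<theta> x) (\<theta> y)) = mul L (?S (\<theta> y)) (?S (\<theta> x))" for x y
    by (simp only: th theta_inv S)
  have l1: "sweedler (comul L (\<theta> x)) (\<lambda>x1 x2. mul L (mul L (?S x1) (\<theta> \<alpha>)) x2) = counit L (\<theta> x) *s \<theta> \<alpha>" for x
    by (simp only: th sweedler_tmap l theta_inv theta_pull[symmetric] theta_scale[symmetric] S)
  have l2: "sweedler (comul L (\<theta> x)) (\<lambda>x1 x2. mul L (mul L x1 (\<theta> \<beta>)) (?S x2)) = counit L (\<theta> x) *s \<theta> \<beta>" for x
    by (simp only: th sweedler_tmap l theta_inv theta_pull[symmetric] theta_scale[symmetric] S)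
  show ?thesis
    unfolding quasi_antipode_def o_def
    apply (intro conjI allI lin_S)
    subgoal for x y by (rule anti[of "inv \<theta> x" "inv \<theta> y", unfolded theta_inv])
    subgoal by (simp only: th theta_inv S)
    subgoal for x by (rule l1[of "inv \<theta> x", unfolded theta_inv])
    subgoal for x by (rule l2[of "inv \<theta> x", unfolded theta_inv])
    subgoal by (simp only: th sweedler3_L l theta_inv theta_pull[symmetric] S)
    subgoal by (simp only: th sweedler3_L l theta_inv theta_pull[symmetric] S)
    done
qed

end

section \<open>The left partial dual as a quasi-bialgebra\<close>

context partial_dual begin

abbreviation "KK \<equiv> left_partial_dual H B C \<iota> \<pi> \<zeta> \<gamma>"
abbreviation "kc \<equiv> lpd_counit H \<iota> \<pi>"

lemma functional_eps_iota: "kfunctional (\<lambda>b. eps (\<iota> b))"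
  using functional_eps linear_iota by (simp add: kfunctional_iff klinear_iff)

lemma lin_kc: "klinear (\<lambda>F. kc F *s v)"
  unfolding lpd_counit_def by (intro lin)

lemma kc_eq: "kc F = eps (ev F (one H))"
proof -
  \<comment> \<open>The vector with all entries 1. Scaling it turns a scalar identity into a vector
    identity, to which \<open>tensor_ext\<close> applies.\<close>
  let ?v = "1 :: 'k ^ 'h"
  have "kc (f \<otimes> b) *s ?v = eps (ev (f \<otimes> b) (one H)) *s ?v" for f b
    using dual_one_sp[OF functional_eps_iota, of b ?v]
    by (simp add: lpd_counit_def scalar_product_tensor ev_pure eps_scale scalar_product_commute[of b] vec_eq_iff)
  then have "kc F *s ?v = eps (ev F (one H)) *s ?v"
    by (rule_tac tensor_ext[of "\<lambda>F. kc F *s ?v"]; assumption?; intro lin_kc lin)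
  then show ?thesis by (simp add: vec_eq_iff)
qed

lemma KK_simps [simp]:
  "mul KK = km" "one KK = ku" "comul KK = kd" "counit KK = kc" "assoc_inv KK = kphi'"
  by (simp_all add: left_partial_dual_def Let_def)

lemma algebra_K3: "algebra_str (mul3 km) (ku \<otimes> ku \<otimes> ku)"
  unfolding mul3_def by (intro algebra_str_tensor algebra_K)

text \<open>The description by \<open>THE\<close> is resolved by uniqueness of inverses in the
  threefold tensor power, with \<open>kphi\<close> as witness.\<close>

lemma assoc_KK: "assoc KK = kphi"
proof -
  have 1: "mul3 km kphi kphi' = ku \<otimes> ku \<otimes> ku"
    unfolding mul3_def by (rule kphi_inverse)
  then have "inverse_in (mul3 km) (ku \<otimes> ku \<otimes> ku) kphi kphi'"
    using left_inverse_imp_inverse[OF algebra_K3 1] by (simp add: inverse_in_def)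
  moreover have "x = kphi" if "inverse_in (mul3 km) (ku \<otimes> ku \<otimes> ku) x kphi'" for x
    using that 1 left_inverse_imp_inverse[OF algebra_K3 1] inverse_unique[OF algebra_K3, of x kphi' kphi]
    by (simp add: inverse_in_def)
  ultimately have "(THE \<phi>. inverse_in (mul3 km) (ku \<otimes> ku \<otimes> ku) \<phi> kphi') = kphi"
    by (rule the_equality)
  then show ?thesis by (simp add: left_partial_dual_def Let_def)
qed

lemma one_nonzero [simp]: "one H \<noteq> 0"
proof
  assume "one H = 0"
  then have "eps (one H) = 0" using eps_scale[of 0 "one H"] by simp
  then show False by simp
qed

lemma kd_one: "kd ku = ku \<otimes> ku"
proof (rule ev2_ext)
  fix h k
  show "ev2 (kd ku) (h \<otimes> k) = ev2 (ku \<otimes> ku) (h \<otimes> k)"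
    by (simp only: ev_kd ev_ku pure_tens) (simp add: norm2 sw_one z_e vec.scale_left_commute)
qed

text \<open>At \<open>one H\<close> the twisted product evaluates \<open>G\<close> at one leg of
  \<open>ev F (one H)\<close>, and the counit of the product absorbs the other leg. What remains is
  \<open>ev G\<close> at an element of \<open>Bs\<close>, which it sees only through
  \<open>eps\<close>.\<close>

lemma kc_mult: "kc (km F G) = kc F * kc G"
proof -
  have "ev (km F G) (one H) = sw (ev F (one H)) (\<lambda>a1 a2. a2 \<cdot> ev G a1)"
    by (simp add: ev_km sw_one lin)
  then have "eps (ev (km F G) (one H)) *s one H = sw (ev F (one H)) (\<lambda>a1 a2. eps a2 *s (eps (ev G a1) *s one H))"
    by (simp add: eps_pull flip: vec.scale_scale)
  also have "\<dots> = eps (ev G (ev F (one H))) *s one H"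
    by (simp only: sw_counit(2)[of "\<lambda>a. eps (ev G a) *s one H"] lin)
  also have "ev G (ev F (one H)) = eps (ev F (one H)) *s ev G (one H)"
    using ev_B_mul[OF ev_Bs[of F "one H"], of G "one H"] by simp
  finally have "eps (eps (ev (km F G) (one H)) *s one H) = eps ((eps (ev F (one H)) * eps (ev G (one H))) *s one H)"
    by (simp add: eps_scale)
  then show ?thesis by (simp add: kc_eq eps_scale)
qed

lemma ev_pi_e: "ev F (e h) = ev F h"
  by (rule ev_cong) (rule pi_e)

lemma kc_counit: "sweedler (kd F) (\<lambda>x1 x2. kc x1 *s x2) = F" "sweedler (kd F) (\<lambda>x1 x2. kc x2 *s x1) = F"
proof (rule_tac [!] ev_ext)
  fix h
  have "ev (sweedler (kd F) (\<lambda>x1 x2. kc x1 *s x2)) h = sweedler (ev2 (kd F) (one H \<otimes> h)) (\<lambda>a b. eps a *s b)"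
    by (simp only: ev_pull ev_scale kc_eq sweedler_ev2[symmetric] lin)
  also have "\<dots> = ev F h"
    by (simp only: ev_kd sweedler_sweedler sweedler_pure lin) (simp add: norm2 ev_pi_e)
  finally show "ev (sweedler (kd F) (\<lambda>x1 x2. kc x1 *s x2)) h = ev F h" .
  have "ev (sweedler (kd F) (\<lambda>x1 x2. kc x2 *s x1)) h = sweedler (ev2 (kd F) (h \<otimes> one H)) (\<lambda>a b. eps b *s a)"
    by (simp only: ev_pull ev_scale kc_eq sweedler_ev2[symmetric] lin)
  also have "\<dots> = ev F h"
    by (simp only: ev_kd sweedler_sweedler sweedler_pure lin) (simp add: norm2 e_one sw_one z_id[OF ev_Bs])
  finally show "ev (sweedler (kd F) (\<lambda>x1 x2. kc x2 *s x1)) h = ev F h" .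
qed

lemma kphi_normal: "sweedler3 kphi (\<lambda>a b c. kc b *s (a \<otimes> c)) = ku \<otimes> ku"
proof (rule ev2_ext)
  fix h w
  have "ev2 (sweedler3 kphi (\<lambda>a b c. kc b *s (a \<otimes> c))) (h \<otimes> w) =
     sweedler (ev3 kphi (h \<otimes> one H \<otimes> w)) (\<lambda>p v. sweedler v (\<lambda>q r. eps q *s (p \<otimes> r)))"
    by (simp only: sweedler3_def sweedler_pull[OF bilev2] tens_scale pure_tens kc_eq sweedler_ev3[symmetric] lin)
  also have "\<dots> = eps h *s sw (e w) (\<lambda>l1 l2. (zb l1 \<cdot> z l2) \<otimes> one H)"
    by (simp only: ev_kphi sweedler_scale sweedler_sweedler sweedler_pure lin)
      (simp add: norm2 e_one sw_one z_id[OF Bs_closed(1)] sweedler_pure vec.scale_left_commute)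
  also have "\<dots> = eps h *s (sw (e w) (\<lambda>l1 l2. zb l1 \<cdot> z l2) \<otimes> one H)"
    by (simp only: sweedler_tensor1)
  also have "\<dots> = ev2 (ku \<otimes> ku) (h \<otimes> w)"
    by (simp only: sw_zb_z pure_tens ev_ku scale eps_e) (simp only: vec.scale_left_commute)
  finally show "ev2 (sweedler3 kphi (\<lambda>a b c. kc b *s (a \<otimes> c))) (h \<otimes> w) = ev2 (ku \<otimes> ku) (h \<otimes> w)" .
qed

lemma quasi_bialgebra_KK: "quasi_bialgebra KK"
proof (rule quasi_bialgebraI; unfold KK_simps assoc_KK)
  show "algebra_str km ku" by (rule algebra_K)
  show "klinear kd" by (rule lin_kd)
  show "kfunctional kc"
    using lin_kc[of "1 :: 'k ^ 'h"] by (simp add: klinear_iff kfunctional_iff vec_eq_iff)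
  show "kd (km x y) = tensor_mul km km (kd x) (kd y)" for x y by (rule kd_mult)
  show "kd ku = ku \<otimes> ku" by (rule kd_one)
  show "kc (km x y) = kc x * kc y" for x y by (rule kc_mult)
  show "kc ku = 1" by (simp add: kc_eq ev_ku)
  show "sweedler (kd x) (\<lambda>x1 x2. kc x1 *s x2) = x" "sweedler (kd x) (\<lambda>x1 x2. kc x2 *s x1) = x" for x
    by (rule kc_counit)+
  show "mul3 km kphi kphi' = ku \<otimes> ku \<otimes> ku" unfolding mul3_def by (rule kphi_inverse)
  show "mul3 km kphi' (sweedler (kd x) (\<lambda>x1 x2. x1 \<otimes> kd x2)) =
    mul3 km (sweedler (kd x) (\<lambda>x1 x2. sweedler (kd x1) (\<lambda>x11 x12. x11 \<otimes> x12 \<otimes> x2))) kphi'" for x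
    unfolding mul3_def by (rule kd_quasi_coassoc)
  show "mul4 km (sweedler3 kphi' (\<lambda>a b c. sweedler (kd a) (\<lambda>a1 a2. a1 \<otimes> a2 \<otimes> b \<otimes> c)))
     (sweedler3 kphi' (\<lambda>a b c. a \<otimes> b \<otimes> kd c)) =
    mul4 km (sweedler3 kphi' (\<lambda>a b c. a \<otimes> b \<otimes> c \<otimes> ku))
     (mul4 km (sweedler3 kphi' (\<lambda>a b c. sweedler (kd b) (\<lambda>b1 b2. a \<otimes> b1 \<otimes> b2 \<otimes> c))) (ku \<otimes> kphi'))"
    unfolding mul4_def mul3_def by (rule inverse_pentagon[unfolded pent1_def pent2_def pent3_def pent4_def])
  show "sweedler3 kphi (\<lambda>a b c. kc b *s (a \<otimes> c)) = ku \<otimes> ku" by (rule kphi_normal)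
qed

section \<open>Calculus with the convolution inverses and the canonical element\<close>

lemma zb_one: "zb (one H) = one H" and eb_one: "eb (one H) = one H"
  using sw_z_zb[of "one H"] sw_e_eb[of "one H"] by (simp_all add: sw_one lin z_one e_one)

text \<open>The relation \<open>z * e = id\<close> convolved with \<open>eb\<close> on the right;
  \<open>e_zb\<close> is the same with \<open>zb\<close> on the left. Both serve to trade one of the
  four maps for another whose cancelling partner is present.\<close>

lemma z_eb: "sw h (\<lambda>h1 h2. h1 \<cdot> eb h2) = z h"
proof -
  have "sw h (\<lambda>h1 h2. h1 \<cdot> eb h2) = sw h (\<lambda>h1 h2. sw h1 (\<lambda>k1 k2. z k1 \<cdot> e k2) \<cdot> eb h2)"
    by (simp only: sw_ze)
  also have "\<dots> = sw h (\<lambda>h1 h. z h1 \<cdot> sw h (\<lambda>k1 k2. e k1 \<cdot> eb k2))"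
    by (simp add: norm2)
  finally show ?thesis by (simp only: sw_e_eb scale mul_one sw_counit lin)
qed

lemma e_zb: "sw h (\<lambda>h1 h2. zb h1 \<cdot> h2) = e h"
proof -
  have "sw h (\<lambda>h1 h2. zb h1 \<cdot> h2) = sw h (\<lambda>h1 h2. zb h1 \<cdot> sw h2 (\<lambda>k1 k2. z k1 \<cdot> e k2))"
    by (simp only: sw_ze)
  also have "\<dots> = sw h (\<lambda>h h2. sw h (\<lambda>k1 k2. zb k1 \<cdot> z k2) \<cdot> e h2)"
    by (simp add: norm2)
  finally show ?thesis by (simp only: sw_zb_z scale mul_one sw_counit lin)
qed

text \<open>What B-linearity of \<open>z\<close> becomes for its convolution inverse. Inserting
  \<open>z * zb\<close> behind \<open>b2\<close> lets \<open>b2\<close> enter \<open>z\<close>; then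
  \<open>zb\<close> and \<open>z\<close> meet on the two legs of \<open>b \<cdot> h\<close> and
  cancel.\<close>

lemma zb_mul: "b \<in> Bs \<Longrightarrow> sw b (\<lambda>b1 b2. zb (b1 \<cdot> h) \<cdot> b2) = eps b *s zb h"
proof -
  assume b: "b \<in> Bs"
  have "sw b (\<lambda>b1 b2. zb (b1 \<cdot> h) \<cdot> b2) = sw h (\<lambda>h1 h2. sw b (\<lambda>b1 b2. zb (b1 \<cdot> h1) \<cdot> b2 \<cdot> (eps h2 *s one H)))"
    by (simp add: norm2)
  also have "\<dots> = sw h (\<lambda>h1 h2. sw b (\<lambda>b1 b2. zb (b1 \<cdot> h1) \<cdot> b2 \<cdot> sw h2 (\<lambda>h2 h3. z h2 \<cdot> zb h3)))"
    by (simp only: sw_z_zb)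
  also have "\<dots> = sw h (\<lambda>h1 h. sw h (\<lambda>h2 h3. sw b (\<lambda>b1 b2. zb (b1 \<cdot> h1) \<cdot> ((b2 \<cdot> z h2) \<cdot> zb h3))))"
    apply (simp only: pull mul_assoc)
    apply (simp only: sweedler_swap[where s = "comul H b"])
    done
  also have "\<dots> = sw h (\<lambda>h1 h. sw h (\<lambda>h2 h3. sw b (\<lambda>b1 b2. zb (b1 \<cdot> h1) \<cdot> (z (b2 \<cdot> h2) \<cdot> zb h3))))"
    by (intro sweedler_cong sw_cong_B[OF b]) (simp add: z_mul, (intro lin)+)
  also have "\<dots> = sw h (\<lambda>h h3. sw (b \<cdot> h) (\<lambda>x1 x2. zb x1 \<cdot> z x2) \<cdot> zb h3)"
    apply (simp only: sweedler_swap[where t = "comul H b"])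
    apply (simp add: norm2)
    apply (simp only: sweedler_swap[where t = "comul H b"])
    apply (simp only: sw_coassoc lin)
    done
  finally show ?thesis by (simp only: sw_zb_z scale mul_one eps_mul vec.scale_scale[symmetric] scale_sweedler[symmetric] sw_counit lin)
qed

text \<open>What colinearity of \<open>e\<close> becomes for its convolution inverse. Inserting
  \<open>eb * e\<close> in front of \<open>h1\<close> lets \<open>sw_e\<close> gather
  \<open>e\<close> and \<open>x1\<close> under one coproduct, where \<open>e * eb\<close> collapses;
  the inserted \<open>eb\<close> survives.\<close>

lemma sw_eb:
  assumes "\<And>b. klinear (\<lambda>a. F a b)" "\<And>a. klinear (\<lambda>b. F a b)"
    and cong: "\<And>a b b'. \<pi> b = \<pi> b' \<Longrightarrow> F a b = F a b'"
  shows "sw x (\<lambda>x1 x2. sw (eb x2) (\<lambda>h1 h2. F h1 (x1 \<cdot> h2))) = F (eb x) (one H)"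
proof -
  note lF = lin lin_compose[OF assms(1)] lin_compose[OF assms(2)]
    and pF = linear_sweedler[OF assms(1)] linear_sweedler[OF assms(2)]
  have cong': "F a (b \<cdot> c) = F a (b' \<cdot> c)" if "\<pi> b = \<pi> b'" for a b b' c
    by (rule cong) (simp add: pi_mul that)
  have "sw x (\<lambda>x1 x2. sw (eb x2) (\<lambda>h1 h2. F h1 (x1 \<cdot> h2))) =
    sw x (\<lambda>u x2. sw u (\<lambda>v x1. sw (eb x2) (\<lambda>h1 h2. F (sw v (\<lambda>y w. eb y \<cdot> e w) \<cdot> h1) (x1 \<cdot> h2))))"
    by (simp add: sw_eb_e norm2 lF vec.linear_scale[OF assms(1)])
  also have "\<dots> = sw x (\<lambda>w y. sw y (\<lambda>u x2. sw u (\<lambda>v x1. sw (eb x2) (\<lambda>h1 h2. F (eb w \<cdot> (e v \<cdot> h1)) (x1 \<cdot> h2)))))"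
    by (simp add: norm2 lF pF)
  also have "\<dots> = sw x (\<lambda>w y. sw y (\<lambda>u x2. sw (e u) (\<lambda>v x1. sw (eb x2) (\<lambda>h1 h2. F (eb w \<cdot> (v \<cdot> h1)) (x1 \<cdot> h2)))))"
    by (rule sweedler_cong, rule sweedler_cong, rule sw_e; (intro lF)?; intro sweedler_cong cong'; assumption)
  also have "\<dots> = sw x (\<lambda>w y. sw (sw y (\<lambda>u x2. e u \<cdot> eb x2)) (\<lambda>t1 t2. F (eb w \<cdot> t1) t2))"
    by (simp add: norm2 lF)
  also have "\<dots> = F (eb x) (one H)"
    by (simp only: sw_e_eb scale) (simp add: sw_one lF sw_counit)
  finally show ?thesis .
qed

text \<open>On \<open>Bs\<close> this is the algebra embedding of \<open>B\<close> as
  \<open>\<epsilon> # B\<close>, because \<open>\<zeta>\<close> inverts \<open>\<iota>\<close>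
  there. Composing with \<open>\<zeta>\<close> makes it a linear map on all of \<open>H\<close>, so
  that it can stand inside Sweedler sums over \<open>H\<close>.\<close>

definition J :: "'k ^ 'h \<Rightarrow> 'k ^ ('c \<times> 'b)" where "J h = cdual_one C \<otimes> \<zeta> h"

lemma lin_J [lin]: "klinear f \<Longrightarrow> klinear (\<lambda>x. J (f x))"
  unfolding J_def by (intro lin)

lemma J_pull: "J (sweedler t F) = sweedler t (\<lambda>a b. J (F a b))" "J (c *s h) = c *s J h"
  by (rule linear_sweedler vec.linear_scale; intro lin)+

lemma ev_J: "ev (J h) k = eps k *s z h"
  by (simp add: J_def ev_one z_def)

lemma J_mul: "b \<in> Bs \<Longrightarrow> c \<in> Bs \<Longrightarrow> km (J b) (J c) = J (b \<cdot> c)"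
  by (rule ev_ext) (simp add: ev_km ev_J z_id Bs_closed norm2 sweedler_scale vec.scale_left_commute)

lemma J_one: "J (one H) = ku"
  by (rule ev_ext) (simp add: ev_J ev_ku z_one)

definition sect where "sect = (SOME \<sigma>. klinear \<sigma> \<and> \<pi> \<circ> \<sigma> = id)"

lemma sect: "klinear sect" "\<pi> (sect x) = x"
proof -
  have "\<exists>\<sigma>. klinear \<sigma> \<and> \<pi> \<circ> \<sigma> = id"
    by (rule vec.linear_surjective_right_inverse[OF linear_pi surj_pi])
  then have "klinear sect \<and> \<pi> \<circ> sect = id"
    unfolding sect_def by (rule someI_ex)
  then show "klinear sect" "\<pi> (sect x) = x" by (auto simp: fun_eq_iff)
qed

text \<open>\<open>tau\<close> is the canonical element of \<open>C\<^sup>* \<otimes> C\<close>, lifted along \<open>\<pi>\<close>; it may be paired only with functions factoring through \<open>\<pi>\<close>.\<close>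

definition tau :: "'k ^ (('c \<times> 'b) \<times> 'h)" where
  "tau = (\<Sum>j\<in>UNIV. (bas j \<otimes> aone B) \<otimes> sect (bas j))"

lemma sweedler_tau:
  assumes "\<And>b. klinear (\<lambda>a. F a b)" "\<And>a. klinear (\<lambda>b. F a b)"
  shows "sweedler tau F = (\<Sum>j\<in>UNIV. F (bas j \<otimes> aone B) (sect (bas j)))"
  by (simp only: tau_def sweedler_sum sweedler_pure assms)

lemma sum_components: "klinear f \<Longrightarrow> f x = (\<Sum>i\<in>UNIV. x $ i *s f (bas i))"
  using sum_basis[of f x] by (simp add: scalar_product_bas)

lemma dual_coact_sp': "sweedler (dual_coact C g) (\<lambda>f1 f2. scalar_product f2 h *s f1) $ i = scalar_product g (act C (bas i) h)"
proof -
  have "sweedler (dual_coact C g) (\<lambda>f1 f2. scalar_product f2 h *s f1) $ i *s (1 :: 'k ^ 'h) =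
     sweedler (dual_coact C g) (\<lambda>a b. scalar_product a (bas i) *s (scalar_product b h *s 1))"
    by (simp add: sweedler_pairs scalar_product_bas vec.scale_sum_left mult_ac vec.scale_scale)
  then show ?thesis
    by (simp add: dual_coact_sp[OF bilinear_act] vec_eq_iff)
qed

lemma km_I: "km (f \<otimes> aone B) (g \<otimes> b) = cdual_mul C f g \<otimes> b"
proof (rule ev_ext)
  fix h
  show "ev (km (f \<otimes> aone B) (g \<otimes> b)) h = ev (cdual_mul C f g \<otimes> b) h"
    by (simp only: ev_km ev_pure iota_one scale sw_one lin mul_one dual_mul_sp[OF linear_ccomul] sw_ccomul_pi)
qed

lemma km_IJ: "km (f \<otimes> aone B) (cdual_one C \<otimes> b) = f \<otimes> b"
proof (rule ev_ext)
  fix h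
  show "ev (km (f \<otimes> aone B) (cdual_one C \<otimes> b)) h = ev (f \<otimes> b) h"
    by (simp only: ev_km ev_pure iota_one scale sw_one lin mul_one sp_one_C')
      (simp only: vec.scale_left_commute[of "scalar_product f x" for x] sw_counit lin)
qed

text \<open>The product of the dual of \<open>C\<close> is dual to the coproduct of
  \<open>C\<close>: multiplying the first legs of two canonical elements amounts to splitting the
  second leg of one. Since second legs are known only up to the kernel of \<open>\<pi>\<close>,
  \<open>F\<close> must factor through \<open>\<pi>\<close> in both of them.\<close>

lemma tau_mul:
  assumes "\<And>b c. klinear (\<lambda>a. F a b c)" "\<And>a c. klinear (\<lambda>b. F a b c)" "\<And>a b. klinear (\<lambda>c. F a b c)"
    and "\<And>p x x' y. \<pi> x = \<pi> x' \<Longrightarrow> F p x y = F p x' y" "\<And>p x y y'. \<pi> y = \<pi> y' \<Longrightarrow> F p x y = F p x y'"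
  shows "sweedler tau (\<lambda>p x. sweedler tau (\<lambda>q y. F (km p q) x y)) = sweedler tau (\<lambda>p x. sw x (\<lambda>x1 x2. F p x1 x2))"
proof -
  note l = lin lin_compose[OF assms(1)] lin_compose[OF assms(2)] lin_compose[OF assms(3)] lin_compose[OF sect(1)]
  have s: "F p x y = F p (sect (\<pi> x)) (sect (\<pi> y))" for p x y
    using assms(4,5) sect(2) by metis
  have m: "km (bas j \<otimes> aone B) (bas k \<otimes> aone B) = (\<Sum>i\<in>UNIV. ccomul C (bas i) $ (j, k) *s (bas i \<otimes> aone B))" for j k
  proof -
    have "cdual_mul C (bas j) (bas k) \<otimes> aone B = (\<Sum>i\<in>UNIV. cdual_mul C (bas j) (bas k) $ i *s (bas i \<otimes> aone B))"
      by (rule sum_components[of "\<lambda>f. f \<otimes> aone B"]) (intro lin)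
    then show ?thesis by (simp add: km_I dual_mul_def bas_tensor scalar_product_bas)
  qed
  have "sweedler tau (\<lambda>p x. sw x (\<lambda>x1 x2. F p x1 x2)) =
    (\<Sum>i\<in>UNIV. sw (sect (bas i)) (\<lambda>x1 x2. F (bas i \<otimes> aone B) x1 x2))"
    by (simp only: sweedler_tau l)
  also have "\<dots> = (\<Sum>i\<in>UNIV. sweedler (ccomul C (bas i)) (\<lambda>x1 x2. F (bas i \<otimes> aone B) (sect x1) (sect x2)))"
    by (subst s) (simp only: sw_ccomul_pi[symmetric, of "\<lambda>x1 x2. F p (sect x1) (sect x2)" for p] l sect(2))
  also have "\<dots> = (\<Sum>i\<in>UNIV. \<Sum>j\<in>UNIV. \<Sum>k\<in>UNIV. ccomul C (bas i) $ (j, k) *s F (bas i \<otimes> aone B) (sect (bas j)) (sect (bas k)))"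
    by (simp only: sweedler_def)
  also have "\<dots> = (\<Sum>j\<in>UNIV. \<Sum>k\<in>UNIV. \<Sum>i\<in>UNIV. ccomul C (bas i) $ (j, k) *s F (bas i \<otimes> aone B) (sect (bas j)) (sect (bas k)))"
    by (subst sum.swap, rule sum.cong, rule refl, subst sum.swap, rule refl)
  also have "\<dots> = sweedler tau (\<lambda>p x. sweedler tau (\<lambda>q y. F (km p q) x y))"
    by (simp only: sweedler_tau l m linear_sum_pull[OF assms(1)] vec.linear_scale[OF assms(1)])
  finally show ?thesis ..
qed

text \<open>The cross relation of the smash product, seen on the canonical element: the coaction on
  \<open>f\<close> hidden in \<open>km (J b) p\<close> is dual to the action on \<open>C\<close>, so
  moving \<open>J b\<close> to the right of \<open>p\<close> multiplies the second leg by
  \<open>b1\<close>.\<close>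

lemma tau_J:
  assumes "\<And>b. klinear (\<lambda>a. F a b)" "\<And>a. klinear (\<lambda>b. F a b)"
    and "\<And>p x x'. \<pi> x = \<pi> x' \<Longrightarrow> F p x = F p x'" and "b \<in> Bs"
  shows "sweedler tau (\<lambda>p x. F (km (J b) p) x) = sweedler tau (\<lambda>p x. sw b (\<lambda>b1 b2. F (km p (J b2)) (x \<cdot> b1)))"
proof -
  obtain b' where b: "b = \<iota> b'" using assms(4) by blast
  note l = lin lin_compose[OF assms(1)] lin_compose[OF assms(2)] lin_compose[OF sect(1)]
  have s: "F p x = F p (sect (\<pi> x))" for p x using assms(3) sect(2) by metis
  have zi: "\<zeta> (\<iota> c) = c" for c
    using z_id[of "\<iota> c"] inj_iota by (simp add: z_def inj_eq)
  have 1: "F (km (J b) (bas j \<otimes> aone B)) x = sweedler (coact B b') (\<lambda>b1 b2. \<Sum>i\<in>UNIV.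
      act C (bas i) b1 $ j *s F (bas i \<otimes> b2) x)" for j x
  proof -
    have "F (km (J b) (bas j \<otimes> aone B)) x = sweedler (dual_coact C (bas j)) (\<lambda>f1 f2. sweedler (coact B b') (\<lambda>b1 b2. scalar_product f2 b1 *s F (f1 \<otimes> b2) x))"
    proof -
      have "km (J b) (bas j \<otimes> aone B) = sweedler (dual_coact C (bas j)) (\<lambda>f1 f2. sweedler (coact B b') (\<lambda>b1 b2. scalar_product f2 b1 *s (f1 \<otimes> b2)))"
      proof (rule ev_ext)
        fix h
        have "ev (km (J b) (bas j \<otimes> aone B)) h = sweedler (coact B b') (\<lambda>b1 b2. scalar_product (bas j) (act C (\<pi> h) b1) *s \<iota> b2)"
          unfolding b by (simp only: ev_km ev_J z_id[OF rangeI] sweedler_scale ev_pure iota_one scale mul_one sw_iota lin sw_counit pi_mul)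
        also have "\<dots> = sweedler (coact B b') (\<lambda>b1 b2. sweedler (dual_coact C (bas j)) (\<lambda>f1 f2. scalar_product f1 (\<pi> h) *s (scalar_product f2 b1 *s \<iota> b2)))"
          by (simp only: dual_coact_sp[OF bilinear_act])
        also have "\<dots> = ev (sweedler (dual_coact C (bas j)) (\<lambda>f1 f2. sweedler (coact B b') (\<lambda>b1 b2. scalar_product f2 b1 *s (f1 \<otimes> b2)))) h"
          by (subst sweedler_commute) (simp only: ev_pull ev_scale ev_pure vec.scale_left_commute)
        finally show "ev (km (J b) (bas j \<otimes> aone B)) h = \<dots>" .
      qed
      then show ?thesis
        by (simp only: linear_sweedler[OF assms(1)] vec.linear_scale[OF assms(1)])
    qed
    also have "\<dots> = sweedler (coact B b') (\<lambda>b1 b2. F (sweedler (dual_coact C (bas j)) (\<lambda>f1 f2. scalar_product f2 b1 *s f1) \<otimes> b2) x)"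
      by (subst sweedler_commute) (simp only: pull linear_sweedler[OF assms(1)] tensor_scale vec.linear_scale[OF assms(1)])
    also have "\<dots> = sweedler (coact B b') (\<lambda>b1 b2. \<Sum>i\<in>UNIV. act C (bas i) b1 $ j *s F (bas i \<otimes> b2) x)"
      by (subst sum_components[of "\<lambda>f. F (f \<otimes> b2) x" for b2 x], intro l) (simp only: dual_coact_sp' scalar_product_bas)
    finally show ?thesis .
  qed
  have "sweedler tau (\<lambda>p x. sw b (\<lambda>b1 b2. F (km p (J b2)) (x \<cdot> b1))) =
     (\<Sum>i\<in>UNIV. sweedler (coact B b') (\<lambda>b1 b2. F (bas i \<otimes> b2) (sect (bas i) \<cdot> b1)))"
    by (simp only: sweedler_tau l b sw_iota) (simp only: J_def zi km_IJ)
  also have "\<dots> = (\<Sum>i\<in>UNIV. sweedler (coact B b') (\<lambda>b1 b2. \<Sum>j\<in>UNIV. act C (bas i) b1 $ j *s F (bas i \<otimes> b2) (sect (bas j))))"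
    by (subst s, simp only: pi_mul sect(2), subst sum_components[of "\<lambda>x. F p (sect x)" for p], intro l, rule refl)
  also have "\<dots> = (\<Sum>j\<in>UNIV. sweedler (coact B b') (\<lambda>b1 b2. \<Sum>i\<in>UNIV. act C (bas i) b1 $ j *s F (bas i \<otimes> b2) (sect (bas j))))"
    by (simp only: sweedler_sum_commute) (rule sweedler_cong, rule sum.swap)
  also have "\<dots> = sweedler tau (\<lambda>p x. F (km (J b) p) x)"
    by (simp only: sweedler_tau l 1)
  finally show ?thesis ..
qed

lemma tau_one: "klinear F \<Longrightarrow> sweedler tau (\<lambda>p x. eps x *s F p) = F ku"
proof -
  assume F: "klinear F"
  have "sweedler tau (\<lambda>p x. eps x *s F p) = (\<Sum>j\<in>UNIV. scalar_product (cdual_one C) (bas j) *s F (bas j \<otimes> aone B))"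
    by (simp only: sweedler_tau lin lin_compose[OF F] sp_one_C'[symmetric] sect(2))
  also have "\<dots> = F ku"
    by (subst sum_components[of "\<lambda>f. F (f \<otimes> aone B)" "cdual_one C"], intro lin lin_compose[OF F]) (simp only: scalar_product_bas)
  finally show ?thesis .
qed

text \<open>Used from right to left to expand an arbitrary factor of a product, so that it enters
  later computations only through its values.\<close>

lemma tau_ev: "sweedler tau (\<lambda>p x. km p (J (ev F x))) = F"
proof -
  have zi: "\<zeta> (\<iota> c) = c" for c
    using z_id[of "\<iota> c"] inj_iota by (simp add: z_def inj_eq)
  have "sweedler tau (\<lambda>p x. km p (J (ev (f \<otimes> b) x))) = f \<otimes> b" for f b
  proof -
    have "sweedler tau (\<lambda>p x. km p (J (ev (f \<otimes> b) x))) = (\<Sum>j\<in>UNIV. scalar_product f (bas j) *s (bas j \<otimes> b))"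
      by (simp only: sweedler_tau lin ev_pure sect(2) J_pull vec.linear_scale[OF lin_km'(2)[OF lin_id]]) (simp only: J_def zi km_IJ)
    also have "\<dots> = f \<otimes> b"
      by (subst sum_components[of "\<lambda>f. f \<otimes> b" f], intro lin) (simp only: scalar_product_bas)
    finally show ?thesis .
  qed
  then show ?thesis
    by (rule_tac tensor_ext[of "\<lambda>F. sweedler tau (\<lambda>p x. km p (J (ev F x)))" "\<lambda>F. F"]; assumption?; intro lin)
qed

text \<open>The right action of \<open>C\<^sup>* # B\<close> on \<open>H\<close> for which \<open>T\<close> takes the form \<open>T_tau\<close>.\<close>

definition ra where "ra F h = sw h (\<lambda>h1 h2. h2 \<cdot> ev F h1)"

section \<open>The map \<open>T\<close> and its preantipode identities\<close>

abbreviation "T \<equiv> lpd_T H B C \<iota> \<pi> \<zeta>' \<gamma>'"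
abbreviation "ups \<equiv> lpd_upsilon B C \<zeta>' \<gamma>'"

lemma lin_ra [lin]: "klinear f \<Longrightarrow> klinear (\<lambda>x. ra (f x) h)" "klinear g \<Longrightarrow> klinear (\<lambda>x. ra F (g x))"
  unfolding ra_def by (intro lin; assumption)+

lemmas km_assoc = algebra_strD(2)[OF algebra_K]
lemmas km_unit [simp] = algebra_strD(3,4)[OF algebra_K]
lemmas km_pull = sweedler_pull_left[OF lin_km] sweedler_pull_right[OF lin_km]
lemmas km_scale = vec.linear_scale[OF lin_km'(1)[OF lin_id]] vec.linear_scale[OF lin_km'(2)[OF lin_id]]

lemmas norm3 = norm2 lin km_pull km_scale J_pull km_assoc

lemma J_zb: "J (zb h) = cdual_one C \<otimes> \<zeta>' h"
proof -
  have "\<zeta> (\<iota> c) = c" for c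
    using z_id[of "\<iota> c"] inj_iota by (simp add: z_def inj_eq)
  then show ?thesis by (simp add: J_def zb_def)
qed

lemma lin_T: "klinear T"
  unfolding lpd_T_def dual_bialg_def hit_def by (simp only: bialg.simps) (intro lin)

lemma hit_sp: "scalar_product (hit H h q) g *s v = scalar_product q (g \<cdot> h) *s v"
proof -
  have "scalar_product (hit H h q) g *s v = sweedler (dual_comul (mul H) q) (\<lambda>f1 f2. scalar_product f1 g *s (scalar_product f2 h *s v))"
    by (simp only: hit_def dual_bialg_def bialg.simps linear_sweedler[OF lin_scalar_product1[OF lin_id], of _ _ g v]
        scalar_product_left) (simp add: vec.scale_scale mult.commute)
  then show ?thesis by (simp only: dual_comul_sp[OF bilinear_mul])
qed

text \<open>Evaluating the functional in the definition of \<open>T\<close> at the element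
  \<open>g = \<gamma>' (bas j)\<close> gives \<open>f\<close> at \<open>\<pi> g1\<close> times the
  \<open>i\<close>-th coordinate of \<open>\<zeta>' (g2 \<cdot> \<iota> b)\<close>. Contracting the
  basis of \<open>B\<close> leaves \<open>zb\<close> of the right action of \<open>f # b\<close> on
  \<open>g\<close>.\<close>

lemma T_tau: "T F = sweedler tau (\<lambda>p x. km (J (zb (ra F (eb x)))) p)"
proof -
  have "T (f \<otimes> b) = sweedler tau (\<lambda>p x. km (J (zb (ra (f \<otimes> b) (eb x)))) p)" for f b
  proof -
    let ?X = "\<lambda>i. dual_mul (comul H) (dual_map \<pi> f) (hit H (\<iota> b) (dual_map \<zeta>' (bas i)))"
    have "T (f \<otimes> b) = (\<Sum>i\<in>UNIV. km (cdual_one C \<otimes> bas i) (dual_map \<gamma>' (?X i) \<otimes> aone B))"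
      unfolding lpd_T_def dual_bialg_def hit_def by (simp only: bialg.simps sweedler_pure lin)
    also have "\<dots> = (\<Sum>i\<in>UNIV. \<Sum>j\<in>UNIV. scalar_product (dual_map \<gamma>' (?X i)) (bas j) *s km (cdual_one C \<otimes> bas i) (bas j \<otimes> aone B))"
      by (subst sum_components[of "\<lambda>f. km (cdual_one C \<otimes> bas i) (f \<otimes> aone B)" for i], intro lin) (simp only: scalar_product_bas)
    also have "\<dots> = (\<Sum>i\<in>UNIV. \<Sum>j\<in>UNIV. sw (\<gamma>' (bas j)) (\<lambda>g1 g2. scalar_product f (\<pi> g1) *s (scalar_product (bas i) (\<zeta>' (g2 \<cdot> \<iota> b)) *s km (cdual_one C \<otimes> bas i) (bas j \<otimes> aone B))))"
      by (simp only: scalar_product_dual_map[OF linear_gamma'] dual_mul_sp[OF linear_comul] hit_sp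
          scalar_product_dual_map[OF linear_zeta'] scalar_product_dual_map[OF linear_pi])
    also have "\<dots> = (\<Sum>j\<in>UNIV. \<Sum>i\<in>UNIV. sw (\<gamma>' (bas j)) (\<lambda>g1 g2. scalar_product f (\<pi> g1) *s (scalar_product (bas i) (\<zeta>' (g2 \<cdot> \<iota> b)) *s km (cdual_one C \<otimes> bas i) (bas j \<otimes> aone B))))"
      by (rule sum.swap)
    also have "\<dots> = (\<Sum>j\<in>UNIV. sw (\<gamma>' (bas j)) (\<lambda>g1 g2. scalar_product f (\<pi> g1) *s km (cdual_one C \<otimes> \<zeta>' (g2 \<cdot> \<iota> b)) (bas j \<otimes> aone B)))"
    proof -
      have 1: "(\<Sum>i\<in>UNIV. scalar_product (bas i) u *s km (cdual_one C \<otimes> bas i) p) = km (cdual_one C \<otimes> u) p" for u p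
        by (rule sum_basis[of "\<lambda>u. km (cdual_one C \<otimes> u) p"]) (intro lin)
      show ?thesis by (simp only: sweedler_sum_commute vec.scale_sum_right[symmetric] 1)
    qed
    also have "\<dots> = sweedler tau (\<lambda>p x. km (J (zb (ra (f \<otimes> b) (eb x)))) p)"
      by (simp only: sweedler_tau lin) (simp only: ra_def pull ev_pure scale J_pull km_pull km_scale J_zb eb_def sect(2))
    finally show ?thesis .
  qed
  then show ?thesis
    by (rule_tac tensor_ext[of T]; assumption?; intro lin lin_T)
qed

lemma ups_tau: "ups = sweedler tau (\<lambda>p x. km (J (zb (eb x))) p)"
proof -
  have 1: "(\<Sum>i\<in>UNIV. scalar_product (bas i) u *s km (cdual_one C \<otimes> bas i) p) = km (cdual_one C \<otimes> u) p" for u p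
    by (rule sum_basis[of "\<lambda>u. km (cdual_one C \<otimes> u) p"]) (intro lin)
  have "ups = (\<Sum>i\<in>UNIV. \<Sum>j\<in>UNIV. scalar_product (dual_map \<gamma>' (dual_map \<zeta>' (bas i))) (bas j) *s km (cdual_one C \<otimes> bas i) (bas j \<otimes> aone B))"
    unfolding lpd_upsilon_def
    by (subst sum_components[of "\<lambda>f. km (cdual_one C \<otimes> bas i) (f \<otimes> aone B)" for i], intro lin) (simp only: scalar_product_bas)
  also have "\<dots> = (\<Sum>j\<in>UNIV. \<Sum>i\<in>UNIV. scalar_product (bas i) (\<zeta>' (\<gamma>' (bas j))) *s km (cdual_one C \<otimes> bas i) (bas j \<otimes> aone B))"
    by (simp only: scalar_product_dual_map[OF linear_gamma'] scalar_product_dual_map[OF linear_zeta']) (rule sum.swap)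
  also have "\<dots> = sweedler tau (\<lambda>p x. km (J (zb (eb x))) p)"
    by (simp only: sweedler_tau lin 1) (simp only: J_zb eb_def sect(2))
  finally show ?thesis .
qed

lemma T_one: "T ku = ups"
proof -
  have "ra ku h = h" for h by (simp add: ra_def ev_ku mul_scale sw_counit lin)
  then show ?thesis by (simp only: T_tau ups_tau)
qed

lemma J_B: "b \<in> Bs \<Longrightarrow> sw b (\<lambda>b1 b2. km (J (zb (b1 \<cdot> h))) (km (J b2) p)) = eps b *s km (J (zb h)) p"
proof -
  assume b: "b \<in> Bs"
  have "sw b (\<lambda>b1 b2. km (J (zb (b1 \<cdot> h))) (km (J b2) p)) = sw b (\<lambda>b1 b2. km (J (zb (b1 \<cdot> h) \<cdot> b2)) p)"
    by (rule sw_cong_B[OF b]) (simp add: J_mul[symmetric] Bs_closed km_assoc, (intro lin)+)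
  also have "\<dots> = km (J (sw b (\<lambda>b1 b2. zb (b1 \<cdot> h) \<cdot> b2))) p"
    by (simp only: J_pull km_pull)
  finally show ?thesis by (simp only: zb_mul[OF b] J_pull km_scale)
qed

lemma km_T_left: "km (T F) G = sweedler tau (\<lambda>p x. sweedler tau (\<lambda>q y. km (J (zb (ra F (eb x)))) (km (km p q) (J (ev G y)))))"
proof -
  have "km (T F) G = km (T F) (sweedler tau (\<lambda>q y. km q (J (ev G y))))" by (simp only: tau_ev)
  also have "\<dots> = sweedler tau (\<lambda>p x. sweedler tau (\<lambda>q y. km (J (zb (ra F (eb x)))) (km (km p q) (J (ev G y)))))"
    by (simp only: T_tau km_pull km_assoc) (rule sweedler_commute)
  finally show ?thesis .
qed

lemma km_T_right: "km G (T F) = sweedler tau (\<lambda>p x. sweedler tau (\<lambda>q y. km (km p (J (ev G x))) (km (J (zb (ra F (eb y)))) q)))"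
proof -
  have "km G (T F) = km (sweedler tau (\<lambda>q y. km q (J (ev G y)))) (T F)" by (simp only: tau_ev)
  also have "\<dots> = sweedler tau (\<lambda>p x. sweedler tau (\<lambda>q y. km (km p (J (ev G x))) (km (J (zb (ra F (eb y)))) q)))"
    by (simp only: T_tau km_pull) (rule sweedler_commute)
  finally show ?thesis .
qed

text \<open>Extends \<open>J_B\<close> past the action of \<open>G\<close>: the leg of
  \<open>b\<close> that reaches the argument of \<open>ev G\<close> counts only through
  \<open>eps\<close>, so the other legs are free for \<open>J_B\<close>.\<close>

lemma J_ra_B: "b \<in> Bs \<Longrightarrow> sw b (\<lambda>b1 b2. km (J (zb (ra G (b1 \<cdot> h)))) (km (J b2) p)) = eps b *s km (J (zb (ra G h))) p"
proof -
  assume b: "b \<in> Bs"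
  have "sw b (\<lambda>b1 b2. km (J (zb (ra G (b1 \<cdot> h)))) (km (J b2) p)) =
    sw h (\<lambda>h1 h2. sw b (\<lambda>b1 b'. sw b' (\<lambda>b2 b3. km (J (zb (b2 \<cdot> (h2 \<cdot> ev G (b1 \<cdot> h1))))) (km (J b3) p))))"
    apply (simp add: ra_def norm3)
    apply (simp only: sweedler_swap[where s = "comul H h"])
    done
  also have "\<dots> = sw h (\<lambda>h1 h2. sw b (\<lambda>b1 b'. eps b' *s km (J (zb (h2 \<cdot> ev G (b1 \<cdot> h1)))) p))"
    by (rule sweedler_cong, rule sw_cong_B[OF b]) (simp add: J_B, (intro lin)+)
  also have "\<dots> = sw h (\<lambda>h1 h2. km (J (zb (h2 \<cdot> ev G (b \<cdot> h1)))) p)"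
    by (simp only: sw_counit lin)
  also have "\<dots> = eps b *s km (J (zb (ra G h))) p"
    by (simp only: ev_B_mul[OF b] ra_def) (simp only: ze_pull J_pull km_pull scale ze_scale km_scale scale_sweedler)
  finally show ?thesis .
qed

lemma ra_km: "ra (km F G) h = ra G (ra F h)"
  by (simp add: ra_def ev_km norm2)

text \<open>All legs are expressed by values. Cancelling \<open>eb\<close> against \<open>e\<close>
  makes \<open>F\<close> appear only at \<open>one H\<close>; its value is an element of
  \<open>Bs\<close> whose legs are then gathered by \<open>tau_J\<close> and absorbed by
  \<open>J_ra_B\<close>, leaving its counit.\<close>

lemma T_left: "sweedler (kd F) (\<lambda>F1 F2. km (T (km F1 G)) F2) = kc F *s T G"
proof -
  define W where "W h = J (zb (ra G h))" for h
  have lW [lin]: "klinear f \<Longrightarrow> klinear (\<lambda>x. W (f x))" for f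
    unfolding W_def by (intro lin)
  have W_pull: "W (sweedler t F) = sweedler t (\<lambda>a b. W (F a b))" "W (c *s h) = c *s W h" for t F c h
    by (rule linear_sweedler vec.linear_scale; intro lin)+
  have "sweedler (kd F) (\<lambda>F1 F2. km (T (km F1 G)) F2) =
    sweedler tau (\<lambda>p x. sweedler tau (\<lambda>q y. sw (eb x) (\<lambda>k1 k2. sweedler (kd F) (\<lambda>F1 F2. km (W (k2 \<cdot> ev F1 k1)) (km (km p q) (J (ev F2 y)))))))"
    by (simp only: km_T_left ra_km W_def[symmetric]) (simp only: ra_def[of F1 for F1] W_pull km_pull sweedler_swap[where s = "kd F"])
  also have "\<dots> = sweedler tau (\<lambda>p x. sweedler tau (\<lambda>q y. sw (eb x) (\<lambda>k1 k2. sw (e y) (\<lambda>g1 g2. sw (ev F (k1 \<cdot> g1)) (\<lambda>c1 c2.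
      km (W (k2 \<cdot> z (g2 \<cdot> c1))) (km (km p q) (J c2)))))))"
    by (simp only: sweedler_kd[where F = "\<lambda>a b. km (W (k2 \<cdot> a)) (km r (J b))" for k2 r] lin)
  also have "\<dots> = sweedler tau (\<lambda>p x. sw x (\<lambda>x1 x2. sw (eb x1) (\<lambda>k1 k2. sw (e x2) (\<lambda>g1 g2. sw (ev F (k1 \<cdot> g1)) (\<lambda>c1 c2.
      km (W (k2 \<cdot> z (g2 \<cdot> c1))) (km p (J c2)))))))"
    by (rule tau_mul; (intro lin)?; simp add: e_def eb_def)
  \<comment> \<open>Expanding \<open>z\<close> as \<open>id * eb\<close> places the leg
    \<open>g3\<close> under \<open>eb\<close>, hence under \<open>\<pi>\<close>, so that colinearity
    of \<open>\<gamma>\<close> can be applied backwards.\<close>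
  also have "\<dots> = sweedler tau (\<lambda>p x. sw x (\<lambda>x1 x2. sw (eb x1) (\<lambda>k1 k2. sw (e x2) (\<lambda>g1 g2. sw (ev F (k1 \<cdot> g1)) (\<lambda>c1 c2.
      km (W (k2 \<cdot> sw (g2 \<cdot> c1) (\<lambda>u1 u2. u1 \<cdot> eb u2))) (km p (J c2)))))))"
    by (simp only: z_eb)
  also have "\<dots> = sweedler tau (\<lambda>p x. sw x (\<lambda>x1 x2. sw (e x2) (\<lambda>g g3. sw g (\<lambda>g1 g2. sw (eb x1) (\<lambda>k1 k2. sw (ev F (k1 \<cdot> g1)) (\<lambda>c1 c. sw c (\<lambda>c2 c3.
      km (W (k2 \<cdot> (g2 \<cdot> (c1 \<cdot> eb (g3 \<cdot> c2))))) (km p (J c3)))))))))"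
    apply (simp add: norm3 lin W_pull)
    apply (simp only: sweedler_swap[where s = "comul H (eb x)" for x])
    done
  also have "\<dots> = sweedler tau (\<lambda>p x. sw x (\<lambda>x1 x'. sw x' (\<lambda>x2 x3. sw (e x2) (\<lambda>g1 g2. sw (eb x1) (\<lambda>k1 k2. sw (ev F (k1 \<cdot> g1)) (\<lambda>c1 c. sw c (\<lambda>c2 c3.
      km (W (k2 \<cdot> (g2 \<cdot> (c1 \<cdot> eb (x3 \<cdot> c2))))) (km p (J c3)))))))))"
    by (rule sweedler_cong, rule sweedler_cong, rule sw_e[symmetric]; (intro lin)?; simp add: eb_def pi_mul)
  \<comment> \<open>Now \<open>eb x1\<close> and \<open>e x2\<close> stand next to each other under
    one coproduct and cancel.\<close>
  also have "\<dots> = sweedler tau (\<lambda>p x. sw x (\<lambda>x' x3. sw (sw x' (\<lambda>x1 x2. eb x1 \<cdot> e x2)) (\<lambda>t1 t2. sw (ev F t1) (\<lambda>c1 c. sw c (\<lambda>c2 c3.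
      km (W (t2 \<cdot> (c1 \<cdot> eb (x3 \<cdot> c2)))) (km p (J c3)))))))"
    apply (simp add: norm3 lin W_pull)
    apply (simp only: sweedler_swap[where s = "comul H (eb x)" for x])
    done
  also have "\<dots> = sweedler tau (\<lambda>p x. sw (ev F (one H)) (\<lambda>c1 c. sw c (\<lambda>c2 c3. km (W (c1 \<cdot> eb (x \<cdot> c2))) (km p (J c3)))))"
    by (simp only: sw_eb_e scale sw_one lin mul_one sw_counit)
  also have "\<dots> = sw (ev F (one H)) (\<lambda>c1 c. sweedler tau (\<lambda>p x. sw c (\<lambda>c2 c3. km (W (c1 \<cdot> eb (x \<cdot> c2))) (km p (J c3)))))"
    by (rule sweedler_commute)
  also have "\<dots> = sw (ev F (one H)) (\<lambda>c1 c. sweedler tau (\<lambda>p x. km (W (c1 \<cdot> eb x)) (km (J c) p)))"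
    by (rule sw_cong_B[OF ev_Bs], rule tau_J[symmetric]; (intro lin)?; simp add: eb_def)
  also have "\<dots> = sweedler tau (\<lambda>p x. eps (ev F (one H)) *s km (W (eb x)) p)"
    by (subst sweedler_commute) (simp only: J_ra_B[OF ev_Bs, where G = G, folded W_def])
  also have "\<dots> = kc F *s T G"
    by (simp only: kc_eq T_tau W_def scale_sweedler)
  finally show ?thesis .
qed

text \<open>After \<open>core\<close> the value of \<open>F\<close> survives only through its
  counit. The element \<open>zb l\<close> of \<open>Bs\<close> is moved in front by
  \<open>tau_J\<close>, and \<open>sw_eb\<close> then frees the argument of \<open>F\<close> of
  everything except a leg in \<open>Bs\<close>, which counts only through
  \<open>eps\<close>.\<close>

lemma T_right: "sweedler (kd F) (\<lambda>F1 F2. km F1 (T (km G F2))) = kc F *s T G"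
proof -
  \<comment> \<open>Writing \<open>e\<close> as \<open>zb * id\<close> creates a factor in
    \<open>Bs\<close> that \<open>z_mul\<close> extracts from \<open>z\<close>; what stays behind is
    \<open>z t1 \<cdot> zb t2\<close>, which cancels.\<close>
  have core: "sw k (\<lambda>k1 k2. sw (e k1) (\<lambda>g1 g2. sw (ev F (x \<cdot> g1)) (\<lambda>c1 c2. z (g2 \<cdot> c1) \<cdot> zb (k2 \<cdot> c2)))) =
     sw k (\<lambda>l k1. sw (zb l) (\<lambda>s1 s2. eps (ev F (x \<cdot> (s1 \<cdot> k1))) *s s2))" for k x
  proof -
    have "sw k (\<lambda>k1 k2. sw (e k1) (\<lambda>g1 g2. sw (ev F (x \<cdot> g1)) (\<lambda>c1 c2. z (g2 \<cdot> c1) \<cdot> zb (k2 \<cdot> c2)))) =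
      sw k (\<lambda>k1 k2. sw (sw k1 (\<lambda>a b. zb a \<cdot> b)) (\<lambda>g1 g2. sw (ev F (x \<cdot> g1)) (\<lambda>c1 c2. z (g2 \<cdot> c1) \<cdot> zb (k2 \<cdot> c2))))"
      by (simp only: e_zb)
    also have "\<dots> = sw k (\<lambda>l k'. sw (zb l) (\<lambda>s1 s2. sw k' (\<lambda>a k''. sw k'' (\<lambda>b k2. sw (ev F (x \<cdot> (s1 \<cdot> a))) (\<lambda>c1 c2. z (s2 \<cdot> (b \<cdot> c1)) \<cdot> zb (k2 \<cdot> c2))))))"
      by (simp add: norm2)
    also have "\<dots> = sw k (\<lambda>l k'. sw (zb l) (\<lambda>s1 s2. sw k' (\<lambda>a k''. sw k'' (\<lambda>b k2. sw (ev F (x \<cdot> (s1 \<cdot> a))) (\<lambda>c1 c2. s2 \<cdot> (z (b \<cdot> c1) \<cdot> zb (k2 \<cdot> c2)))))))"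
      by (rule sweedler_cong, rule sw_cong_B[OF Bs_closed(2)]) (simp add: z_mul mul_assoc, (intro lin)+)
    also have "\<dots> = sw k (\<lambda>l k'. sw (zb l) (\<lambda>s1 s2. sw k' (\<lambda>a k''. s2 \<cdot> sw (k'' \<cdot> ev F (x \<cdot> (s1 \<cdot> a))) (\<lambda>t1 t2. z t1 \<cdot> zb t2))))"
      by (simp add: norm2)
    also have "\<dots> = sw k (\<lambda>l k1. sw (zb l) (\<lambda>s1 s2. eps (ev F (x \<cdot> (s1 \<cdot> k1))) *s s2))"
      by (simp only: sw_z_zb scale mul_one eps_mul vec.scale_scale[symmetric] sw_counit lin)
    finally show ?thesis .
  qed
  define R where "R y = ra G (eb y)" for y
  have lR [lin]: "klinear f \<Longrightarrow> klinear (\<lambda>x. R (f x))" for f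
    unfolding R_def by (intro lin)
  have "sweedler (kd F) (\<lambda>F1 F2. km F1 (T (km G F2))) =
    sweedler tau (\<lambda>p x. sweedler tau (\<lambda>q y. sw (R y) (\<lambda>k1 k2. sweedler (kd F) (\<lambda>F1 F2. km (km p (J (ev F1 x))) (km (J (zb (k2 \<cdot> ev F2 k1))) q)))))"
    by (simp only: km_T_right ra_km R_def[symmetric]) (simp only: ra_def[of F1 for F1] ze_pull J_pull km_pull sweedler_swap[where s = "kd F"])
  also have "\<dots> = sweedler tau (\<lambda>p x. sweedler tau (\<lambda>q y. sw (R y) (\<lambda>k1 k2. sw (e k1) (\<lambda>g1 g2. sw (ev F (x \<cdot> g1)) (\<lambda>c1 c2.
      km (km p (J (z (g2 \<cdot> c1)))) (km (J (zb (k2 \<cdot> c2))) q))))))"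
    by (simp only: sweedler_kd[where F = "\<lambda>a b. km (km p (J a)) (km (J (zb (k2 \<cdot> b))) q)" for k2 p q] lin)
  also have "\<dots> = sweedler tau (\<lambda>p x. sweedler tau (\<lambda>q y. km p (km (J (sw (R y) (\<lambda>k1 k2. sw (e k1) (\<lambda>g1 g2. sw (ev F (x \<cdot> g1)) (\<lambda>c1 c2.
      z (g2 \<cdot> c1) \<cdot> zb (k2 \<cdot> c2)))))) q)))"
    by (simp only: J_pull km_pull J_mul[symmetric] Bs_closed km_assoc)
  also have "\<dots> = sweedler tau (\<lambda>p x. sweedler tau (\<lambda>q y. sw (R y) (\<lambda>l k. sw (zb l) (\<lambda>s1 s2. eps (ev F ((x \<cdot> s1) \<cdot> k)) *s km (km p (J s2)) q))))"
    by (simp only: core J_pull km_pull km_scale km_assoc mul_assoc)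
  also have "\<dots> = sweedler tau (\<lambda>q y. sw (R y) (\<lambda>l k. sweedler tau (\<lambda>p x. sw (zb l) (\<lambda>s1 s2. eps (ev F ((x \<cdot> s1) \<cdot> k)) *s km (km p (J s2)) q))))"
    by (subst sweedler_commute, rule sweedler_cong, rule sweedler_commute)
  also have "\<dots> = sweedler tau (\<lambda>q y. sw (R y) (\<lambda>l k. sweedler tau (\<lambda>p x. eps (ev F (x \<cdot> k)) *s km (km (J (zb l)) p) q)))"
    by (rule sweedler_cong, rule sweedler_cong, rule tau_J[symmetric]; (intro lin Bs_closed)?; simp add: ev_def pi_mul)
  also have "\<dots> = sweedler tau (\<lambda>p x. sweedler tau (\<lambda>q y. sw (R y) (\<lambda>l k. eps (ev F (x \<cdot> k)) *s km (J (zb l)) (km p q))))"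
    by (subst (2) sweedler_commute, rule sweedler_cong) (simp only: km_assoc sweedler_swap[where s = "comul H (R x)" for x])
  also have "\<dots> = sweedler tau (\<lambda>p x. sw x (\<lambda>x1 x2. sw (R x2) (\<lambda>l k. eps (ev F (x1 \<cdot> k)) *s km (J (zb l)) p)))"
    by (rule tau_mul; (intro lin)?; simp add: ev_def R_def eb_def pi_mul)
  also have "\<dots> = sweedler tau (\<lambda>p x. sw x (\<lambda>x1 x2. sw (eb x2) (\<lambda>a b. sw a (\<lambda>k1 k2. sw (ev G k1) (\<lambda>c1 c2.
      eps (ev F ((x1 \<cdot> b) \<cdot> c2)) *s km (J (zb (k2 \<cdot> c1))) p)))))"
    by (simp add: R_def ra_def norm3)
  also have "\<dots> = sweedler tau (\<lambda>p x. sw (eb x) (\<lambda>k1 k2. sw (ev G k1) (\<lambda>c1 c2. eps (ev F (one H \<cdot> c2)) *s km (J (zb (k2 \<cdot> c1))) p)))"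
    by (rule sweedler_cong, rule sw_eb; (intro lin)?; simp add: ev_def pi_mul)
  also have "\<dots> = sweedler tau (\<lambda>p x. sw (eb x) (\<lambda>k1 k2. sw (ev G k1) (\<lambda>c1 c2. eps c2 *s (eps (ev F (one H)) *s km (J (zb (k2 \<cdot> c1))) p))))"
  proof (rule sweedler_cong, rule sweedler_cong, rule sw_cong_B[OF ev_Bs])
    fix p k2 c1 c2 assume "c2 \<in> Bs"
    then show "eps (ev F (one H \<cdot> c2)) *s km (J (zb (k2 \<cdot> c1))) p = eps c2 *s (eps (ev F (one H)) *s km (J (zb (k2 \<cdot> c1))) p)"
      using ev_B_mul[of c2 F "one H"] by (simp add: eps_scale vec.scale_scale)
  qed (intro lin)+
  also have "\<dots> = kc F *s T G"
    by (simp only: sw_counit lin kc_eq T_tau ra_def) (simp only: ze_pull J_pull km_pull scale_sweedler)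
  finally show ?thesis .
qed

lemma sweedler3_commute:
  "sweedler3 t (\<lambda>a b c. sweedler s (\<lambda>x y. F a b c x y)) = sweedler s (\<lambda>x y. sweedler3 t (\<lambda>a b c. F a b c x y))"
  unfolding sweedler3_def by (subst sweedler_commute, rule sweedler_commute[THEN trans]) (rule refl)

lemma sweedler3_ev:
  assumes "\<And>b c. klinear (\<lambda>a. F a b c)" "\<And>a c. klinear (\<lambda>b. F a b c)" "\<And>a b. klinear (\<lambda>c. F a b c)"
  shows "sweedler3 t (\<lambda>a b c. F (ev a x) (ev b y) (ev c w)) = sweedler3 (ev3 t (x \<otimes> y \<otimes> w)) F"
  unfolding sweedler3_def by (rule sweedler_ev3[OF assms])

text \<open>As in \<open>T_right\<close>, expanding \<open>e\<close> as \<open>zb * id\<close> lets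
  \<open>z\<close> cancel against \<open>zb\<close>; the leftover factor in \<open>Bs\<close> is
  absorbed by \<open>zb_mul\<close>. This leaves \<open>zb (eb x \<cdot> e y)\<close>, and
  \<open>tau_mul\<close> puts \<open>x\<close> and \<open>y\<close> on the legs of one element,
  where \<open>eb\<close> and \<open>e\<close> cancel.\<close>

lemma T_assoc: "sweedler3 kphi (\<lambda>a b c. km (km a (T b)) c) = ku"
proof -
  have core: "sw k (\<lambda>k1 k2. sw (e k1) (\<lambda>g1 g2. sw h (\<lambda>l1 l2. sw (z l2) (\<lambda>c1 c2. zb (g1 \<cdot> l1) \<cdot> (z (g2 \<cdot> c1) \<cdot> zb (k2 \<cdot> c2)))))) = zb (k \<cdot> h)" for k h
  proof -
    have "sw k (\<lambda>k1 k2. sw (e k1) (\<lambda>g1 g2. sw h (\<lambda>l1 l2. sw (z l2) (\<lambda>c1 c2. zb (g1 \<cdot> l1) \<cdot> (z (g2 \<cdot> c1) \<cdot> zb (k2 \<cdot> c2)))))) =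
      sw k (\<lambda>k1 k2. sw (sw k1 (\<lambda>a b. zb a \<cdot> b)) (\<lambda>g1 g2. sw h (\<lambda>l1 l2. sw (z l2) (\<lambda>c1 c2. zb (g1 \<cdot> l1) \<cdot> (z (g2 \<cdot> c1) \<cdot> zb (k2 \<cdot> c2))))))"
      by (simp only: e_zb)
    also have "\<dots> = sw k (\<lambda>l k'. sw (zb l) (\<lambda>s1 s2. sw k' (\<lambda>a k''. sw k'' (\<lambda>b k2. sw h (\<lambda>l1 l2. sw (z l2) (\<lambda>c1 c2. zb (s1 \<cdot> (a \<cdot> l1)) \<cdot> (z (s2 \<cdot> (b \<cdot> c1)) \<cdot> zb (k2 \<cdot> c2))))))))"
      by (simp add: norm2)
    also have "\<dots> = sw k (\<lambda>l k'. sw (zb l) (\<lambda>s1 s2. sw k' (\<lambda>a k''. sw k'' (\<lambda>b k2. sw h (\<lambda>l1 l2. sw (z l2) (\<lambda>c1 c2. zb (s1 \<cdot> (a \<cdot> l1)) \<cdot> (s2 \<cdot> (z (b \<cdot> c1) \<cdot> zb (k2 \<cdot> c2)))))))))"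
      by (rule sweedler_cong, rule sw_cong_B[OF Bs_closed(2)]) (simp add: z_mul mul_assoc, (intro lin)+)
    also have "\<dots> = sw k (\<lambda>l k'. sw (zb l) (\<lambda>s1 s2. sw h (\<lambda>l1 l2. sw k' (\<lambda>a k''. zb (s1 \<cdot> (a \<cdot> l1)) \<cdot> (s2 \<cdot> sw (k'' \<cdot> z l2) (\<lambda>t1 t2. z t1 \<cdot> zb t2))))))"
      apply (simp only: sweedler_swap[where s = "comul H h"])
      apply (simp add: norm2)
      apply (simp only: sweedler_swap[where s = "comul H h"])
      done
    also have "\<dots> = sw k (\<lambda>l a. sw (zb l) (\<lambda>s1 s2. zb (s1 \<cdot> (a \<cdot> h)) \<cdot> s2))"
      by (simp only: sw_z_zb scale mul_one eps_mul eps_z vec.scale_scale[symmetric] scale_sweedler[symmetric] sw_counit lin)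
    also have "\<dots> = zb (k \<cdot> h)"
      by (simp only: zb_mul[OF Bs_closed(2)] eps_zb sw_counit lin)
    finally show ?thesis .
  qed
  have expand: "km (km a (T b)) c = sweedler tau (\<lambda>r w. sweedler tau (\<lambda>p x. sweedler tau (\<lambda>q y. sw (eb x) (\<lambda>k1 k2.
     km r (km (J (ev a w)) (km (J (zb (k2 \<cdot> ev b k1))) (km (km p q) (J (ev c y)))))))))" for a b c
  proof -
    have "km (km a (T b)) c = km (sweedler tau (\<lambda>r w. km r (J (ev a w)))) (km (T b) c)"
      by (simp only: tau_ev km_assoc)
    also have "\<dots> = sweedler tau (\<lambda>r w. km r (km (J (ev a w)) (km (T b) c)))"
      by (simp only: sweedler_pull_left[OF lin_km] km_assoc)
    also have "\<dots> = sweedler tau (\<lambda>r w. sweedler tau (\<lambda>p x. sweedler tau (\<lambda>q y. sw (eb x) (\<lambda>k1 k2.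
     km r (km (J (ev a w)) (km (J (zb (k2 \<cdot> ev b k1))) (km (km p q) (J (ev c y)))))))))"
      by (simp only: km_T_left ra_def ze_pull J_pull km_pull)
    finally show ?thesis .
  qed
  define W where "W = sweedler tau (\<lambda>p x. sweedler tau (\<lambda>q y. km (J (sw (eb x) (\<lambda>k1 k2. sw (e k1) (\<lambda>g1 g2. sw (e y) (\<lambda>l1 l2. sw (z l2) (\<lambda>c1 c2. zb (g1 \<cdot> l1) \<cdot> (z (g2 \<cdot> c1) \<cdot> zb (k2 \<cdot> c2)))))))) (km p q)))"
  have "sweedler3 kphi (\<lambda>a b c. km (km a (T b)) c) = sweedler tau (\<lambda>r w. sweedler tau (\<lambda>p x. sweedler tau (\<lambda>q y. sw (eb x) (\<lambda>k1 k2.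
     sweedler3 (ev3 kphi (w \<otimes> k1 \<otimes> y)) (\<lambda>u v t. km r (km (J u) (km (J (zb (k2 \<cdot> v))) (km (km p q) (J t)))))))))"
    by (simp only: expand sweedler3_commute
        sweedler3_ev[where F = "\<lambda>u v t. km r (km (J u) (km (J (zb (k2 \<cdot> v))) (km r' (J t))))" for r k2 r'] lin)
  also have "\<dots> = sweedler tau (\<lambda>r w. eps w *s km r W)"
    by (simp only: ev_kphi sweedler3_def sweedler_scale sweedler_sweedler sweedler_pure lin J_one km_unit W_def km_pull J_pull scale_sweedler)
       (simp only: J_mul[symmetric] Bs_closed km_assoc)
  also have "\<dots> = W"
    by (subst tau_one, intro lin) simp
  also have "\<dots> = sweedler tau (\<lambda>p x. sweedler tau (\<lambda>q y. km (J (zb (eb x \<cdot> e y))) (km p q)))"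
    by (simp only: W_def core)
  also have "\<dots> = sweedler tau (\<lambda>p x. sw x (\<lambda>x1 x2. km (J (zb (eb x1 \<cdot> e x2))) p))"
    by (rule tau_mul; (intro lin)?; simp add: e_def eb_def)
  also have "\<dots> = sweedler tau (\<lambda>p x. km (J (zb (sw x (\<lambda>x1 x2. eb x1 \<cdot> e x2)))) p)"
    by (simp only: ze_pull J_pull km_pull)
  also have "\<dots> = sweedler tau (\<lambda>p x. eps x *s p)"
    by (simp only: sw_eb_e ze_scale zb_one J_pull J_one km_scale km_unit)
  also have "\<dots> = ku"
    by (rule tau_one) (intro lin)
  finally show ?thesis .
qed

text \<open>In \<open>core1\<close> the expansion \<open>z = id * eb\<close> cancels
  \<open>eb\<close> against \<open>e\<close>; in \<open>core2\<close> the expansion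
  \<open>e = zb * id\<close> cancels \<open>z\<close> against \<open>zb\<close>. The element of
  \<open>Bs\<close> released by \<open>core2\<close> passes through the canonical element by
  \<open>tau_J\<close> and is absorbed by \<open>J_B\<close>, and \<open>sw_eb\<close> reduces the
  inner \<open>eb\<close> to its value at \<open>one H\<close>.\<close>

lemma T_assoc_inv: "sweedler3 kphi' (\<lambda>a b c. km (km (T a) b) (T c)) = ups"
proof -
  have core1: "sw x (\<lambda>x1 x2. eb x1 \<cdot> z (e x2 \<cdot> l)) = sw l (\<lambda>l1 l2. l1 \<cdot> eb (x \<cdot> l2))" for x l
  proof -
    have "sw x (\<lambda>x1 x2. eb x1 \<cdot> z (e x2 \<cdot> l)) = sw x (\<lambda>x1 x2. eb x1 \<cdot> sw (e x2 \<cdot> l) (\<lambda>u1 u2. u1 \<cdot> eb u2))"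
      by (simp only: z_eb)
    also have "\<dots> = sw x (\<lambda>x1 x2. sw (e x2) (\<lambda>g g3. sw l (\<lambda>l1 l2. eb x1 \<cdot> (g \<cdot> (l1 \<cdot> eb (g3 \<cdot> l2))))))"
      by (simp only: sw_mul lin pull mul_assoc)
    also have "\<dots> = sw x (\<lambda>x1 x'. sw x' (\<lambda>x2 x3. sw l (\<lambda>l1 l2. eb x1 \<cdot> (e x2 \<cdot> (l1 \<cdot> eb (x3 \<cdot> l2))))))"
      by (rule sweedler_cong, rule sw_e[symmetric]; (intro lin)?; simp add: eb_def pi_mul)
    also have "\<dots> = sw l (\<lambda>l1 l2. sw x (\<lambda>x' x3. sw x' (\<lambda>x1 x2. eb x1 \<cdot> e x2) \<cdot> (l1 \<cdot> eb (x3 \<cdot> l2))))"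
      apply (simp only: sweedler_swap[where t = "comul H l"])
      apply (simp only: pull sw_coassoc lin mul_assoc)
      done
    also have "\<dots> = sw l (\<lambda>l1 l2. l1 \<cdot> eb (x \<cdot> l2))"
      by (simp only: sw_eb_e scale mul_one sw_counit lin)
    finally show ?thesis .
  qed
  have core2: "sw m (\<lambda>m1 m2. sw (e m1) (\<lambda>l l3. sw l (\<lambda>l1 l2. V l1 l2 (z l3 \<cdot> zb m2)))) =
     sw m (\<lambda>l m'. sw m' (\<lambda>a b. sw (zb l) (\<lambda>s1 s'. sw s' (\<lambda>s2 s3. V (s1 \<cdot> a) (s2 \<cdot> b) s3))))"
    if V: "\<And>b c. klinear (\<lambda>a. V a b c)" "\<And>a c. klinear (\<lambda>b. V a b c)" "\<And>a b. klinear (\<lambda>c. V a b c)" for m V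
  proof -
    note l = lin lin_compose[OF V(1)] lin_compose[OF V(2)] lin_compose[OF V(3)]
      and p = linear_sweedler[OF V(1)] linear_sweedler[OF V(2)] linear_sweedler[OF V(3)]
      and sc = vec.linear_scale[OF V(1)] vec.linear_scale[OF V(2)] vec.linear_scale[OF V(3)]
    have "sw m (\<lambda>m1 m2. sw (e m1) (\<lambda>l l3. sw l (\<lambda>l1 l2. V l1 l2 (z l3 \<cdot> zb m2)))) =
       sw m (\<lambda>m1 m2. sw (sw m1 (\<lambda>a b. zb a \<cdot> b)) (\<lambda>l l3. sw l (\<lambda>l1 l2. V l1 l2 (z l3 \<cdot> zb m2))))"
      by (simp only: e_zb)
    also have "\<dots> = sw m (\<lambda>l m'. sw m' (\<lambda>a m1. sw m1 (\<lambda>b' d. sw (zb l) (\<lambda>s1 s'. sw s' (\<lambda>s2 s3. sw b' (\<lambda>b c. V (s1 \<cdot> a) (s2 \<cdot> b) (z (s3 \<cdot> c) \<cdot> zb d)))))))"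
      by (simp add: norm2 l p sc)
    also have "\<dots> = sw m (\<lambda>l m'. sw m' (\<lambda>a m1. sw m1 (\<lambda>b' d. sw (zb l) (\<lambda>s1 s'. sw s' (\<lambda>s2 s3. sw b' (\<lambda>b c. V (s1 \<cdot> a) (s2 \<cdot> b) (s3 \<cdot> (z c \<cdot> zb d))))))))"
      by (rule sweedler_cong, rule sweedler_cong, rule sweedler_cong, rule sw_cong_B[OF Bs_closed(2)], rule sw_cong_B, assumption, simp add: z_mul mul_assoc, (intro l)+)
    also have "\<dots> = sw m (\<lambda>l m'. sw m' (\<lambda>a m1. sw (zb l) (\<lambda>s1 s'. sw s' (\<lambda>s2 s3. sw m1 (\<lambda>b' d. sw b' (\<lambda>b c. V (s1 \<cdot> a) (s2 \<cdot> b) (s3 \<cdot> (z c \<cdot> zb d))))))))"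
      by (rule sweedler_cong, rule sweedler_cong, subst sweedler_commute, rule sweedler_cong, rule sweedler_commute)
    also have "\<dots> = sw m (\<lambda>l m'. sw m' (\<lambda>a m1. sw (zb l) (\<lambda>s1 s'. sw s' (\<lambda>s2 s3. sw m1 (\<lambda>b m2. V (s1 \<cdot> a) (s2 \<cdot> b) (s3 \<cdot> sw m2 (\<lambda>c d. z c \<cdot> zb d)))))))"
      by (simp only: pull p sw_coassoc l)
    also have "\<dots> = sw m (\<lambda>l m'. sw m' (\<lambda>a b. sw (zb l) (\<lambda>s1 s'. sw s' (\<lambda>s2 s3. V (s1 \<cdot> a) (s2 \<cdot> b) s3))))"
      by (simp only: sw_z_zb scale mul_one sc sw_counit l)
    finally show ?thesis .
  qed
  have expand: "km (km (T a) b) (T c) = sweedler tau (\<lambda>p x. sweedler tau (\<lambda>q y. sweedler tau (\<lambda>r w. sw (eb x) (\<lambda>k1 k2. sw (eb w) (\<lambda>m1 m2.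
     km (J (zb (k2 \<cdot> ev a k1))) (km (km p q) (km (J (ev b y)) (km (J (zb (m2 \<cdot> ev c m1))) r))))))))" for a b c
  proof -
    have "km (km (T a) b) (T c) = sweedler tau (\<lambda>p x. sweedler tau (\<lambda>q y. km (J (zb (ra a (eb x)))) (km (km p q) (km (J (ev b y)) (T c)))))"
      by (simp only: km_T_left sweedler_pull_left[OF lin_km] km_assoc)
    also have "\<dots> = sweedler tau (\<lambda>p x. sweedler tau (\<lambda>q y. sweedler tau (\<lambda>r w. km (J (zb (ra a (eb x)))) (km (km p q) (km (J (ev b y)) (km (J (zb (ra c (eb w)))) r))))))"
      by (simp only: T_tau sweedler_pull_right[OF lin_km])
    also have "\<dots> = sweedler tau (\<lambda>p x. sweedler tau (\<lambda>q y. sweedler tau (\<lambda>r w. sw (eb x) (\<lambda>k1 k2. sw (eb w) (\<lambda>m1 m2.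
     km (J (zb (k2 \<cdot> ev a k1))) (km (km p q) (km (J (ev b y)) (km (J (zb (m2 \<cdot> ev c m1))) r))))))))"
      by (intro sweedler_cong) (simp only: ra_def ze_pull J_pull sweedler_pull_left[OF lin_km], simp only: sweedler_pull_right[OF lin_km])
    finally show ?thesis .
  qed
  have "sweedler3 kphi' (\<lambda>a b c. km (km (T a) b) (T c)) = sweedler tau (\<lambda>p x. sweedler tau (\<lambda>q y. sweedler tau (\<lambda>r w. sw (eb x) (\<lambda>k1 k2. sw (eb w) (\<lambda>m1 m2.
     sweedler3 (ev3 kphi' (k1 \<otimes> y \<otimes> m1)) (\<lambda>u v t. km (J (zb (k2 \<cdot> u))) (km (km p q) (km (J v) (km (J (zb (m2 \<cdot> t))) r)))))))))"
    by (simp only: expand sweedler3_commute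
        sweedler3_ev[where F = "\<lambda>u v t. km (J (zb (k2 \<cdot> u))) (km r' (km (J v) (km (J (zb (m2 \<cdot> t))) r)))" for r k2 m2 r'] lin)
  also have "\<dots> = sweedler tau (\<lambda>p x. sweedler tau (\<lambda>q y. sweedler tau (\<lambda>r w. sw (eb w) (\<lambda>m1 m2. sw (e m1) (\<lambda>l1 l2.
     km (J (zb (eb x \<cdot> z (e y \<cdot> l1)))) (km (km p q) (km (J (z l2 \<cdot> zb m2)) r)))))))"
    by (simp only: ev_kphi' sweedler3_def sweedler_scale sweedler_sweedler sweedler_pure lin mul_one sw_counit
        scale_sweedler[symmetric]) (simp only: J_mul[symmetric] Bs_closed km_assoc)
  also have "\<dots> = sweedler tau (\<lambda>p x. sw x (\<lambda>x1 x2. sweedler tau (\<lambda>r w. sw (eb w) (\<lambda>m1 m2. sw (e m1) (\<lambda>l1 l2.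
     km (J (zb (eb x1 \<cdot> z (e x2 \<cdot> l1)))) (km p (km (J (z l2 \<cdot> zb m2)) r)))))))"
    by (rule tau_mul; (intro lin)?; simp add: e_def eb_def)
  also have "\<dots> = sweedler tau (\<lambda>p x. sweedler tau (\<lambda>r w. sw (eb w) (\<lambda>m1 m2. sw (e m1) (\<lambda>l1 l2.
     km (J (zb (sw x (\<lambda>x1 x2. eb x1 \<cdot> z (e x2 \<cdot> l1))))) (km p (km (J (z l2 \<cdot> zb m2)) r))))))"
    apply (simp only: ze_pull J_pull sweedler_pull_left[OF lin_km])
    apply (rule sweedler_cong)
    apply (subst sweedler_commute, rule sweedler_cong, subst sweedler_commute, rule sweedler_cong, rule sweedler_commute)
    done
  also have "\<dots> = sweedler tau (\<lambda>p x. sweedler tau (\<lambda>r w. sw (eb w) (\<lambda>m1 m2. sw (e m1) (\<lambda>l l3. sw l (\<lambda>l1 l2.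
     km (J (zb (l1 \<cdot> eb (x \<cdot> l2)))) (km p (km (J (z l3 \<cdot> zb m2)) r)))))))"
    by (simp only: core1) (simp only: ze_pull J_pull sweedler_pull_left[OF lin_km])
  also have "\<dots> = sweedler tau (\<lambda>p x. sweedler tau (\<lambda>r w. sw (eb w) (\<lambda>l m'. sw m' (\<lambda>a b. sw (zb l) (\<lambda>s1 s'. sw s' (\<lambda>s2 s3.
     km (J (zb ((s1 \<cdot> a) \<cdot> eb (x \<cdot> (s2 \<cdot> b))))) (km p (km (J s3) r))))))))"
    by (rule sweedler_cong, rule sweedler_cong, rule core2; intro lin)
  also have "\<dots> = sweedler tau (\<lambda>r w. sw (eb w) (\<lambda>l m'. sw m' (\<lambda>a b. sw (zb l) (\<lambda>s1 s'. sweedler tau (\<lambda>p x. sw s' (\<lambda>s2 s3.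
     km (J (zb (s1 \<cdot> (a \<cdot> eb ((x \<cdot> s2) \<cdot> b))))) (km (km p (J s3)) r)))))))"
    apply (simp only: km_assoc mul_assoc)
    apply (subst sweedler_commute, rule sweedler_cong, subst sweedler_commute, rule sweedler_cong,
        subst sweedler_commute, rule sweedler_cong, rule sweedler_commute)
    done
  also have "\<dots> = sweedler tau (\<lambda>r w. sw (eb w) (\<lambda>l m'. sw m' (\<lambda>a b. sw (zb l) (\<lambda>s1 s'. sweedler tau (\<lambda>p x.
     km (J (zb (s1 \<cdot> (a \<cdot> eb (x \<cdot> b))))) (km (km (J s') p) r))))))"
    by (rule sweedler_cong, rule sweedler_cong, rule sweedler_cong, rule sw_cong_B[OF Bs_closed(2)], rule tau_J[symmetric];
      (intro lin)?; simp add: eb_def pi_mul)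
  also have "\<dots> = sweedler tau (\<lambda>r w. sw (eb w) (\<lambda>l m'. sw m' (\<lambda>a b. sweedler tau (\<lambda>p x. eps l *s km (J (zb (a \<cdot> eb (x \<cdot> b)))) (km p r)))))"
    by (rule sweedler_cong, rule sweedler_cong, rule sweedler_cong, subst sweedler_commute, rule sweedler_cong)
      (simp only: km_assoc J_B[OF Bs_closed(2)] eps_zb)
  also have "\<dots> = sweedler tau (\<lambda>r w. sw (eb w) (\<lambda>a b. sweedler tau (\<lambda>p x. km (J (zb (a \<cdot> eb (x \<cdot> b)))) (km p r))))"
    by (simp only: scale_sweedler[symmetric] sw_counit lin)
  also have "\<dots> = sweedler tau (\<lambda>p x. sweedler tau (\<lambda>r w. sw (eb w) (\<lambda>a b. km (J (zb (a \<cdot> eb (x \<cdot> b)))) (km p r))))"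
    by (subst (2) sweedler_commute, rule sweedler_cong, rule sweedler_commute)
  also have "\<dots> = sweedler tau (\<lambda>p x. sw x (\<lambda>x1 x2. sw (eb x2) (\<lambda>a b. km (J (zb (a \<cdot> eb (x1 \<cdot> b)))) p)))"
    by (rule tau_mul; (intro lin)?; simp add: eb_def pi_mul)
  also have "\<dots> = sweedler tau (\<lambda>p x. km (J (zb (eb x \<cdot> eb (one H)))) p)"
    by (rule sweedler_cong, rule sw_eb; (intro lin)?; simp add: eb_def)
  also have "\<dots> = ups"
    by (simp only: eb_one mul_one ups_tau)
  finally show ?thesis .
qed

end

section \<open>Antipodes from preantipodes\<close>

text \<open>Anti-multiplicativity is not assumed; proving it, in the form \<open>T_mult\<close>, is
  the purpose of this locale. The additional argument \<open>b\<close> inside \<open>T\<close> makes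
  up for the missing product rule.\<close>

locale quasi_preantipode =
  fixes K :: "('k::field, 'n::finite) qbialg" and T :: "'k ^ 'n \<Rightarrow> 'k ^ 'n" and v
  assumes quasi_K: "quasi_bialgebra K" and lin_T: "klinear T"
    and T_left: "sweedler (comul K a) (\<lambda>a1 a2. mul K (T (mul K a1 b)) a2) = counit K a *s T b"
    and T_right: "sweedler (comul K a) (\<lambda>a1 a2. mul K a1 (T (mul K b a2))) = counit K a *s T b"
    and T_assoc: "sweedler3 (assoc K) (\<lambda>a b c. mul K (mul K a (T b)) c) = one K"
    and T_assoc_inv: "sweedler3 (assoc_inv K) (\<lambda>a b c. mul K (mul K (T a) b) (T c)) = T (one K)"
    and normal1: "sweedler3 (assoc K) (\<lambda>a b c. counit K a *s (b \<otimes> c)) = one K \<otimes> one K"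
    and normal3: "sweedler3 (assoc K) (\<lambda>a b c. counit K c *s (a \<otimes> b)) = one K \<otimes> one K"
    and normal2_inv: "sweedler3 (assoc_inv K) (\<lambda>a b c. counit K b *s (a \<otimes> c)) = one K \<otimes> one K"
    and T_one_inv: "inverse_in (mul K) (one K) (T (one K)) v"
begin

sublocale multiplicative_comul "mul K" "one K" "comul K"
  by (rule multiplicative_comulI[OF quasi_K])

abbreviation m where "m \<equiv> mul K"
abbreviation \<epsilon> where "\<epsilon> \<equiv> counit K"
abbreviation \<Delta> where "\<Delta> \<equiv> comul K"
abbreviation "m2 \<equiv> tensor_mul m m"

lemmas K = quasi_bialgebraD[OF quasi_K]
lemmas m_assoc = algebra_strD(2)[OF K(1)]
lemmas m_unit [simp] = algebra_strD(3,4)[OF K(1)]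
lemmas lin_p = lins lin_compose[OF lin_T] lin_functional[OF K(3)]
lemmas m_pull = sweedler_pull_left[OF bil(1)] sweedler_pull_right[OF bil(1)] sweedler_pull_left[OF bil(2)] sweedler_pull_right[OF bil(2)]
  linear_sweedler[OF lin_T] linear_sweedler[OF lin_Delta]
lemmas m_scale = vec.linear_scale[OF bilinear_left[OF bil(1) lin_id]] vec.linear_scale[OF bilinear_right[OF bil(1) lin_id]]

text \<open>\<open>Psi\<close> turns the diagonal right action of \<open>K\<close> on \<open>K \<otimes> K\<close> into the action on the second factor.
  It is shown to be surjective, hence bijective; this is the only place where finite dimension is used.\<close>

definition Psi where "Psi t = sweedler t (\<lambda>a b. sweedler3 (assoc K) (\<lambda>x y w.
  sweedler (\<Delta> b) (\<lambda>b1 b2. m a (m x (T (m b1 y))) \<otimes> m b2 w)))"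

lemma lin_Psi: "klinear Psi"
  unfolding Psi_def by (intro lin)

lemma Psi_pure: "Psi (a \<otimes> b) = sweedler3 (assoc K) (\<lambda>x y w.
  sweedler (\<Delta> b) (\<lambda>b1 b2. m a (m x (T (m b1 y))) \<otimes> m b2 w))"
  unfolding Psi_def sweedler3_def by (simp only: sweedler_pure lin_p)

lemma coassoc': "mul3 m (sweedler (\<Delta> c) (\<lambda>c1 c2. c1 \<otimes> \<Delta> c2)) (assoc K) =
   mul3 m (assoc K) (sweedler (\<Delta> c) (\<lambda>c1 c2. sweedler (\<Delta> c1) (\<lambda>c11 c12. c11 \<otimes> c12 \<otimes> c2)))"
  by (simp only: K(12) algebra_strD(2)[OF alg3] K(11) algebra_strD(4)[OF alg3])

lemma counit_left: "klinear f \<Longrightarrow> sweedler (\<Delta> c) (\<lambda>c1 c2. \<epsilon> c1 *s f c2) = f c"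
  and counit_right: "klinear f \<Longrightarrow> sweedler (\<Delta> c) (\<lambda>c1 c2. \<epsilon> c2 *s f c1) = f c"
proof -
  assume f: "klinear f"
  show "sweedler (\<Delta> c) (\<lambda>c1 c2. \<epsilon> c1 *s f c2) = f c"
    by (simp only: vec.linear_scale[OF f, symmetric] linear_sweedler[OF f, symmetric] K(8))
  show "sweedler (\<Delta> c) (\<lambda>c1 c2. \<epsilon> c2 *s f c1) = f c"
    by (simp only: vec.linear_scale[OF f, symmetric] linear_sweedler[OF f, symmetric] K(9))
qed

text \<open>Quasi-coassociativity moves the coproduct of \<open>c\<close> to the other side of the
  associator. There \<open>T_right\<close> reduces \<open>c1\<close> to its counit, and only the
  multiplication by \<open>c\<close> on the second factor remains.\<close>

lemma Psi_comul: "Psi (m2 t (\<Delta> c)) = m2 (Psi t) (one K \<otimes> c)"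
proof -
  have "Psi (m2 (a \<otimes> b) (\<Delta> c)) = m2 (Psi (a \<otimes> b)) (one K \<otimes> c)" for a b
  proof -
    let ?G = "\<lambda>u. sweedler (\<Delta> b) (\<lambda>b1 b2. sweedler3 u (\<lambda>x y w. m a (m x (T (m b1 y))) \<otimes> m b2 w))"
    have "Psi (m2 (a \<otimes> b) (\<Delta> c)) = ?G (mul3 m (sweedler (\<Delta> c) (\<lambda>c1 c2. c1 \<otimes> \<Delta> c2)) (assoc K))"
      apply (simp only: tensor_mul_def[of m m] mul3_def tensor_mul_def[of m "tensor_mul m m"])
      apply (simp only: sweedler_sweedler sweedler_pure lin_p sweedler3_def Psi_def sweedler_Delta_mult)
      apply (simp only: sweedler_swap[where t = "\<Delta> b"])
      apply (simp only: m_pull sweedler_tensor1 sweedler_tensor2 lin_p m_assoc)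
      apply (intro sweedler_cong, rule sweedler_commute)
      done
    also have "\<dots> = ?G (mul3 m (assoc K) (sweedler (\<Delta> c) (\<lambda>c1 c2. sweedler (\<Delta> c1) (\<lambda>c11 c12. c11 \<otimes> c12 \<otimes> c2))))"
      by (simp only: coassoc')
    also have "\<dots> = sweedler (\<Delta> b) (\<lambda>b1 b2. sweedler (assoc K) (\<lambda>x p. sweedler p (\<lambda>y w. sweedler (\<Delta> c) (\<lambda>c1 c2.
        m a (m x (sweedler (\<Delta> c1) (\<lambda>u v. m u (T (m (m b1 y) v))))) \<otimes> m b2 (m w c2)))))"
      apply (simp only: tensor_mul_def[of m m] mul3_def tensor_mul_def[of m "tensor_mul m m"])
      apply (simp only: sweedler_sweedler sweedler_pure lin_p sweedler3_def)
      apply (simp only: m_pull sweedler_tensor1 sweedler_tensor2 lin_p m_assoc)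
      apply (rule sweedler_cong, rule sweedler_cong, subst (2) sweedler_commute, rule sweedler_cong, rule sweedler_commute)
      done
    also have "\<dots> = sweedler (\<Delta> b) (\<lambda>b1 b2. sweedler (assoc K) (\<lambda>x p. sweedler p (\<lambda>y w.
        m a (m x (T (m b1 y))) \<otimes> m b2 (m w c))))"
      by (simp only: T_right m_scale tensor_scale counit_left lin_p)
    also have "\<dots> = m2 (Psi (a \<otimes> b)) (one K \<otimes> c)"
      apply (simp only: tensor_mul_def[of m m] Psi_pure)
      apply (simp only: sweedler_sweedler sweedler_pure lin_p sweedler3_def)
      apply (simp only: sweedler_swap[where t = "\<Delta> b"] m_assoc m_unit)
      done
    finally show ?thesis .
  qed
  then show ?thesis
    by (rule_tac tensor_ext[of "\<lambda>t. Psi (m2 t (\<Delta> c))" "\<lambda>t. m2 (Psi t) (one K \<otimes> c)"]; assumption?; intro lins lin_compose[OF lin_Psi])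
qed

lemma Psi_left: "Psi (m2 (z \<otimes> one K) t) = m2 (z \<otimes> one K) (Psi t)"
  unfolding Psi_def tensor_mul_def[of m m]
  by (simp only: sweedler_sweedler sweedler_pure lin_p sweedler3_def m_unit m_assoc)

text \<open>By \<open>T_right\<close>, each \<open>beta x\<close> is invariant under the diagonal
  right action (\<open>beta_comul\<close>), while \<open>beta (one K)\<close> is \<open>Psi\<close>
  followed by the counit on the second factor (\<open>Psi_counit\<close>). Comparing these two facts
  yields the product rule for \<open>T\<close>.\<close>

definition beta where "beta x t = sweedler t (\<lambda>a b. m a (T (m x b)))"

lemma lin_beta: "klinear (beta x)"
  unfolding beta_def by (intro lin)

lemma beta_scale: "beta x (c *s t) = c *s beta x t"
  by (rule vec.linear_scale[OF lin_beta])

lemma beta_comul: "beta x (m2 t (\<Delta> c)) = \<epsilon> c *s beta x t"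
  unfolding beta_def tensor_mul_def[of m m]
  apply (simp only: sweedler_sweedler sweedler_pure lin_p)
  apply (simp only: m_assoc m_pull(2)[symmetric])
  apply (simp only: m_pull(1)[symmetric] T_right[of c "m x b" for b, unfolded m_assoc] m_scale scale_sweedler)
  done

text \<open>For a trivial associator this is \<open>T (one K) \<otimes> one K\<close>. In general
  the legs are placed so that \<open>Psi n\<close> contains a product that the pentagon can
  rewrite.\<close>

definition n where "n = sweedler3 (assoc_inv K) (\<lambda>x y w. m (T x) y \<otimes> w)"

text \<open>Let \<open>?G\<close> send \<open>a \<otimes> b \<otimes> c \<otimes> d\<close> to
  \<open>T a\<close> times \<open>b\<close> times \<open>T c\<close>, tensored with
  \<open>d\<close>. It does not see a left factor \<open>pl1\<close> of the associator, by
  \<open>T_left\<close> and \<open>normal1\<close>, nor the right factor \<open>pl4\<close> of its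
  inverse, by \<open>T_right\<close> and \<open>normal2_inv\<close>. The rest is
  \<open>T_assoc_inv\<close>.\<close>

lemma Psi_n: "Psi n = T (one K) \<otimes> one K"
proof -
  let ?G = "\<lambda>s. sweedler s (\<lambda>a u. sweedler3 u (\<lambda>b c d. m (T a) (m b (T c)) \<otimes> d))"
  let ?f = "assoc_inv K" and ?g = "assoc K"
  \<comment> \<open>The pentagon solved for the product that occurs in \<open>Psi n\<close>.\<close>
  have "mul4 m (pl2 ?f) (one K \<otimes> ?g) = mul4 m (pl1 ?g) (mul4 m (pl3 ?f) (pl4 ?f))"
  proof -
    note a = algebra_strD(2-4)[OF alg4] and i = pl_inverse[OF K(10)] and j = pl_inverse[OF K(11)]
    have mid: "mul4 m x (mul4 m y w) = w" if "mul4 m x y = one K \<otimes> one K \<otimes> one K \<otimes> one K" for x y w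
      using a(1)[of x y w] that by (simp add: a)
    have "one K \<otimes> ?g = mul4 m (mul4 m (mul4 m (one K \<otimes> ?g) (pl4 ?g)) (pl3 ?g)) (mul4 m (pl3 ?f) (pl4 ?f))"
      by (simp only: a mid[OF i(3)] i)
    also have "\<dots> = mul4 m (mul4 m (pl2 ?g) (pl1 ?g)) (mul4 m (pl3 ?f) (pl4 ?f))"
      by (simp only: K(13) pl1_def pl2_def pl3_def pl4_def)
    finally show ?thesis by (simp only: a mid[OF j(2)])
  qed
  moreover have "Psi n = ?G (mul4 m (pl2 ?f) (one K \<otimes> ?g))"
    unfolding pl2_def n_def Psi_def mul4_def mul3_def
    apply (simp only: tensor_mul_def[of m m] mul3_def tensor_mul_def[of m "tensor_mul m m"] tensor_mul_def[of m "tensor_mul m (tensor_mul m m)"])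
    apply (simp only: sweedler_sweedler sweedler_pure lin_p sweedler3_def)
    apply (simp only: m_pull sweedler_tensor1 sweedler_tensor2 lin_p m_assoc m_unit)
    apply (intro sweedler_cong, rule sweedler_commute)
    done
  moreover have "?G (mul4 m (pl1 ?g) (mul4 m (pl3 ?f) (pl4 ?f))) = T (one K) \<otimes> one K"
  proof -
    have "?G (mul4 m (pl1 ?g) (a \<otimes> b \<otimes> c \<otimes> d)) = ?G (a \<otimes> b \<otimes> c \<otimes> d)" for a b c d
    proof -
      have "?G (mul4 m (pl1 ?g) (a \<otimes> b \<otimes> c \<otimes> d)) = sweedler3 ?g (\<lambda>x y w.
         m (sweedler (\<Delta> x) (\<lambda>x1 x2. m (T (m x1 a)) x2)) (m b (T (m y c))) \<otimes> m w d)"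
        unfolding pl1_def mul4_def mul3_def
        apply (simp only: tensor_mul_def[of m m] tensor_mul_def[of m "tensor_mul m m"] tensor_mul_def[of m "tensor_mul m (tensor_mul m m)"])
        apply (simp only: sweedler_sweedler sweedler_pure lin_p sweedler3_def)
        apply (simp only: m_pull sweedler_tensor1 sweedler_tensor2 lin_p m_assoc m_unit)
        done
      also have "\<dots> = sweedler (sweedler3 ?g (\<lambda>x y w. \<epsilon> x *s (y \<otimes> w))) (\<lambda>y w. m (T a) (m b (T (m y c))) \<otimes> m w d)"
        by (simp only: T_left sweedler_sweedler sweedler_scale sweedler_pure lin_p sweedler3_def m_scale tensor_scale)
      also have "\<dots> = ?G (a \<otimes> b \<otimes> c \<otimes> d)"
        by (simp only: normal1 sweedler_pure lin_p m_unit) (simp only: sweedler3_def sweedler_pure lin_p)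
      finally show ?thesis .
    qed
    then have "?G (mul4 m (pl1 ?g) (a \<otimes> b \<otimes> t)) = ?G (a \<otimes> b \<otimes> t)" for a b t
      by (rule_tac tensor_ext[of "\<lambda>t. ?G (mul4 m (pl1 ?g) (a \<otimes> b \<otimes> t))"]; assumption?; unfold sweedler3_def; intro lins)
    then have "?G (mul4 m (pl1 ?g) (a \<otimes> t)) = ?G (a \<otimes> t)" for a t
      by (rule_tac tensor_ext[of "\<lambda>t. ?G (mul4 m (pl1 ?g) (a \<otimes> t))"]; assumption?; unfold sweedler3_def; intro lins)
    then have 1: "?G (mul4 m (pl1 ?g) t) = ?G t" for t
      by (rule_tac tensor_ext[of "\<lambda>t. ?G (mul4 m (pl1 ?g) t)"]; assumption?; unfold sweedler3_def; intro lins)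
    have 2: "?G (mul4 m (a \<otimes> b \<otimes> c \<otimes> one K) (pl4 ?f)) = m (T a) (m b (T c)) \<otimes> one K" for a b c
    proof -
      have "?G (mul4 m (a \<otimes> b \<otimes> c \<otimes> one K) (pl4 ?f)) = sweedler3 ?f (\<lambda>x y w.
         m (T (m a x)) (m b (sweedler (\<Delta> y) (\<lambda>u v. m u (T (m c v))))) \<otimes> w)"
        unfolding pl4_def mul4_def mul3_def
        apply (simp only: tensor_mul_def[of m m] tensor_mul_def[of m "tensor_mul m m"] tensor_mul_def[of m "tensor_mul m (tensor_mul m m)"])
        apply (simp only: sweedler_sweedler sweedler_pure lin_p sweedler3_def)
        apply (simp only: m_pull sweedler_tensor1 sweedler_tensor2 lin_p m_assoc m_unit)
        done
      also have "\<dots> = sweedler (sweedler3 ?f (\<lambda>x y w. \<epsilon> y *s (x \<otimes> w))) (\<lambda>x w. m (T (m a x)) (m b (T c)) \<otimes> w)"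
        by (simp only: T_right sweedler_sweedler sweedler_scale sweedler_pure lin_p sweedler3_def m_scale tensor_scale)
      also have "\<dots> = m (T a) (m b (T c)) \<otimes> one K"
        by (simp only: normal2_inv sweedler_pure lin_p m_unit)
      finally show ?thesis .
    qed
    have "?G (mul4 m (pl3 ?f) (pl4 ?f)) = sweedler3 ?f (\<lambda>a b c. ?G (mul4 m (a \<otimes> b \<otimes> c \<otimes> one K) (pl4 ?f)))"
      by (simp only: pl3_def sweedler3_def sweedler_pull_left[OF bil(4)] sweedler_sweedler)
    also have "\<dots> = sweedler3 ?f (\<lambda>a b c. m (m (T a) b) (T c)) \<otimes> one K"
      by (simp only: 2) (simp only: sweedler3_def sweedler_tensor1 m_assoc)
    finally show ?thesis by (simp only: 1 T_assoc_inv)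
  qed
  ultimately show ?thesis by simp
qed

text \<open>The inverse of \<open>Psi\<close>. Since \<open>Psi\<close> respects left multiplication
  on the first factor and intertwines the two right actions, the one preimage \<open>n\<close>
  produces a preimage of every \<open>z \<otimes> c\<close>; the factor \<open>v\<close> cancels
  \<open>T (one K)\<close>.\<close>

definition sig where "sig t = sweedler t (\<lambda>z c. m2 (m2 (m z v \<otimes> one K) n) (\<Delta> c))"

lemma lin_sig: "klinear sig"
  unfolding sig_def by (intro lin)

lemma sig_scale: "sig (c *s t) = c *s sig t"
  by (rule vec.linear_scale[OF lin_sig])

lemma sig_pure: "sig (z \<otimes> c) = m2 (m2 (m z v \<otimes> one K) n) (\<Delta> c)"
  by (simp only: sig_def sweedler_pure lin_p)

lemma Psi_sig: "Psi (sig t) = t"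
proof (rule tensor_ext[of "\<lambda>t. Psi (sig t)" "\<lambda>t. t"])
  fix z c
  show "Psi (sig (z \<otimes> c)) = z \<otimes> c"
    using T_one_inv by (simp add: sig_pure Psi_comul Psi_left Psi_n mul2_pure m_assoc inverse_in_def)
qed (intro lin_compose[OF lin_Psi] lin_compose[OF lin_sig] lin_id)+

lemma sig_Psi: "sig (Psi t) = t"
proof -
  have "inj sig" using Psi_sig by (metis injI)
  then have "surj sig" using lin_sig by (intro vec.linear_injective_imp_surjective) auto
  then obtain s where "t = sig s" by blast
  then show ?thesis by (simp only: Psi_sig)
qed

lemma Psi_counit: "sweedler (Psi t) (\<lambda>z c. \<epsilon> c *s z) = beta (one K) t"
proof (rule tensor_ext[of "\<lambda>t. sweedler (Psi t) (\<lambda>z c. \<epsilon> c *s z)"])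
  fix a b
  have "sweedler (Psi (a \<otimes> b)) (\<lambda>z c. \<epsilon> c *s z) = sweedler (sweedler3 (assoc K) (\<lambda>x y w. \<epsilon> w *s (x \<otimes> y))) (\<lambda>x y.
     sweedler (\<Delta> b) (\<lambda>b1 b2. m a (m x (T (m (\<epsilon> b2 *s b1) y)))))"
    apply (simp only: Psi_pure sweedler_sweedler sweedler_pure lin_p sweedler3_def K(6) m_scale vec.scale_scale sweedler_scale tensor_scale)
    apply (simp only: m_pull m_scale vec.linear_scale[OF lin_T] scale_sweedler vec.scale_scale mult.commute)
    done
  then show "sweedler (Psi (a \<otimes> b)) (\<lambda>z c. \<epsilon> c *s z) = beta (one K) (a \<otimes> b)"
    by (simp only: normal3 sweedler_pure lin_p beta_def m_unit vec.linear_scale[OF lin_T] m_scale counit_right)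
qed (intro lin_p lin_compose[OF lin_Psi] lin_beta)+

text \<open>Thus \<open>beta x t\<close> depends on \<open>t\<close> only through
  \<open>beta (one K) t\<close>. Indeed \<open>t\<close> is \<open>sig\<close> of
  \<open>Psi t\<close>; invariance of \<open>beta x\<close> reduces the second factor of
  \<open>Psi t\<close> to its counit, and what is left of \<open>Psi t\<close> is
  \<open>beta (one K) t\<close>.\<close>

lemma beta_beta: "beta x t = beta x (sig (beta (one K) t \<otimes> one K))"
proof -
  have "beta x (sig s) = beta x (sig (sweedler s (\<lambda>z c. \<epsilon> c *s z) \<otimes> one K))" for s
  proof (rule tensor_ext[of "\<lambda>s. beta x (sig s)"])
    fix z c :: "'k ^ 'n"
    have "sweedler (z \<otimes> c) (\<lambda>z c. \<epsilon> c *s z) = \<epsilon> c *s z"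
      by (simp only: sweedler_pure lin_p)
    moreover have "m2 (m2 (m z v \<otimes> one K) n) (one K \<otimes> one K) = m2 (m z v \<otimes> one K) n"
      by (simp only: algebra_strD(4)[OF alg2])
    ultimately show "beta x (sig (z \<otimes> c)) = beta x (sig (sweedler (z \<otimes> c) (\<lambda>z c. \<epsilon> c *s z) \<otimes> one K))"
      by (simp only: tensor_scale sig_scale beta_scale sig_pure beta_comul K(5))
  qed (intro lin_p lin_compose[OF lin_beta] lin_compose[OF lin_sig])+
  from this[of "Psi t"] show ?thesis by (simp only: sig_Psi Psi_counit)
qed

text \<open>The tensors \<open>one K \<otimes> y\<close> and
  \<open>m (T y) v \<otimes> one K\<close> have the same value \<open>T y\<close> under
  \<open>beta (one K)\<close>, because \<open>v\<close> is inverse to \<open>T (one K)\<close>. By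
  \<open>beta_beta\<close> they agree under \<open>beta x\<close> as well, and the two values of
  \<open>beta x\<close> are the two sides of the claim.\<close>

lemma T_mult: "T (m x y) = m (T y) (m v (T x))"
proof -
  have b: "beta x (a \<otimes> b) = m a (T (m x b))" for x a b
    by (simp only: beta_def sweedler_pure lin_p)
  have "T (m x y) = beta x (one K \<otimes> y)" by (simp add: b)
  also have "\<dots> = beta x (sig (T y \<otimes> one K))" by (subst beta_beta) (simp add: b)
  also have "\<dots> = beta x (m (T y) v \<otimes> one K)"
    using T_one_inv by (subst (2) beta_beta) (simp add: b m_assoc inverse_in_def)
  finally show ?thesis by (simp add: b m_assoc)
qed

lemma T_one_v: "m (T (one K)) v = one K" "m v (T (one K)) = one K"
  using T_one_inv by (simp_all add: inverse_in_def)

lemma v_T_one [simp]: "m v (m (T (one K)) x) = x" "m (T (one K)) (m v x) = x"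
  by (simp_all add: T_one_v flip: m_assoc)

lemma pull3: "sweedler3 t (\<lambda>a b c. m x (F a b c)) = m x (sweedler3 t F)" "sweedler3 t (\<lambda>a b c. m (F a b c) y) = m (sweedler3 t F) y"
  by (simp_all only: sweedler3_def m_pull)

lemmas T_conv = T_left[of _ "one K", simplified] T_right[of _ "one K", simplified]

lemma antipode_right: "quasi_antipode K (\<lambda>x. m (T x) v) (T (one K)) (one K)"
  unfolding quasi_antipode_def
proof (intro conjI allI)
  show "klinear (\<lambda>x. m (T x) v)" by (intro lin_p)
  show "m (T (m x y)) v = m (m (T y) v) (m (T x) v)" for x y by (simp add: T_mult m_assoc)
  show "m (T (one K)) v = one K" by (rule T_one_v)
  show "sweedler (\<Delta> x) (\<lambda>x1 x2. m (m (m (T x1) v) (T (one K))) x2) = \<epsilon> x *s T (one K)" for x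
    by (simp add: m_assoc T_conv)
  show "sweedler (\<Delta> x) (\<lambda>x1 x2. m (m x1 (one K)) (m (T x2) v)) = \<epsilon> x *s one K" for x
    by (simp only: m_unit m_assoc[symmetric]) (simp only: m_pull(1,2)[symmetric] T_conv m_scale T_one_v)
  show "sweedler3 (assoc K) (\<lambda>a b c. m (m (m (m a (one K)) (m (T b) v)) (T (one K))) c) = one K"
    using T_assoc by (simp add: m_assoc)
  show "sweedler3 (assoc_inv K) (\<lambda>a b c. m (m (m (m (m (T a) v) (T (one K))) b) (one K)) (m (T c) v)) = one K"
    using T_assoc_inv by (simp add: m_assoc) (simp only: m_assoc[symmetric] pull3 T_one_v)
qed

lemma antipode_left: "quasi_antipode K (\<lambda>x. m v (T x)) (one K) (T (one K))"
  unfolding quasi_antipode_def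
proof (intro conjI allI)
  show "klinear (\<lambda>x. m v (T x))" by (intro lin_p)
  show "m v (T (m x y)) = m (m v (T y)) (m v (T x))" for x y by (simp add: T_mult m_assoc)
  show "m v (T (one K)) = one K" by (rule T_one_v)
  show "sweedler (\<Delta> x) (\<lambda>x1 x2. m (m (m v (T x1)) (one K)) x2) = \<epsilon> x *s one K" for x
    by (simp only: m_unit m_assoc m_pull(1,2)[symmetric] T_conv m_scale T_one_v)
  show "sweedler (\<Delta> x) (\<lambda>x1 x2. m (m x1 (T (one K))) (m v (T x2))) = \<epsilon> x *s T (one K)" for x
    by (simp add: m_assoc T_conv)
  show "sweedler3 (assoc K) (\<lambda>a b c. m (m (m (m a (T (one K))) (m v (T b))) (one K)) c) = one K"
    using T_assoc by (simp add: m_assoc)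
  show "sweedler3 (assoc_inv K) (\<lambda>a b c. m (m (m (m (m v (T a)) (one K)) b) (T (one K))) (m v (T c))) = one K"
    using T_assoc_inv by (simp add: m_assoc pull3 T_one_v)
qed

end

section \<open>The antipodes of the left partial dual\<close>

context partial_dual begin

lemma kphi_normal1: "sweedler3 kphi (\<lambda>a b c. kc a *s (b \<otimes> c)) = ku \<otimes> ku"
proof (rule ev2_ext)
  fix h w
  have "ev2 (sweedler3 kphi (\<lambda>a b c. kc a *s (b \<otimes> c))) (h \<otimes> w) =
     sweedler (ev3 kphi (one H \<otimes> h \<otimes> w)) (\<lambda>p v. sweedler v (\<lambda>q r. eps p *s (q \<otimes> r)))"
    by (simp only: sweedler3_def sweedler_pull[OF bilev2] tens_scale pure_tens kc_eq sweedler_ev3[symmetric] lin)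
  also have "\<dots> = ev2 (ku \<otimes> ku) (h \<otimes> w)"
    apply (simp only: ev_kphi sweedler_scale sweedler_sweedler sweedler_pure lin)
    apply (simp add: norm2 sweedler_pure)
    apply (simp only: z_e sweedler_tensor1[symmetric] sw_zb_z pure_tens ev_ku scale eps_e tensor_scale)
    apply (simp only: vec.scale_left_commute)
    done
  finally show "ev2 (sweedler3 kphi (\<lambda>a b c. kc a *s (b \<otimes> c))) (h \<otimes> w) = ev2 (ku \<otimes> ku) (h \<otimes> w)" .
qed

lemma kphi_normal3: "sweedler3 kphi (\<lambda>a b c. kc c *s (a \<otimes> b)) = ku \<otimes> ku"
proof (rule ev2_ext)
  fix h w
  have "ev2 (sweedler3 kphi (\<lambda>a b c. kc c *s (a \<otimes> b))) (h \<otimes> w) =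
     sweedler (ev3 kphi (h \<otimes> w \<otimes> one H)) (\<lambda>p v. sweedler v (\<lambda>q r. eps r *s (p \<otimes> q)))"
    by (simp only: sweedler3_def sweedler_pull[OF bilev2] tens_scale pure_tens kc_eq sweedler_ev3[symmetric] lin)
  also have "\<dots> = ev2 (ku \<otimes> ku) (h \<otimes> w)"
    apply (simp only: ev_kphi sweedler_scale sweedler_sweedler sweedler_pure lin)
    apply (simp add: norm2 sweedler_pure e_one sw_one z_one)
    apply (simp only: z_e sweedler_tensor1[symmetric] sw_zb_z pure_tens ev_ku scale eps_e tensor_scale)
    apply (simp only: vec.scale_left_commute)
    done
  finally show "ev2 (sweedler3 kphi (\<lambda>a b c. kc c *s (a \<otimes> b))) (h \<otimes> w) = ev2 (ku \<otimes> ku) (h \<otimes> w)" .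
qed

lemma kphi_inv_normal2: "sweedler3 kphi' (\<lambda>a b c. kc b *s (a \<otimes> c)) = ku \<otimes> ku"
proof (rule ev2_ext)
  fix h w
  have "ev2 (sweedler3 kphi' (\<lambda>a b c. kc b *s (a \<otimes> c))) (h \<otimes> w) =
     sweedler (ev3 kphi' (h \<otimes> one H \<otimes> w)) (\<lambda>p v. sweedler v (\<lambda>q r. eps q *s (p \<otimes> r)))"
    by (simp only: sweedler3_def sweedler_pull[OF bilev2] tens_scale pure_tens kc_eq sweedler_ev3[symmetric] lin)
  also have "\<dots> = ev2 (ku \<otimes> ku) (h \<otimes> w)"
    apply (simp only: ev_kphi' sweedler_scale sweedler_sweedler sweedler_pure lin)
    apply (simp add: norm2 sweedler_pure e_one sw_one z_one)
    apply (simp only: z_e sweedler_tensor1[symmetric] sw_zb_z pure_tens ev_ku scale eps_e tensor_scale)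
    apply (simp only: vec.scale_left_commute)
    done
  finally show "ev2 (sweedler3 kphi' (\<lambda>a b c. kc b *s (a \<otimes> c))) (h \<otimes> w) = ev2 (ku \<otimes> ku) (h \<otimes> w)" .
qed

lemma quasi_preantipode_KK: "inverse_in km ku ups v \<Longrightarrow> quasi_preantipode KK T v"
  by (rule quasi_preantipode.intro)
    (simp_all add: quasi_bialgebra_KK lin_T T_left T_right assoc_KK T_assoc T_assoc_inv T_one kphi_normal1 kphi_normal3 kphi_inv_normal2)

lemma antipodes_KK:
  assumes "inverse_in km ku ups v"
  shows "quasi_antipode KK (\<lambda>x. km (T x) v) ups ku" "quasi_antipode KK (\<lambda>x. km v (T x)) ku ups"
  using quasi_preantipode.antipode_right[OF quasi_preantipode_KK[OF assms]]
    quasi_preantipode.antipode_left[OF quasi_preantipode_KK[OF assms]]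
  by (simp_all add: T_one)

end

section \<open>The left partial dual of the dual Hopf algebra\<close>

lemma scalar_product_flip: "scalar_product s (flip t) = scalar_product (flip s) t"
  unfolding scalar_product_def flip_def
  by (rule sum.reindex_bij_witness[of _ prod.swap prod.swap]) auto

lemma vec_scale_cancel: "(\<And>v :: 'k::field ^ 'n::finite. c *s v = d *s v) \<Longrightarrow> c = d"
  by (drule meta_spec[of _ 1]) (simp add: vec_eq_iff)

lemma scalar_product_ext: "(\<And>i. scalar_product x (bas i) = scalar_product y (bas i)) \<Longrightarrow> x = y"
  by (simp add: vec_eq_iff scalar_product_bas)

lemma dual_mul_flip: "dual_mul (\<lambda>x. flip (D x)) f g = dual_mul D g f"
  by (simp add: dual_mul_def vec_eq_iff scalar_product_flip flip_tensor)

text \<open>In dual-basis coordinates the double dual is the space itself, so dualising twice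
  returns the multiplication literally, without an intervening isomorphism.
  \<open>dual_comul_dual_mul\<close> is the counterpart for coproducts.\<close>

lemma dual_mul_dual_comul:
  assumes "kbilinear m"
  shows "dual_mul (dual_comul m) x y = m x y"
proof -
  have "scalar_product (x \<otimes> y) (dual_comul m (bas i)) = m x y $ i" for i
  proof (rule vec_scale_cancel)
    fix v :: "'a ^ 'b"
    have "scalar_product (x \<otimes> y) (dual_comul m (bas i)) *s v =
        sweedler (dual_comul m (bas i)) (\<lambda>a b. scalar_product a x *s (scalar_product b y *s v))"
      by (simp only: tensor_functionals scalar_product_commute[of x] scalar_product_commute[of y])
    also have "\<dots> = m x y $ i *s v"
      by (simp only: dual_comul_sp[OF assms] scalar_product_bas)
    finally show "scalar_product (x \<otimes> y) (dual_comul m (bas i)) *s v = m x y $ i *s v" .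
  qed
  then show ?thesis by (simp add: dual_mul_def vec_eq_iff)
qed

lemma dual_comul_dual_mul:
  assumes "klinear D"
  shows "dual_comul (dual_mul D) x = D x"
proof -
  have "scalar_product x (dual_mul D (bas i) (bas j)) = D x $ (i, j)" for i j
  proof (rule vec_scale_cancel)
    fix v :: "'a ^ 'b"
    show "scalar_product x (dual_mul D (bas i) (bas j)) *s v = D x $ (i, j) *s v"
      by (simp only: scalar_product_commute[of x] dual_mul_sp[OF assms] tensor_functionals[symmetric]) (simp only: bas_tensor scalar_product_bas)
  qed
  then show ?thesis by (simp add: dual_comul_def vec_eq_iff)
qed

lemma dual_comul_op: "dual_comul (\<lambda>x y. m y x) f = flip (dual_comul m f)"
  by (simp add: dual_comul_def flip_def vec_eq_iff)

lemma dual_map_dual_map: "klinear f \<Longrightarrow> dual_map (dual_map f) = f"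
proof (intro ext scalar_product_ext)
  fix x i
  assume f: "klinear f"
  have "scalar_product (dual_map (dual_map f) x) (bas i) = scalar_product (dual_map f (bas i)) x"
    by (simp only: scalar_product_dual_map[OF lin_dual_map] scalar_product_commute[of x])
  also have "\<dots> = scalar_product (f x) (bas i)"
    by (simp only: scalar_product_dual_map[OF f] scalar_product_commute[of "f x"])
  finally show "scalar_product (dual_map (dual_map f) x) (bas i) = scalar_product (f x) (bas i)" .
qed

lemma dual_one_functional: "dual_one (\<lambda>f. scalar_product f x) = x"
  by (simp add: dual_one_def vec_eq_iff scalar_product_bas)

lemma dual_map_dual_one:
  assumes "kfunctional d" "klinear f"
  shows "dual_map f (dual_one d) = dual_one (\<lambda>x. d (f x))"
proof (rule scalar_product_ext)
  fix i
  have "scalar_product (dual_one d) (f (bas i)) = d (f (bas i))"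
    by (rule vec_scale_cancel) (rule dual_one_sp[OF assms(1)])
  then show "scalar_product (dual_map f (dual_one d)) (bas i) = scalar_product (dual_one (\<lambda>x. d (f x))) (bas i)"
    by (simp only: scalar_product_dual_map[OF assms(2)]) (simp only: scalar_product_bas dual_one_def vec_lambda_beta)
qed

context partial_dual begin

abbreviation (input) "Hd \<equiv> op_cop (dual_bialg H)"
abbreviation (input) "Bd \<equiv> dual_comod_alg C"
abbreviation (input) "Cd \<equiv> dual_mod_coalg B"
abbreviation LL where "LL \<equiv> left_partial_dual Hd Bd Cd (dual_map \<pi>) (dual_map \<iota>) (dual_map \<gamma>) (dual_map \<zeta>)"

text \<open>Biduality once more: the action on the dual of \<open>B\<close> was defined by
  transposing the coaction, and transposing it again restores the coaction with its legs
  exchanged.\<close>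

lemma dual_coact_Cd: "dual_coact Cd b = flip (coact B b)"
proof (rule basis_ext[of "dual_coact Cd" "\<lambda>b. flip (coact B b)"])
  show "dual_coact Cd (bas k) = flip (coact B (bas k))" for k
    by (simp add: dual_coact_def dual_mod_coalg_def flip_def vec_eq_iff bas_tensor scalar_product_bas)
qed (intro lin lin_dual_coact lin_compose[OF lin_flip])+

lemma cdual_mul_Cd: "cdual_mul Cd b c = amul B c b"
  by (simp add: dual_mod_coalg_def dual_mul_flip dual_mul_dual_comul bilinear_amul)

lemma cdual_one_Cd: "cdual_one Cd = aone B"
  by (simp add: dual_mod_coalg_def dual_one_functional)

lemma mul_dual_Hd: "mul (dual_bialg Hd) = (\<lambda>x y. y \<cdot> x)" "comul (dual_bialg Hd) = (\<lambda>x. flip (comul H x))"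
proof -
  show "mul (dual_bialg Hd) = (\<lambda>x y. y \<cdot> x)"
    by (intro ext) (simp add: dual_bialg_def op_cop_def dual_mul_flip dual_mul_dual_comul bilinear_mul)
  show "comul (dual_bialg Hd) = (\<lambda>x. flip (comul H x))"
    by (intro ext) (simp add: dual_bialg_def op_cop_def dual_comul_op[of "dual_mul (comul H)"] dual_comul_dual_mul linear_comul)
qed

lemma flip_pull: "flip (sweedler t F) = sweedler t (\<lambda>a b. flip (F a b))" "flip (c *s u) = c *s flip u"
  "flip (\<Sum>i\<in>A. g i) = (\<Sum>i\<in>A. flip (g i))"
  by (rule linear_sweedler vec.linear_scale linear_sum_pull; rule lin_flip)+

text \<open>The cross relation is symmetric in the two factors: it pairs one leg of a functional
  with one leg of an element of \<open>B\<close>, and this pairing can be read from either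
  side.\<close>

lemma mul_LL: "lpd_mul Bd Cd (flip x) (flip y) = flip (km y x)"
proof -
  have "lpd_mul Bd Cd (flip x) (flip y) = sweedler x (\<lambda>f b. sweedler y (\<lambda>g c. sweedler (coact B c) (\<lambda>c1 c2.
      sweedler (dual_coact C f) (\<lambda>f1 f2. scalar_product f2 c1 *s (amul B c2 b \<otimes> cdual_mul C g f1)))))"
    by (simp only: lpd_mul_def sweedler_flip dual_coact_Cd cdual_mul_Cd)
      (simp only: dual_comod_alg_def comod_alg.simps sweedler_flip scalar_product_commute)
  also have "\<dots> = flip (km y x)"
    apply (simp only: lpd_mul_def flip_pull flip_tensor)
    apply (subst sweedler_commute, rule sweedler_cong, rule sweedler_cong, rule sweedler_commute)
    done
  finally show ?thesis .
qed

text \<open>The two pairs of dual bases change roles together with \<open>\<zeta>\<close> and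
  \<open>\<gamma>\<close>, hence the exchange of the two sums at the end.\<close>

lemma comul_LL: "lpd_comul Hd Bd Cd (dual_map \<gamma>) (dual_map \<zeta>) (flip x) = tmap flip flip (flip (kd x))"
proof -
  have "lpd_comul Hd Bd Cd (dual_map \<gamma>) (dual_map \<zeta>) (flip x) = sweedler x (\<lambda>f b. sweedler (coact B b) (\<lambda>b1 b2.
      sweedler (dual_coact C f) (\<lambda>f1 f2. \<Sum>i\<in>UNIV. \<Sum>j\<in>UNIV.
         (b2 \<otimes> cdual_mul C (dual_map \<gamma> (dual_mul (comul H) f2 (dual_map \<zeta> (bas j)))) (bas i)) \<otimes>
         (amul B (bas j) (\<zeta> (\<gamma> (bas i) \<cdot> b1)) \<otimes> f1))))"
    by (simp only: lpd_comul_def sweedler_flip dual_coact_Cd cdual_mul_Cd mul_dual_Hd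
        dual_map_dual_map linear_zeta linear_gamma)
      (simp add: dual_comod_alg_def sweedler_flip op_cop_def dual_bialg_def)
  also have "\<dots> = tmap flip flip (flip (kd x))"
    apply (simp only: lpd_comul_def flip_pull tmap_pull linear_sum_pull[OF lin_tmap] flip_tensor tmap_pure lin_flip)
    apply (simp only: dual_bialg_def bialg.simps)
    apply (subst sum.swap)
    apply (rule sweedler_cong, rule sweedler_commute)
    done
  finally show ?thesis .
qed

lemma counit_LL: "lpd_counit Hd (dual_map \<pi>) (dual_map \<iota>) (flip x) = kc x"
proof -
  have "counit Hd (dual_map \<pi> f) = scalar_product f (\<pi> (one H))" for f
    by (simp add: op_cop_def dual_bialg_def scalar_product_dual_map linear_pi)
  moreover have "dual_map \<iota> (one Hd) = dual_one (\<lambda>b. eps (\<iota> b))"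
    by (simp add: op_cop_def dual_bialg_def dual_map_dual_one functional_eps linear_iota)
  ultimately show ?thesis
    by (simp add: lpd_counit_def dual_one_functional flip_tensor scalar_product_flip[symmetric])
qed

lemma sum_swap4: "(\<Sum>i\<in>I. \<Sum>j\<in>I'. \<Sum>k\<in>A. \<Sum>l\<in>A'. g i j k l) = (\<Sum>k\<in>A. \<Sum>l\<in>A'. \<Sum>i\<in>I. \<Sum>j\<in>I'. g i j k l)"
proof -
  have "(\<Sum>i\<in>I. \<Sum>j\<in>I'. \<Sum>k\<in>A. \<Sum>l\<in>A'. g i j k l) = (\<Sum>i\<in>I. \<Sum>k\<in>A. \<Sum>l\<in>A'. \<Sum>j\<in>I'. g i j k l)"
    by (rule sum.cong[OF refl], subst sum.swap, rule sum.cong[OF refl], rule sum.swap)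
  also have "\<dots> = (\<Sum>k\<in>A. \<Sum>l\<in>A'. \<Sum>i\<in>I. \<Sum>j\<in>I'. g i j k l)"
    by (subst sum.swap, rule sum.cong[OF refl], rule sum.swap)
  finally show ?thesis .
qed

text \<open>Not a mere rereading of the definition: one side sums over bases of \<open>C\<close> and
  uses the coproduct of \<open>H\<close>, the other sums over bases of \<open>B\<close> and uses the
  dual coproduct. Both come from one fourfold sum over the two bases, contracted in different
  orders.\<close>

lemma assoc_inv_LL: "lpd_assoc_inv Hd Bd Cd (dual_map \<gamma>) (dual_map \<zeta>) = tmap flip (tmap flip flip) (flip13 kphi')"
proof -
  let ?X = "\<lambda>i j k l. (aone B \<otimes> bas k) \<otimes> (bas j \<otimes> bas l) \<otimes> (bas i \<otimes> cdual_one C)"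
  have "lpd_assoc_inv Hd Bd Cd (dual_map \<gamma>) (dual_map \<zeta>) = (\<Sum>i\<in>UNIV. \<Sum>j\<in>UNIV.
     sw (\<gamma> (bas i)) (\<lambda>h1 h2. (aone B \<otimes> bas i) \<otimes> (\<zeta> h2 \<otimes> bas j) \<otimes> (\<zeta> (\<gamma> (bas j) \<cdot> h1) \<otimes> cdual_one C)))" (is "_ = ?L")
    by (simp only: lpd_assoc_inv_def sweedler_flip cdual_one_Cd mul_dual_Hd
        dual_map_dual_map linear_zeta linear_gamma) (simp add: dual_comod_alg_def)
  also have "?L = (\<Sum>i\<in>UNIV. \<Sum>j\<in>UNIV. sweedler (dual_comul (mul H) (dual_map \<zeta> (bas i))) (\<lambda>z1 z2.
      (aone B \<otimes> dual_map \<gamma> (dual_mul (comul H) z2 (dual_map \<zeta> (bas j)))) \<otimes> (bas j \<otimes> dual_map \<gamma> z1) \<otimes> (bas i \<otimes> cdual_one C)))" (is "_ = ?R")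
  proof -
    \<comment> \<open>Expanding the two functionals in coordinates introduces the sums over the
      basis of \<open>C\<close>, after which duality turns the coproduct of
      \<open>\<zeta>\<close>-functionals into a product in \<open>H\<close>.\<close>
    have comps: "(aone B \<otimes> P) \<otimes> (bas j \<otimes> Q) \<otimes> (bas i \<otimes> cdual_one C) =
       (\<Sum>k\<in>UNIV. \<Sum>l\<in>UNIV. scalar_product Q (bas l) *s (scalar_product P (bas k) *s ?X i j k l))" for P Q i j
      by (subst sum_components[of "\<lambda>P. (aone B \<otimes> P) \<otimes> (bas j \<otimes> Q) \<otimes> (bas i \<otimes> cdual_one C)"], intro lin,
          subst sum_components[of "\<lambda>Q. (aone B \<otimes> bas k) \<otimes> (bas j \<otimes> Q) \<otimes> (bas i \<otimes> cdual_one C)" for k], intro lin)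
        (simp only: vec.scale_sum_right scalar_product_bas vec.scale_left_commute[of "P $ k" for k])
    have "sweedler (dual_comul (mul H) (dual_map \<zeta> (bas i))) (\<lambda>z1 z2.
        (aone B \<otimes> dual_map \<gamma> (dual_mul (comul H) z2 (dual_map \<zeta> (bas j)))) \<otimes> (bas j \<otimes> dual_map \<gamma> z1) \<otimes> (bas i \<otimes> cdual_one C)) =
      (\<Sum>k\<in>UNIV. \<Sum>l\<in>UNIV. sw (\<gamma> (bas k)) (\<lambda>h1 h2. scalar_product (bas i) (\<zeta> (\<gamma> (bas l) \<cdot> h1)) *s
         (scalar_product (bas j) (\<zeta> h2) *s ?X i j k l)))" for i j
      apply (simp only: comps[of "dual_map \<gamma> x" _ "dual_map \<gamma> y" for x y] scalar_product_dual_map[OF linear_gamma] dual_mul_sp[OF linear_comul] scalar_product_dual_map[OF linear_zeta])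
      apply (simp only: sweedler_sum_commute[symmetric] sweedler_swap[where s="dual_comul m f" for m f])
      apply (simp only: scale_sweedler)
      apply (simp only: sweedler_swap[where s="dual_comul m f" for m f])
      apply (simp only: dual_comul_sp[OF bilinear_mul] scalar_product_dual_map[OF linear_zeta])
      done
    then have "?R = (\<Sum>i\<in>UNIV. \<Sum>j\<in>UNIV. \<Sum>k\<in>UNIV. \<Sum>l\<in>UNIV. sw (\<gamma> (bas k)) (\<lambda>h1 h2. scalar_product (bas i) (\<zeta> (\<gamma> (bas l) \<cdot> h1)) *s
         (scalar_product (bas j) (\<zeta> h2) *s ?X i j k l)))" by (simp only:)
    also have "\<dots> = (\<Sum>k\<in>UNIV. \<Sum>l\<in>UNIV. \<Sum>i\<in>UNIV. \<Sum>j\<in>UNIV. sw (\<gamma> (bas k)) (\<lambda>h1 h2. scalar_product (bas i) (\<zeta> (\<gamma> (bas l) \<cdot> h1)) *s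
         (scalar_product (bas j) (\<zeta> h2) *s ?X i j k l)))"
      by (rule sum_swap4)
    also have "\<dots> = ?L"
    proof (intro sum.cong refl)
      fix k l :: 'c
      have key: "(\<Sum>i\<in>UNIV. scalar_product (bas i) u *s (\<Sum>j\<in>UNIV. scalar_product (bas j) w *s ?X i j k l)) =
        (aone B \<otimes> bas k) \<otimes> (w \<otimes> bas l) \<otimes> (u \<otimes> cdual_one C)" for u w
        by (subst sum_basis[of "\<lambda>w. (aone B \<otimes> bas k) \<otimes> (w \<otimes> bas l) \<otimes> (bas i \<otimes> cdual_one C)" for i], intro lin,
            rule sum_basis[of "\<lambda>u. (aone B \<otimes> bas k) \<otimes> (w \<otimes> bas l) \<otimes> (u \<otimes> cdual_one C)"], intro lin)
      show "(\<Sum>i\<in>UNIV. \<Sum>j\<in>UNIV. sw (\<gamma> (bas k)) (\<lambda>h1 h2. scalar_product (bas i) (\<zeta> (\<gamma> (bas l) \<cdot> h1)) *s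
         (scalar_product (bas j) (\<zeta> h2) *s ?X i j k l))) =
         sw (\<gamma> (bas k)) (\<lambda>h1 h2. (aone B \<otimes> bas k) \<otimes> (\<zeta> h2 \<otimes> bas l) \<otimes> (\<zeta> (\<gamma> (bas l) \<cdot> h1) \<otimes> cdual_one C))"
        by (simp only: sweedler_sum_commute vec.scale_sum_right[symmetric] key)
    qed
    finally show ?thesis ..
  qed
  also have "\<dots> = tmap flip (tmap flip flip) (flip13 kphi')"
    apply (simp only: lpd_assoc_inv_def linear_sum_pull[OF lin_flip13] linear_sum_pull[OF lin_tmap] linear_sweedler[OF lin_flip13]
      tmap_pull flip13_tensor tmap_pure lin_flip lin_tmap flip_tensor)
    apply (simp only: dual_bialg_def bialg.simps)
    done
  finally show ?thesis .
qed

lemma LL_simps: "mul LL = lpd_mul Bd Cd" "one LL = flip ku"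
  "comul LL = lpd_comul Hd Bd Cd (dual_map \<gamma>) (dual_map \<zeta>)" "counit LL = lpd_counit Hd (dual_map \<pi>) (dual_map \<iota>)"
  "assoc_inv LL = lpd_assoc_inv Hd Bd Cd (dual_map \<gamma>) (dual_map \<zeta>)"
  "assoc LL = (THE \<phi>. inverse_in (mul3 (lpd_mul Bd Cd)) (flip ku \<otimes> flip ku \<otimes> flip ku) \<phi> (assoc_inv LL))"
  by (simp_all add: left_partial_dual_def Let_def cdual_one_Cd flip_tensor) (simp_all add: dual_comod_alg_def)

lemma flip_flip: "flip (flip x) = x"
  by (simp add: flip_def vec_eq_iff)

lemma bij_flip: "bij flip"
  by (rule o_bij[of flip]) (simp_all add: fun_eq_iff flip_flip)

lemma algebra_LL: "algebra_str (lpd_mul Bd Cd) (flip ku)"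
proof -
  let ?m = "lpd_mul Bd Cd"
  have m: "?m x y = flip (km (flip y) (flip x))" for x y
    using mul_LL[of "flip x" "flip y"] by (simp only: flip_flip)
  have "kbilinear ?m"
    unfolding kbilinear_def m by (intro conjI allI lin lin_compose[OF lin_flip])
  then show ?thesis unfolding algebra_str_def m by (simp add: flip_flip km_assoc)
qed

lemma algebra_LL3: "algebra_str (mul3 (lpd_mul Bd Cd)) (flip ku \<otimes> flip ku \<otimes> flip ku)"
  unfolding mul3_def by (intro algebra_str_tensor algebra_LL)

text \<open>The flip is multiplicative on threefold tensors, so it carries the inverse relation of
  the opposite quasi-bialgebra to the one that determines \<open>THE\<close>.\<close>

lemma assoc_LL: "assoc LL = tmap flip (tmap flip flip) (flip13 kphi)"
proof -
  interpret op: multiplicative_comul "mul (quasi_op_cop KK)" "one (quasi_op_cop KK)" "comul (quasi_op_cop KK)"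
    by (intro multiplicative_comulI quasi_bialgebra_op_cop quasi_bialgebra_KK)
  let ?m = "lpd_mul Bd Cd" and ?u = "flip ku" and ?t = "tmap flip (tmap flip flip)"
  note bil = algebra_strD(1)[OF algebra_LL]
  have f: "?t (mul3 (\<lambda>x y. km y x) s t) = mul3 ?m (?t s) (?t t)" for s t
    unfolding mul3_def
    by (rule tensor_mul_tmap tensor_mul_tmap lin_tensor_mul bil lin_flip lin_tmap mul_LL[symmetric])+
  have "?t (one (quasi_op_cop KK) \<otimes> one (quasi_op_cop KK) \<otimes> one (quasi_op_cop KK)) = ?u \<otimes> ?u \<otimes> ?u"
    by (simp add: tmap_pure lin_flip lin_tmap)
  then have 1: "mul3 ?m (?t (flip13 kphi)) (assoc_inv LL) = ?u \<otimes> ?u \<otimes> ?u"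
    using quasi_bialgebraD(10)[OF quasi_bialgebra_op_cop[OF quasi_bialgebra_KK]]
    by (simp add: LL_simps(5) assoc_inv_LL assoc_KK f[symmetric])
  have "inverse_in (mul3 ?m) (?u \<otimes> ?u \<otimes> ?u) (?t (flip13 kphi)) (assoc_inv LL)"
    using 1 left_inverse_imp_inverse[OF algebra_LL3 1] by (simp add: inverse_in_def)
  moreover have "x = ?t (flip13 kphi)" if "inverse_in (mul3 ?m) (?u \<otimes> ?u \<otimes> ?u) x (assoc_inv LL)" for x
    using that left_inverse_imp_inverse[OF algebra_LL3 1] inverse_unique[OF algebra_LL3, of x "assoc_inv LL" "?t (flip13 kphi)"]
    by (simp add: inverse_in_def)
  ultimately show ?thesis unfolding LL_simps(6) by (rule the_equality)
qed

lemma transport_LL: "quasi_transport (quasi_op_cop KK) LL flip"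
  by (rule quasi_transport.intro)
    (simp_all only: quasi_bialgebra_op_cop quasi_bialgebra_KK lin_flip bij_flip quasi_op_cop_simps KK_simps LL_simps(1-5)
      mul_LL comul_LL counit_LL assoc_inv_LL assoc_LL assoc_KK)

end

text \<open>Invertibility of \<open>\<upsilon>\<close> enters through a quantified inverse
  \<open>\<upsilon>'\<close>, because both antipodes are written with it. The convolution inverses
  are parameters since \<open>\<upsilon>\<close> and \<open>T\<close> are built from them.\<close>

theorem proposition5p1:
  fixes H :: "('k::field, 'h::finite) bialg"
    and B :: "('k, 'h, 'b::finite) comod_alg"
    and C :: "('k, 'h, 'c::finite) mod_coalg"
    and \<iota> :: "'k ^ 'b \<Rightarrow> 'k ^ 'h" and \<pi> :: "'k ^ 'h \<Rightarrow> 'k ^ 'c"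
    and \<zeta> \<zeta>' :: "'k ^ 'h \<Rightarrow> 'k ^ 'b" and \<gamma> \<gamma>' :: "'k ^ 'c \<Rightarrow> 'k ^ 'h"
    and K :: "('k, 'c \<times> 'b) qbialg" and L :: "('k, 'b \<times> 'c) qbialg"
    and \<theta> :: "'k ^ ('c \<times> 'b) \<Rightarrow> 'k ^ ('b \<times> 'c)"
    and T :: "'k ^ ('c \<times> 'b) \<Rightarrow> 'k ^ ('c \<times> 'b)" and \<upsilon> :: "'k ^ ('c \<times> 'b)"
  assumes hopf: "hopf_algebra H"
    and coideal_subalgebra: "comodule_subalgebra H B \<iota>"
    and quotient: "module_quotient_coalgebra H C \<pi>"
      "{h. \<pi> h = 0} = augmentation_right_ideal H \<iota>"
    and pams: "partially_admissible H B C \<iota> \<pi> \<zeta> \<gamma>"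
    and zeta': "conv_inverse (comul H) (counit H) (amul B) (aone B) \<zeta> \<zeta>'"
    and gamma': "conv_inverse (ccomul C) (ccounit C) (mul H) (one H) \<gamma> \<gamma>'"
  defines "K \<equiv> left_partial_dual H B C \<iota> \<pi> \<zeta> \<gamma>"
    and "L \<equiv> left_partial_dual (op_cop (dual_bialg H)) (dual_comod_alg C) (dual_mod_coalg B)
           (dual_map \<pi>) (dual_map \<iota>) (dual_map \<gamma>) (dual_map \<zeta>)"
    and "\<theta> \<equiv> flip"
    and "\<upsilon> \<equiv> lpd_upsilon B C \<zeta>' \<gamma>'"
    and "T \<equiv> lpd_T H B C \<iota> \<pi> \<zeta>' \<gamma>'"
  shows "quasi_bialgebra_iso (quasi_op_cop K) L \<theta> \<and>
    (\<forall>\<upsilon>'. inverse_in (mul K) (one K) \<upsilon> \<upsilon>' \<longrightarrow>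
      (let S1 = (\<lambda>x. mul K (T x) \<upsilon>'); S2 = (\<lambda>x. mul K \<upsilon>' (T x)) in
        (quasi_antipode (quasi_op_cop K) S1 (cdual_one C \<otimes> aone B) \<upsilon> \<and>
         quasi_antipode L (\<theta> \<circ> S1 \<circ> inv \<theta>) (aone B \<otimes> cdual_one C) (\<theta> \<upsilon>)) \<and>
        (quasi_antipode (quasi_op_cop K) S2 \<upsilon> (cdual_one C \<otimes> aone B) \<and>
         quasi_antipode L (\<theta> \<circ> S2 \<circ> inv \<theta>) (\<theta> \<upsilon>) (aone B \<otimes> cdual_one C))))"
proof -
  interpret partial_dual H B C \<iota> \<pi> \<zeta> \<zeta>' \<gamma> \<gamma>'
    by (rule partial_dual.intro) (fact pams zeta' gamma')+
  interpret L: quasi_transport "quasi_op_cop K" L \<theta>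
    unfolding K_def L_def \<theta>_def by (rule transport_LL)
  have unit: "aone B \<otimes> cdual_one C = \<theta> (cdual_one C \<otimes> aone B)"
    by (simp add: \<theta>_def flip_tensor)
  \<comment> \<open>\<open>antipodes_KK\<close> lists the distinguished elements in the opposite
    order; passing to opposite product and coproduct exchanges \<open>\<alpha>\<close> and
    \<open>\<beta>\<close> and keeps the map.\<close>
  have "quasi_antipode (quasi_op_cop K) (\<lambda>x. mul K (T x) v) (cdual_one C \<otimes> aone B) \<upsilon>"
    "quasi_antipode (quasi_op_cop K) (\<lambda>x. mul K v (T x)) \<upsilon> (cdual_one C \<otimes> aone B)"
    if "inverse_in (mul K) (one K) \<upsilon> v" for v
    using antipodes_KK[of v] that algebra_K unfolding K_def \<upsilon>_def T_def
    by (auto intro!: quasi_antipode_op_cop)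
  then show ?thesis
    unfolding Let_def unit by (blast intro: L.iso_L L.antipode_L)
qed

end
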